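(* Let $X:V\to W$ be a centered stationary Gaussian field with continuous non-degenerate covariance function $\Omega$ and spectral measure $\mu$, let $\eta$ be the law of $X(0)$, let $f\in L^2(\eta)$ with chaotic coefficients $(f_q)_{q\ge 0}$, let $\phi\in L^1\cap L^2(V)$ be real-valued with $\|\phi\|_2=1$, and put $\gamma=|\hat\phi|^2$, $\gamma_\lambda(\xi)=\lambda^d\gamma(\lambda\xi)$. Then for every $\lambda>0$ $$\operatorname{Var}(Z_\lambda(\phi))=\sum_{q=1}^{+\infty}\operatorname{Var}\big(Z_\lambda^{(q)}(\phi)\big),$$ and for every $q\ge 1$ $$\operatorname{Var}\big(Z_\lambda^{(q)}(\phi)\big)=\frac{1}{q!}\int_{V^*}\gamma_\lambda(\xi)\,\mathrm d\mu^{*q}(f_q)(\xi).$$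
   Context: $V,W$ are finite-dimensional real vector spaces of dimensions $d,n$; $V$ carries a Euclidean norm and its Lebesgue measure, $V^*$ the dual norm and Lebesgue measure. $X:V\to W$ is a (measurable) centered stationary Gaussian field whose covariance $\Omega(v)(\ell,m)=\mathbb E[\ell(X(v))\,m(X(0))]$, $\ell,m\in W^*$, is continuous in $v$, with $\Omega(0)$ positive definite. Hermite expansion: $\Omega(0)$ is a scalar product on $W^*$; it is transported by duality to $W$, and to $(W^* )^{\otimes q}$ by $\langle \ell_1\otimes\cdots\otimes\ell_q,m_1\otimes\cdots\otimes m_q\rangle=\prod_k\langle\ell_k,m_k\rangle$. For $x\in W$, $H^q_x=(-1)^q e^{\|x\|^2/2}D^q_x\big[e^{-\|\cdot\|^2/2}\big]$ is a symmetric $q$-linear form on $W$. For $f\in L^2(\eta)$ set $f_q=\int_W f(x)H^q_x\,\mathrm d\eta(x)$ (a symmetric $q$-linear form on $W$) and $\pi_q(f)(x)=\frac1{q!}\langle f_q,H^q_x\rangle$. Functionals: $Z_\lambda(\phi)=\lambda^{-d/2}\int_V\phi(v/\lambda)f(X(v))\,\mathrm dv$ and $Z^{(q)}_\lambda(\phi)=\lambda^{-d/2}\int_V\phi(v/\lambda)\,\pi_q(f)(X(v))\,\mathrm dv$. Fourier transform: $\hat\phi(\xi)=\int_V\phi(v)e^{-2i\pi\xi(v)}\mathrm dv$. Let $W_{\mathbb C}$ be the complexification of $W$. The spectral measure $\mu$ is the measure on $V^*$ with values in positive semi-definite Hermitian forms on $W_{\mathbb C}^*$ such that $\Omega(v)=\int_{V^*}e^{2i\pi\xi(v)}\mathrm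 d\mu(\xi)$ (with $\Omega(v)$ extended sesquilinearly). Its $q$-fold convolution $\mu^{*q}$ is the measure on $V^*$ with values in positive semi-definite Hermitian forms on $(W_{\mathbb C}^* )^{\otimes q}$ determined by $\mu^{*q}(\ell_1\otimes\cdots\otimes\ell_q,m_1\otimes\cdots\otimes m_q)=\mu(\ell_1,m_1)*\cdots*\mu(\ell_q,m_q)$. For $g\in(W_{\mathbb C}^* )^{\otimes q}$, $\mu^{*q}(g)$ denotes the non-negative finite measure $E\mapsto\mu^{*q}(E)(g,g)$. *)

theory Defs
  imports "HOL-Probability.Probability"
begin

text \<open>
  The dual of the Euclidean space \<open>V = 'v\<close> is identified isometrically with \<open>'v\<close> by
  \<open>\<xi>(v) = \<xi> \<bullet> v\<close>. The dual of \<open>W = 'w\<close> is the set of linear functions \<open>'w \<Rightarrow> real\<close>, and its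
  complexification the set of real-linear functions \<open>'w \<Rightarrow> complex\<close>; the inner product of the
  type \<open>'w\<close> only serves to provide a basis (\<open>Basis\<close>) of \<open>W\<close> and the dual basis
  \<open>dual_basis b\<close>. An element of the \<open>q\<close>-th tensor power of the dual of \<open>W\<close> is a \<open>q\<close>-linear form
  on \<open>W\<close>, that is, a function on the lists of vectors of length \<open>q\<close>.
\<close>

definition square_integrable :: "'a measure \<Rightarrow> ('a \<Rightarrow> real) \<Rightarrow> bool" where
  "square_integrable M Y \<longleftrightarrow> Y \<in> borel_measurable M \<and> integrable M (\<lambda>x. (Y x)\<^sup>2)"

definition dual_basis :: "'w::euclidean_space \<Rightarrow> 'w \<Rightarrow> real" where
  "dual_basis b = (\<lambda>w. w \<bullet> b)"

definition multi_indices :: "nat \<Rightarrow> 'w::euclidean_space list set" where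
  "multi_indices q = {I. set I \<subseteq> Basis \<and> length I = q}"


section \<open>Gaussian fields\<close>

text \<open>Constant random variables are Gaussian, with variance zero.\<close>

definition gaussian_rv :: "'a measure \<Rightarrow> ('a \<Rightarrow> real) \<Rightarrow> bool" where
  "gaussian_rv M Y \<longleftrightarrow>
     (\<exists>m. Y \<in> borel_measurable M \<and> (AE \<omega> in M. Y \<omega> = m)) \<or>
     (\<exists>m \<sigma>. \<sigma> > 0 \<and> distributed M lborel Y (\<lambda>x. ennreal (normal_density m \<sigma> x)))"

definition gaussian_field ::
  "'a measure \<Rightarrow> ('v::euclidean_space \<Rightarrow> 'a \<Rightarrow> 'w::euclidean_space) \<Rightarrow> bool" where
  "gaussian_field M X \<longleftrightarrow>
     (\<lambda>(v, \<omega>). X v \<omega>) \<in> borel_measurable (borel \<Otimes>\<^sub>M M) \<and>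
     (\<forall>S l. finite S \<and> (\<forall>v\<in>S. linear (l v :: 'w \<Rightarrow> real)) \<longrightarrow>
        gaussian_rv M (\<lambda>\<omega>. \<Sum>v\<in>S. l v (X v \<omega>)))"

definition centered_field ::
  "'a measure \<Rightarrow> ('v::euclidean_space \<Rightarrow> 'a \<Rightarrow> 'w::euclidean_space) \<Rightarrow> bool" where
  "centered_field M X \<longleftrightarrow> (\<forall>v. has_bochner_integral M (X v) 0)"

definition stationary_field ::
  "'a measure \<Rightarrow> ('v::euclidean_space \<Rightarrow> 'a \<Rightarrow> 'w::euclidean_space) \<Rightarrow> bool" where
  "stationary_field M X \<longleftrightarrow>
     (\<forall>S u. finite S \<longrightarrow>
        distr M (PiM S (\<lambda>_. borel)) (\<lambda>\<omega>. \<lambda>v\<in>S. X (v + u) \<omega>) =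
        distr M (PiM S (\<lambda>_. borel)) (\<lambda>\<omega>. \<lambda>v\<in>S. X v \<omega>))"

definition field_cov ::
  "'a measure \<Rightarrow> ('v::euclidean_space \<Rightarrow> 'a \<Rightarrow> 'w::euclidean_space) \<Rightarrow>
     'v \<Rightarrow> ('w \<Rightarrow> real) \<Rightarrow> ('w \<Rightarrow> real) \<Rightarrow> real" where
  "field_cov M X v l m = (\<integral>\<omega>. l (X v \<omega>) * m (X 0 \<omega>) \<partial>M)"

definition continuous_cov ::
  "('v::euclidean_space \<Rightarrow> ('w::euclidean_space \<Rightarrow> real) \<Rightarrow> ('w \<Rightarrow> real) \<Rightarrow> real) \<Rightarrow> bool" where
  "continuous_cov \<Omega> \<longleftrightarrow>
     (\<forall>l m. linear l \<and> linear m \<longrightarrow> continuous_on UNIV (\<lambda>v. \<Omega> v l m))"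

definition nondegenerate_cov ::
  "('v::euclidean_space \<Rightarrow> ('w::euclidean_space \<Rightarrow> real) \<Rightarrow> ('w \<Rightarrow> real) \<Rightarrow> real) \<Rightarrow> bool" where
  "nondegenerate_cov \<Omega> \<longleftrightarrow> (\<forall>l. linear l \<and> l \<noteq> (\<lambda>_. 0) \<longrightarrow> \<Omega> 0 l l > 0)"


section \<open>Hermite expansion\<close>

text \<open>
  In this section \<open>B\<close> is a scalar product on the dual of \<open>W\<close>, the covariance at \<open>0\<close> in the
  application. \<open>riesz B x\<close> is the linear form corresponding to \<open>x\<close> by duality.
\<close>

definition riesz ::
  "(('w::euclidean_space \<Rightarrow> real) \<Rightarrow> ('w \<Rightarrow> real) \<Rightarrow> real) \<Rightarrow> 'w \<Rightarrow> 'w \<Rightarrow> real" where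
  "riesz B x = (THE l. linear l \<and> (\<forall>m. linear m \<longrightarrow> B l m = m x))"

definition transported_inner ::
  "(('w::euclidean_space \<Rightarrow> real) \<Rightarrow> ('w \<Rightarrow> real) \<Rightarrow> real) \<Rightarrow> 'w \<Rightarrow> 'w \<Rightarrow> real" where
  "transported_inner B x y = B (riesz B x) (riesz B y)"

definition transported_norm ::
  "(('w::euclidean_space \<Rightarrow> real) \<Rightarrow> ('w \<Rightarrow> real) \<Rightarrow> real) \<Rightarrow> 'w \<Rightarrow> real" where
  "transported_norm B x = sqrt (transported_inner B x x)"

text \<open>\<open>iter_deriv h [w\<^sub>1, \<dots>, w\<^sub>q] x\<close> is \<open>D\<^sup>q\<^sub>x h (w\<^sub>1, \<dots>, w\<^sub>q)\<close>.\<close>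

primrec iter_deriv ::
  "('w::euclidean_space \<Rightarrow> real) \<Rightarrow> 'w list \<Rightarrow> 'w \<Rightarrow> real" where
  "iter_deriv h [] x = h x"
| "iter_deriv h (w # ws) x = frechet_derivative (iter_deriv h ws) (at x) w"

definition hermite_form ::
  "(('w::euclidean_space \<Rightarrow> real) \<Rightarrow> ('w \<Rightarrow> real) \<Rightarrow> real) \<Rightarrow> 'w \<Rightarrow> 'w list \<Rightarrow> real" where
  "hermite_form B x ws =
     (-1) ^ length ws * exp ((transported_norm B x)\<^sup>2 / 2) *
     iter_deriv (\<lambda>y. exp (- (transported_norm B y)\<^sup>2 / 2)) ws x"

text \<open>
  The scalar product on the \<open>q\<close>-th tensor power of the dual of \<open>W\<close> induced by \<open>B\<close>. A form \<open>g\<close>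
  is the sum over \<open>I\<close> of \<open>g I\<close> times the tensor product of the \<open>dual_basis (I ! k)\<close>, \<open>k < q\<close>.
\<close>

definition tensor_inner ::
  "(('w::euclidean_space \<Rightarrow> real) \<Rightarrow> ('w \<Rightarrow> real) \<Rightarrow> real) \<Rightarrow> nat \<Rightarrow>
     ('w list \<Rightarrow> real) \<Rightarrow> ('w list \<Rightarrow> real) \<Rightarrow> real" where
  "tensor_inner B q g h =
     (\<Sum>I\<in>multi_indices q. \<Sum>J\<in>multi_indices q.
        g I * h J * (\<Prod>k<q. B (dual_basis (I ! k)) (dual_basis (J ! k))))"

text \<open>\<open>chaos_coeff B \<eta> f\<close>, restricted to the lists of length \<open>q\<close>, is the coefficient \<open>f\<^sub>q\<close>.\<close>

definition chaos_coeff ::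
  "(('w::euclidean_space \<Rightarrow> real) \<Rightarrow> ('w \<Rightarrow> real) \<Rightarrow> real) \<Rightarrow> 'w measure \<Rightarrow>
     ('w \<Rightarrow> real) \<Rightarrow> 'w list \<Rightarrow> real" where
  "chaos_coeff B \<eta> f ws = (\<integral>x. f x * hermite_form B x ws \<partial>\<eta>)"

definition chaos_proj ::
  "(('w::euclidean_space \<Rightarrow> real) \<Rightarrow> ('w \<Rightarrow> real) \<Rightarrow> real) \<Rightarrow> 'w measure \<Rightarrow>
     nat \<Rightarrow> ('w \<Rightarrow> real) \<Rightarrow> 'w \<Rightarrow> real" where
  "chaos_proj B \<eta> q f x = tensor_inner B q (chaos_coeff B \<eta> f) (hermite_form B x) / fact q"


section \<open>The functionals and the Fourier transform\<close>

definition field_functional ::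
  "('v::euclidean_space \<Rightarrow> 'a \<Rightarrow> 'w::euclidean_space) \<Rightarrow> ('w \<Rightarrow> real) \<Rightarrow>
     real \<Rightarrow> ('v \<Rightarrow> real) \<Rightarrow> 'a \<Rightarrow> real" where
  "field_functional X f s \<phi> \<omega> =
     s powr (- real DIM('v) / 2) * (\<integral>v. \<phi> (v /\<^sub>R s) * f (X v \<omega>) \<partial>lborel)"

definition fourier :: "('v::euclidean_space \<Rightarrow> real) \<Rightarrow> 'v \<Rightarrow> complex" where
  "fourier \<phi> \<xi> =
     (\<integral>v. complex_of_real (\<phi> v) * exp (- 2 * \<i> * of_real pi * of_real (\<xi> \<bullet> v)) \<partial>lborel)"

definition spectral_window :: "('v::euclidean_space \<Rightarrow> real) \<Rightarrow> 'v \<Rightarrow> real" where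
  "spectral_window \<phi> \<xi> = (cmod (fourier \<phi> \<xi>))\<^sup>2"

definition scaled_window :: "('v::euclidean_space \<Rightarrow> real) \<Rightarrow> real \<Rightarrow> 'v \<Rightarrow> real" where
  "scaled_window \<phi> s \<xi> = s ^ DIM('v) * spectral_window \<phi> (s *\<^sub>R \<xi>)"


section \<open>Complex Borel measures\<close>

text \<open>
  A signed or complex measure is a countably additive function on the Borel sets. Integration
  uses the Jordan decomposition of the real and imaginary parts: the positive variation of a
  signed measure \<open>\<nu>\<close> maps \<open>E\<close> to the supremum of \<open>\<nu> F\<close> over the Borel subsets \<open>F\<close> of \<open>E\<close>. Since
  \<open>F = {}\<close> is allowed, truncating negative values by \<open>ennreal\<close> does not affect the supremum.
\<close>

definition positive_variation :: "('v::euclidean_space set \<Rightarrow> real) \<Rightarrow> 'v measure" where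
  "positive_variation \<nu> =
     measure_of UNIV (sets borel) (\<lambda>E. SUP F\<in>{F \<in> sets borel. F \<subseteq> E}. ennreal (\<nu> F))"

definition signed_integral ::
  "('v::euclidean_space set \<Rightarrow> real) \<Rightarrow> ('v \<Rightarrow> complex) \<Rightarrow> complex" where
  "signed_integral \<nu> h =
     (\<integral>\<xi>. h \<xi> \<partial>positive_variation \<nu>) - (\<integral>\<xi>. h \<xi> \<partial>positive_variation (\<lambda>E. - \<nu> E))"

definition complex_integral ::
  "('v::euclidean_space set \<Rightarrow> complex) \<Rightarrow> ('v \<Rightarrow> complex) \<Rightarrow> complex" where
  "complex_integral \<nu> h =
     signed_integral (\<lambda>E. Re (\<nu> E)) h + \<i> * signed_integral (\<lambda>E. Im (\<nu> E)) h"

definition measure_conv ::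
  "('v::euclidean_space set \<Rightarrow> complex) \<Rightarrow> ('v set \<Rightarrow> complex) \<Rightarrow> 'v set \<Rightarrow> complex" where
  "measure_conv \<nu> \<rho> E = complex_integral \<nu> (\<lambda>\<xi>. \<rho> {\<zeta>. \<xi> + \<zeta> \<in> E})"

text \<open>The empty convolution product is the Dirac measure at the origin.\<close>

primrec measure_conv_list ::
  "('v::euclidean_space set \<Rightarrow> complex) list \<Rightarrow> 'v set \<Rightarrow> complex" where
  "measure_conv_list [] E = indicator E 0"
| "measure_conv_list (\<nu> # \<nu>s) E = measure_conv \<nu> (measure_conv_list \<nu>s) E"


section \<open>Measures with values in Hermitian forms and the spectral measure\<close>

text \<open>Sesquilinear forms are linear in the first and antilinear in the second argument.\<close>

definition psd_hermitian_on ::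
  "('b \<Rightarrow> complex) set \<Rightarrow> (('b \<Rightarrow> complex) \<Rightarrow> ('b \<Rightarrow> complex) \<Rightarrow> complex) \<Rightarrow> bool" where
  "psd_hermitian_on S H \<longleftrightarrow>
     (\<forall>x\<in>S. \<forall>y\<in>S. \<forall>z\<in>S. \<forall>a b.
        H (\<lambda>t. a * x t + b * y t) z = a * H x z + b * H y z) \<and>
     (\<forall>x\<in>S. \<forall>y\<in>S. H y x = cnj (H x y)) \<and>
     (\<forall>x\<in>S. 0 \<le> Re (H x x))"

definition hermitian_measure_on ::
  "('b \<Rightarrow> complex) set \<Rightarrow>
     ('v::euclidean_space set \<Rightarrow> ('b \<Rightarrow> complex) \<Rightarrow> ('b \<Rightarrow> complex) \<Rightarrow> complex) \<Rightarrow> bool" where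
  "hermitian_measure_on S \<mu> \<longleftrightarrow>
     (\<forall>E\<in>sets borel. psd_hermitian_on S (\<mu> E)) \<and>
     (\<forall>x\<in>S. \<forall>y\<in>S. \<forall>A::nat \<Rightarrow> 'v set. range A \<subseteq> sets borel \<and> disjoint_family A \<longrightarrow>
        (\<lambda>i. \<mu> (A i) x y) sums \<mu> (\<Union>i. A i) x y)"

definition sesquilinear_ext ::
  "(('w \<Rightarrow> real) \<Rightarrow> ('w \<Rightarrow> real) \<Rightarrow> real) \<Rightarrow> ('w \<Rightarrow> complex) \<Rightarrow> ('w \<Rightarrow> complex) \<Rightarrow> complex" where
  "sesquilinear_ext B l m =
     (let l1 = (\<lambda>w. Re (l w)); l2 = (\<lambda>w. Im (l w));
          m1 = (\<lambda>w. Re (m w)); m2 = (\<lambda>w. Im (m w))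
      in of_real (B l1 m1) + \<i> * of_real (B l2 m1)
         - \<i> * of_real (B l1 m2) + of_real (B l2 m2))"

definition is_spectral_measure ::
  "('v::euclidean_space \<Rightarrow> ('w::euclidean_space \<Rightarrow> real) \<Rightarrow> ('w \<Rightarrow> real) \<Rightarrow> real) \<Rightarrow>
     ('v set \<Rightarrow> ('w \<Rightarrow> complex) \<Rightarrow> ('w \<Rightarrow> complex) \<Rightarrow> complex) \<Rightarrow> bool" where
  "is_spectral_measure \<Omega> \<mu> \<longleftrightarrow>
     hermitian_measure_on {l. linear l} \<mu> \<and>
     (\<forall>v l m. linear l \<and> linear m \<longrightarrow>
        sesquilinear_ext (\<Omega> v) l m =
        complex_integral (\<lambda>E. \<mu> E l m) (\<lambda>\<xi>. exp (2 * \<i> * of_real pi * of_real (\<xi> \<bullet> v))))"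

text \<open>
  The \<open>q\<close>-fold convolution, given on tensor products of elements of the dual basis by convolving
  the complex measures \<open>\<mu>(l\<^sub>k, m\<^sub>k)\<close>, and extended sesquilinearly.
\<close>

definition conv_power ::
  "('v::euclidean_space set \<Rightarrow> ('w::euclidean_space \<Rightarrow> complex) \<Rightarrow> ('w \<Rightarrow> complex) \<Rightarrow> complex) \<Rightarrow>
     nat \<Rightarrow> 'v set \<Rightarrow> ('w list \<Rightarrow> complex) \<Rightarrow> ('w list \<Rightarrow> complex) \<Rightarrow> complex" where
  "conv_power \<mu> q E g h =
     (\<Sum>I\<in>multi_indices q. \<Sum>J\<in>multi_indices q.
        g I * cnj (h J) *
        measure_conv_list
          (map (\<lambda>k F. \<mu> F (\<lambda>w. of_real (dual_basis (I ! k) w)) (\<lambda>w. of_real (dual_basis (J ! k) w)))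
             [0..<q]) E)"

text \<open>The finite measure \<open>E \<mapsto> K(E)(g, g)\<close> of a measure \<open>K\<close> with values in Hermitian forms.\<close>

definition diagonal_measure ::
  "('v::euclidean_space set \<Rightarrow> ('b \<Rightarrow> complex) \<Rightarrow> ('b \<Rightarrow> complex) \<Rightarrow> complex) \<Rightarrow>
     ('b \<Rightarrow> complex) \<Rightarrow> 'v measure" where
  "diagonal_measure K g = measure_of UNIV (sets borel) (\<lambda>E. ennreal (Re (K E g g)))"

end

theory Submission
  imports Defs
begin

text \<open>
  Write \<open>X\<^sub>v\<close> for the field at \<open>v\<close>. Every pair \<open>(X\<^sub>v, X\<^sub>w)\<close> is a possibly degenerate Gaussian
  vector. The characteristic function of such a vector gives the integration by parts formula
  \<open>E[(u \<bullet> Z) p(Z)] = E[D p(Z)(C u)]\<close> for polynomials \<open>p\<close>, where \<open>C\<close> is the covariance. Together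
  with \<open>H(w, ws) = \<langle>w, x\<rangle> H(ws) - D\<^sub>w H(ws)\<close> it shows that the covariance of two Hermite forms in
  \<open>X\<^sub>v\<close> and \<open>X\<^sub>w\<close> is a permanent of covariances, hence that
  \<open>E[\<pi>\<^sub>p f(X\<^sub>v) \<pi>\<^sub>q f(X\<^sub>w)]\<close> is the contraction of \<open>f\<^sub>q \<otimes> f\<^sub>q\<close> with \<open>\<Omega>(v - w)\<^sup>\<otimes>\<^sup>q\<close>, divided by \<open>q!\<close>,
  if \<open>p = q\<close>, and zero otherwise.

  The Hermite expansion converges in \<open>L\<^sup>2(\<eta>)\<close>: for \<open>f(x) = cos (k \<bullet> x + \<theta>)\<close> Parseval's identity
  is an explicit exponential series, and trigonometric polynomials are dense. As \<open>Z\<^sub>\<lambda>\<close> is bounded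
  from \<open>L\<^sup>2(\<eta>)\<close> to \<open>L\<^sup>2\<close>, this gives the first formula.

  For the second formula, the spectral measure has a matrix density with positive semi-definite
  values with respect to a finite measure \<open>\<rho>\<close>. Then \<open>\<mu>\<^sup>*\<^sup>q(g)\<close> is the image of a measure with
  non-negative density with respect to \<open>\<rho>\<^sup>q\<close> under \<open>(\<xi>\<^sub>1, \<dots>, \<xi>\<^sub>q) \<mapsto> \<xi>\<^sub>1 + \<dots> + \<xi>\<^sub>q\<close>, and Fubini's
  theorem applies.
\<close>

section \<open>Directional derivatives of polynomial functions\<close>

text \<open>Already for v = w the pair \<open>(X_v, X_w)\<close> has no density, so integration by
  parts cannot start from one. The oscillating factor \<open>cos (k \<bullet> Z + \<theta>)\<close>
  takes its place: each derivative in k produces one linear factor, so that all polynomials are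
  reached from the characteristic function. The same identity, with k kept, yields the Hermite
  coefficients of cosines.

  The factor 1/q! of the variance combines one factor 1/q! from each of two projections with the q!
  terms of a permanent, which contribute equally because the coefficients are symmetric.

  Complex measures and their convolutions are set functions, integrated through Jordan
  decompositions; a common dominating measure turns all these integrals into Bochner integrals of
  densities. The matrix of densities has to be positive semi-definite pointwise, because the
  non-negativity of the convolution power is obtained from tensor products of its values at
  different points. Finally, the covariance depends on v - w only, so the exponential splits into
  two conjugate factors and the double integral becomes the squared modulus of a Fourier
  transform.\<close>

lemmas real_polynomial_function_linear = real_polynomial_function.intros(1)
lemmas real_polynomial_function_const = real_polynomial_function.intros(2)
lemmas real_polynomial_function_mult = real_polynomial_function.intros(4)

lemma real_polynomial_function_inner [intro]:
  "real_polynomial_function (\<lambda>x :: 'e::euclidean_space. u \<bullet> x)"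
  by (intro real_polynomial_function_linear bounded_linear_inner_right)

text \<open>The same \<open>frechet_derivative\<close> as in \<open>iter_deriv\<close>. It is
  applied to polynomials, where the rules of calculus hold without further conditions of
  differentiability.\<close>

definition dir_deriv :: "'e::euclidean_space \<Rightarrow> ('e \<Rightarrow> real) \<Rightarrow> 'e \<Rightarrow> real" where
  "dir_deriv w p x = frechet_derivative p (at x) w"

lemma dir_deriv_eqI: "(p has_derivative p') (at x) \<Longrightarrow> dir_deriv w p x = p' w"
  unfolding dir_deriv_def using frechet_derivative_at by metis

lemma has_derivative_dir_deriv:
  "real_polynomial_function p \<Longrightarrow> (p has_derivative (\<lambda>w. dir_deriv w p x)) (at x)"
  unfolding dir_deriv_def
  using differentiable_at_real_polynomial_function frechet_derivative_works by (metis eta_contract_eq)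

lemma dir_deriv_const [simp]: "dir_deriv w (\<lambda>x. c) x = 0"
  by (rule dir_deriv_eqI) (rule has_derivative_const)

lemma dir_deriv_bounded_linear: "bounded_linear f \<Longrightarrow> dir_deriv w f x = f w"
  by (rule dir_deriv_eqI) (rule bounded_linear_imp_has_derivative)

lemma dir_deriv_add:
  assumes "real_polynomial_function p" "real_polynomial_function q"
  shows "dir_deriv w (\<lambda>x. p x + q x) x = dir_deriv w p x + dir_deriv w q x"
  by (rule dir_deriv_eqI) (intro has_derivative_add has_derivative_dir_deriv assms)

lemma dir_deriv_diff:
  assumes "real_polynomial_function p" "real_polynomial_function q"
  shows "dir_deriv w (\<lambda>x. p x - q x) x = dir_deriv w p x - dir_deriv w q x"
  by (rule dir_deriv_eqI) (intro has_derivative_diff has_derivative_dir_deriv assms)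

lemma dir_deriv_mult:
  assumes "real_polynomial_function p" "real_polynomial_function q"
  shows "dir_deriv w (\<lambda>x. p x * q x) x = p x * dir_deriv w q x + dir_deriv w p x * q x"
  by (rule dir_deriv_eqI) (intro has_derivative_mult has_derivative_dir_deriv assms)

lemma dir_deriv_cmult:
  assumes "real_polynomial_function p"
  shows "dir_deriv w (\<lambda>x. c * p x) x = c * dir_deriv w p x"
  using dir_deriv_mult[OF real_polynomial_function_const assms] by simp

lemma dir_deriv_sum:
  assumes "finite I" "\<And>i. i \<in> I \<Longrightarrow> real_polynomial_function (p i)"
  shows "dir_deriv w (\<lambda>x. \<Sum>i\<in>I. p i x) x = (\<Sum>i\<in>I. dir_deriv w (p i) x)"
  by (rule dir_deriv_eqI) (intro has_derivative_sum has_derivative_dir_deriv assms)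

lemma linear_dir_deriv:
  assumes "real_polynomial_function p"
  shows "linear (\<lambda>w. dir_deriv w p x)"
  using has_derivative_dir_deriv[OF assms] has_derivative_linear by blast

lemma real_polynomial_function_dir_deriv [intro]:
  assumes "real_polynomial_function p"
  shows "real_polynomial_function (dir_deriv w p)"
  using assms
proof induction
  case (linear f)
  then have "dir_deriv w f = (\<lambda>x. f w)" by (auto simp: dir_deriv_bounded_linear)
  then show ?case by auto
next
  case (const c)
  have "dir_deriv w (\<lambda>x. c) = (\<lambda>x::'a. 0)" by auto
  then show ?case by auto
next
  case (add f g)
  then have "dir_deriv w (\<lambda>x. f x + g x) = (\<lambda>x. dir_deriv w f x + dir_deriv w g x)"
    by (auto simp: dir_deriv_add)
  with add show ?case by auto
next
  case (mult f g)
  then have "dir_deriv w (\<lambda>x. f x * g x) = (\<lambda>x. f x * dir_deriv w g x + dir_deriv w f x * g x)"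
    by (auto simp: dir_deriv_mult)
  with mult show ?case by auto
qed

text \<open>Symmetry of second derivatives, for polynomials by structural induction. The symmetry of
  Hermite forms rests on it.\<close>

lemma dir_deriv_commute:
  assumes "real_polynomial_function p"
  shows "dir_deriv v (dir_deriv w p) x = dir_deriv w (dir_deriv v p) x"
  using assms
proof (induction arbitrary: x)
  case (linear f)
  then have "dir_deriv u f = (\<lambda>x. f u)" for u by (auto simp: dir_deriv_bounded_linear)
  then show ?case by simp
next
  case (const c)
  have "dir_deriv u (\<lambda>x. c) = (\<lambda>x::'a. 0)" for u by auto
  then show ?case by auto
next
  case (add f g)
  then have "dir_deriv u (\<lambda>x. f x + g x) = (\<lambda>x. dir_deriv u f x + dir_deriv u g x)" for u
    by (auto simp: dir_deriv_add)
  with add show ?case by (simp add: dir_deriv_add real_polynomial_function_dir_deriv)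
next
  case (mult f g)
  then have "dir_deriv u (\<lambda>x. f x * g x) = (\<lambda>x. f x * dir_deriv u g x + dir_deriv u f x * g x)" for u
    by (auto simp: dir_deriv_mult)
  with mult show ?case
    by (simp add: dir_deriv_add dir_deriv_mult real_polynomial_function_dir_deriv
        real_polynomial_function_mult algebra_simps)
qed

lemma measurable_real_polynomial_function:
  fixes p :: "'e::euclidean_space \<Rightarrow> real"
  assumes "real_polynomial_function p"
  shows "p \<in> borel_measurable borel"
  by (intro borel_measurable_continuous_onI continuous_at_imp_continuous_on ballI
      continuous_real_polymonial_function assms)

text \<open>The Riesz vector for the auxiliary inner product of the type; it trades abstract linear
  forms for inner products.\<close>

lemma bounded_linear_eq_inner:
  fixes f :: "'e::euclidean_space \<Rightarrow> real"
  assumes "linear f"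
  shows "f x = (\<Sum>b\<in>Basis. f b *\<^sub>R b) \<bullet> x"
proof -
  have "f x = f (\<Sum>b\<in>Basis. (x \<bullet> b) *\<^sub>R b)" by (simp add: euclidean_representation)
  also have "\<dots> = (\<Sum>b\<in>Basis. f b *\<^sub>R b) \<bullet> x"
    using assms by (simp add: linear_sum linear_scale inner_sum_left)
      (simp add: inner_commute mult.commute)
  finally show ?thesis .
qed

section \<open>Gaussian vectors\<close>

lemma std_normal_distribution_cos:
  "(LINT x|std_normal_distribution. cos (t * x)) = exp (- t\<^sup>2 / 2)"
  and std_normal_distribution_sin:
  "(LINT x|std_normal_distribution. sin (t * x)) = 0"
proof -
  interpret real_distribution std_normal_distribution by (rule real_dist_normal_dist)
  have int: "integrable std_normal_distribution (\<lambda>x. iexp (t * x))"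
    by (rule integrable_iexp) auto
  have c: "(CLINT x|std_normal_distribution. iexp (t * x)) = complex_of_real (exp (- t\<^sup>2 / 2))"
    using char_std_normal_distribution unfolding char_def fun_eq_iff by auto
  show "(LINT x|std_normal_distribution. cos (t * x)) = exp (- t\<^sup>2 / 2)"
    using arg_cong[OF c, of Re] integral_Re[OF int] by (simp add: Re_exp)
  show "(LINT x|std_normal_distribution. sin (t * x)) = 0"
    using arg_cong[OF c, of Im] integral_Im[OF int] by (simp add: Im_exp)
qed

text \<open>This includes variance zero, where centering forces Y = 0 almost surely. The phase
  \<open>\<theta>\<close> covers cosine and sine by one formula.\<close>

lemma (in prob_space)
  assumes "gaussian_rv M Y" "expectation Y = 0"
  shows integrable_gaussian_power: "integrable M (\<lambda>\<omega>. Y \<omega> ^ n)"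
    and expectation_cos_gaussian:
      "expectation (\<lambda>\<omega>. cos (Y \<omega> + \<theta>)) = cos \<theta> * exp (- expectation (\<lambda>\<omega>. (Y \<omega>)\<^sup>2) / 2)"
proof -
  consider (const) m where "Y \<in> borel_measurable M" "AE \<omega> in M. Y \<omega> = m"
    | (normal) m \<sigma> where "\<sigma> > 0" "distributed M lborel Y (\<lambda>x. ennreal (normal_density m \<sigma> x))"
    using assms(1) unfolding gaussian_rv_def by blast
  then have "integrable M (\<lambda>\<omega>. Y \<omega> ^ n) \<and>
      expectation (\<lambda>\<omega>. cos (Y \<omega> + \<theta>)) = cos \<theta> * exp (- expectation (\<lambda>\<omega>. (Y \<omega>)\<^sup>2) / 2)"
  proof cases
    case const
    note [measurable] = const(1)
    have "expectation Y = expectation (\<lambda>_. m)"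
      using const(2) by (intro integral_cong_AE) auto
    then have "m = 0" using assms(2) by (simp add: prob_space)
    then have ae: "AE \<omega> in M. Y \<omega> = 0" using const by simp
    have "integrable M (\<lambda>\<omega>. Y \<omega> ^ n) \<longleftrightarrow> integrable M (\<lambda>\<omega>. 0 ^ n :: real)"
      using ae by (intro integrable_cong_AE) auto
    moreover have "expectation (\<lambda>\<omega>. cos (Y \<omega> + \<theta>)) = expectation (\<lambda>\<omega>. cos \<theta>)"
      using ae by (intro integral_cong_AE) auto
    moreover have "expectation (\<lambda>\<omega>. (Y \<omega>)\<^sup>2) = expectation (\<lambda>\<omega>. 0)"
      using ae by (intro integral_cong_AE) auto
    ultimately show ?thesis by (simp add: prob_space)
  next
    case normal
    note D = normal(2)
    have m: "m = 0" using normal_distributed_expectation[OF normal] assms(2) by simp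
    have v: "expectation (\<lambda>\<omega>. (Y \<omega>)\<^sup>2) = \<sigma>\<^sup>2"
      using normal_distributed_variance[OF normal] assms(2) by simp
    have 1: "integrable M (\<lambda>\<omega>. Y \<omega> ^ n)"
      using distributed_integrable[OF D, of "\<lambda>x. x ^ n"] integrable_normal_moment[OF normal(1), of 0 n] m
      by (simp add: normal_density_nonneg)
    have S: "distributed M lborel (\<lambda>x. Y x / \<sigma>) std_normal_density"
      using normal_standard_normal_convert[OF normal(1), of Y m] D m by simp
    have meas: "(\<lambda>x. Y x / \<sigma>) \<in> borel_measurable M"
      using distributed_measurable[OF S] by simp
    have L: "distr M borel (\<lambda>x. Y x / \<sigma>) = std_normal_distribution"
      using distributed_distr_eq_density[OF S] by (simp cong: distr_cong)
    have c: "expectation (\<lambda>\<omega>. cos (\<sigma> * (Y \<omega> / \<sigma>))) = exp (- \<sigma>\<^sup>2 / 2)"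
      using std_normal_distribution_cos[of \<sigma>] meas unfolding L[symmetric]
      by (subst (asm) integral_distr) auto
    have s: "expectation (\<lambda>\<omega>. sin (\<sigma> * (Y \<omega> / \<sigma>))) = 0"
      using std_normal_distribution_sin[of \<sigma>] meas unfolding L[symmetric]
      by (subst (asm) integral_distr) auto
    have mY[measurable]: "Y \<in> borel_measurable M"
      using distributed_measurable[OF D] by simp
    have ic: "integrable M (\<lambda>\<omega>. cos (Y \<omega>))" "integrable M (\<lambda>\<omega>. sin (Y \<omega>))"
      by (auto intro!: integrable_const_bound[where B=1])
    have "expectation (\<lambda>\<omega>. cos (Y \<omega> + \<theta>)) =
        expectation (\<lambda>\<omega>. cos \<theta> * cos (Y \<omega>) - sin \<theta> * sin (Y \<omega>))"
      by (simp add: cos_add mult.commute)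
    also have "\<dots> = cos \<theta> * exp (- \<sigma>\<^sup>2 / 2)"
      using ic c s normal(1) by simp
    finally show ?thesis using 1 v by simp
  qed
  then show "integrable M (\<lambda>\<omega>. Y \<omega> ^ n)"
    "expectation (\<lambda>\<omega>. cos (Y \<omega> + \<theta>)) = cos \<theta> * exp (- expectation (\<lambda>\<omega>. (Y \<omega>)\<^sup>2) / 2)"
    by auto
qed

text \<open>Only one-dimensional marginals are prescribed, so the law of Z may live on a proper
  subspace, as it does for a vector of the form (X, X).\<close>

locale gaussian_vector = prob_space M for M :: "'a measure" +
  fixes Z :: "'a \<Rightarrow> 'e::euclidean_space"
  assumes measurable_Z [measurable]: "Z \<in> borel_measurable M"
    and gaussian: "gaussian_rv M (\<lambda>\<omega>. u \<bullet> Z \<omega>)"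
    and centered: "expectation (\<lambda>\<omega>. u \<bullet> Z \<omega>) = 0"
begin

definition cov :: "'e \<Rightarrow> 'e \<Rightarrow> real" where
  "cov u k = expectation (\<lambda>\<omega>. (u \<bullet> Z \<omega>) * (k \<bullet> Z \<omega>))"

text \<open>The covariance operator applied to u; \<open>inner_cov_vec\<close> is its defining
  property.\<close>

definition cov_vec :: "'e \<Rightarrow> 'e" where
  "cov_vec u = (\<Sum>b\<in>Basis. cov u b *\<^sub>R b)"

text \<open>All exponents are treated at once because the product case at exponent n uses both
  factors at exponent 2 * n.\<close>

lemma integrable_polynomial_power:
  assumes "real_polynomial_function p"
  shows "integrable M (\<lambda>\<omega>. \<bar>p (Z \<omega>)\<bar> ^ n)"
  using assms
proof (induction arbitrary: n)
  case (linear f)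
  then obtain u where f: "f = (\<lambda>x. u \<bullet> x)"
    using bounded_linear_eq_inner[OF bounded_linear.linear] by blast
  have "integrable M (\<lambda>\<omega>. f (Z \<omega>) ^ n)"
    unfolding f by (rule integrable_gaussian_power[OF gaussian centered])
  from integrable_abs[OF this] show ?case by (simp add: power_abs)
next
  case (const c)
  then show ?case by simp
next
  case (add f g)
  have [measurable]: "f \<in> borel_measurable borel" "g \<in> borel_measurable borel"
    using add by (auto intro: measurable_real_polynomial_function)
  have "\<bar>a + b\<bar> ^ n \<le> 2 ^ n * (\<bar>a\<bar> ^ n + \<bar>b\<bar> ^ n)" for a b :: real
  proof -
    have "\<bar>a + b\<bar> ^ n \<le> (2 * max \<bar>a\<bar> \<bar>b\<bar>) ^ n" by (intro power_mono) auto
    also have "\<dots> = 2 ^ n * (max \<bar>a\<bar> \<bar>b\<bar>) ^ n" by (simp add: power_mult_distrib)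
    also have "\<dots> \<le> 2 ^ n * (\<bar>a\<bar> ^ n + \<bar>b\<bar> ^ n)" by (intro mult_left_mono) (auto simp: max_def)
    finally show ?thesis .
  qed
  then show ?case
    by (intro Bochner_Integration.integrable_bound[where g="\<lambda>\<omega>. \<bar>f (Z \<omega>) + g (Z \<omega>)\<bar> ^ n"
          and f="\<lambda>\<omega>. 2 ^ n * (\<bar>f (Z \<omega>)\<bar> ^ n + \<bar>g (Z \<omega>)\<bar> ^ n)"])
       (auto intro!: Bochner_Integration.integrable_add integrable_mult_right add.IH)
next
  case (mult f g)
  have [measurable]: "f \<in> borel_measurable borel" "g \<in> borel_measurable borel"
    using mult by (auto intro: measurable_real_polynomial_function)
  have "\<bar>a * b\<bar> ^ n \<le> \<bar>a\<bar> ^ (2 * n) + \<bar>b\<bar> ^ (2 * n)" for a b :: real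
  proof -
    have "\<bar>a * b\<bar> ^ n = \<bar>a\<bar> ^ n * \<bar>b\<bar> ^ n" by (simp add: abs_mult power_mult_distrib)
    also have "\<dots> \<le> (\<bar>a\<bar> ^ n)\<^sup>2 + (\<bar>b\<bar> ^ n)\<^sup>2"
      using sum_squares_bound[of "\<bar>a\<bar> ^ n" "\<bar>b\<bar> ^ n"]
        mult_nonneg_nonneg[of "\<bar>a\<bar> ^ n" "\<bar>b\<bar> ^ n"] zero_le_power[OF abs_ge_zero, of a n] zero_le_power[OF abs_ge_zero, of b n] by linarith
    finally show ?thesis by (simp add: power_mult mult.commute[of 2])
  qed
  then show ?case
    by (intro Bochner_Integration.integrable_bound[where g="\<lambda>\<omega>. \<bar>f (Z \<omega>) * g (Z \<omega>)\<bar> ^ n"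
          and f="\<lambda>\<omega>. \<bar>f (Z \<omega>)\<bar> ^ (2 * n) + \<bar>g (Z \<omega>)\<bar> ^ (2 * n)"])
       (auto intro!: Bochner_Integration.integrable_add mult.IH)
qed

lemma integrable_polynomial:
  assumes "real_polynomial_function p"
  shows "integrable M (\<lambda>\<omega>. p (Z \<omega>))"
proof -
  have [measurable]: "p \<in> borel_measurable borel"
    using assms by (rule measurable_real_polynomial_function)
  show ?thesis
    using integrable_polynomial_power[OF assms, of 1] by (auto intro: integrable_abs_cancel)
qed

lemma integrable_polynomial_mult_bounded:
  assumes "real_polynomial_function p" and [measurable]: "h \<in> borel_measurable M"
    and "\<And>\<omega>. \<bar>h \<omega>\<bar> \<le> 1"
  shows "integrable M (\<lambda>\<omega>. p (Z \<omega>) * h \<omega>)"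
proof -
  have [measurable]: "p \<in> borel_measurable borel"
    using assms(1) by (rule measurable_real_polynomial_function)
  show ?thesis
    by (rule Bochner_Integration.integrable_bound[OF integrable_polynomial[OF assms(1)]])
       (use assms(3) in \<open>auto simp: abs_mult mult_left_le\<close>)
qed

lemma integrable_inner2: "integrable M (\<lambda>\<omega>. (u \<bullet> Z \<omega>) * (k \<bullet> Z \<omega>))"
  using integrable_polynomial[of "\<lambda>z. (u \<bullet> z) * (k \<bullet> z)"] by blast

lemma cov_commute: "cov u k = cov k u"
  by (simp add: cov_def mult.commute)

lemma cov_add_left: "cov (u + v) k = cov u k + cov v k"
  by (simp add: cov_def inner_add_left distrib_right integrable_inner2)

lemma cov_scale_left: "cov (c *\<^sub>R u) k = c * cov u k"
  by (simp add: cov_def mult.assoc)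

lemma cov_add_right: "cov u (k + v) = cov u k + cov u v"
  using cov_add_left cov_commute by metis

lemma cov_scale_right: "cov u (c *\<^sub>R k) = c * cov u k"
  using cov_scale_left cov_commute by metis

lemma inner_cov_vec: "k \<bullet> cov_vec u = cov u k"
proof -
  have lin: "linear (cov u)" by (rule linearI) (auto simp: cov_add_right cov_scale_right)
  show ?thesis
    unfolding cov_vec_def using bounded_linear_eq_inner[OF lin, of k] by (simp add: inner_commute)
qed

lemma expectation_cos:
  "expectation (\<lambda>\<omega>. cos (k \<bullet> Z \<omega> + \<theta>)) = cos \<theta> * exp (- cov k k / 2)"
  using expectation_cos_gaussian[OF gaussian centered, of k \<theta>] by (simp add: cov_def power2_eq_square)

text \<open>Differentiation under the expectation. The cosine is 1-Lipschitz, so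
  \<open>\<bar>G \<omega> * (m \<bullet> Z \<omega>)\<bar>\<close> dominates all difference
  quotients in the direction m.\<close>

lemma has_derivative_expectation_cos:
  assumes "integrable M G" "integrable M (\<lambda>\<omega>. G \<omega> * (m \<bullet> Z \<omega>))"
  shows "((\<lambda>t. expectation (\<lambda>\<omega>. G \<omega> * cos ((k + t *\<^sub>R m) \<bullet> Z \<omega> + \<theta>))) has_real_derivative
    - expectation (\<lambda>\<omega>. G \<omega> * (m \<bullet> Z \<omega>) * sin (k \<bullet> Z \<omega> + \<theta>))) (at 0)"
proof -
  have [measurable]: "G \<in> borel_measurable M" using assms by auto
  have intG: "integrable M (\<lambda>\<omega>. G \<omega> * cos (a \<bullet> Z \<omega> + \<theta>))" for a
    by (rule Bochner_Integration.integrable_bound[OF assms(1)]) (auto simp: abs_mult mult_left_le)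
  define q where "q t \<omega> = G \<omega> * ((cos ((k + t *\<^sub>R m) \<bullet> Z \<omega> + \<theta>) - cos (k \<bullet> Z \<omega> + \<theta>)) / t)" for t \<omega>
  have [measurable]: "q t \<in> borel_measurable M" for t unfolding q_def by measurable
  have lim: "((\<lambda>t. expectation (q t)) \<longlongrightarrow> expectation (\<lambda>\<omega>. - (G \<omega> * (m \<bullet> Z \<omega>) * sin (k \<bullet> Z \<omega> + \<theta>)))) (at 0)"
    unfolding tendsto_at_iff_sequentially comp_def
  proof (intro allI impI, rule integral_dominated_convergence[where w="\<lambda>\<omega>. \<bar>G \<omega> * (m \<bullet> Z \<omega>)\<bar>"])
    fix T :: "nat \<Rightarrow> real" assume T: "\<forall>i. T i \<in> UNIV - {0}" "T \<longlonglongrightarrow> 0"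
    show "integrable M (\<lambda>\<omega>. \<bar>G \<omega> * (m \<bullet> Z \<omega>)\<bar>)" using assms(2) by (rule integrable_abs)
    show "AE \<omega> in M. (\<lambda>i. q (T i) \<omega>) \<longlonglongrightarrow> - (G \<omega> * (m \<bullet> Z \<omega>) * sin (k \<bullet> Z \<omega> + \<theta>))"
    proof (intro AE_I2)
      fix \<omega>
      have "((\<lambda>t. cos ((k + t *\<^sub>R m) \<bullet> Z \<omega> + \<theta>)) has_real_derivative - sin (k \<bullet> Z \<omega> + \<theta>) * (m \<bullet> Z \<omega>)) (at 0)"
        by (auto intro!: derivative_eq_intros simp: inner_add_left)
      then have "((\<lambda>t. (cos ((k + t *\<^sub>R m) \<bullet> Z \<omega> + \<theta>) - cos (k \<bullet> Z \<omega> + \<theta>)) / t) \<longlongrightarrow>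
          - sin (k \<bullet> Z \<omega> + \<theta>) * (m \<bullet> Z \<omega>)) (at 0)"
        by (simp add: has_field_derivative_iff)
      then have "((\<lambda>t. q t \<omega>) \<longlongrightarrow> G \<omega> * (- sin (k \<bullet> Z \<omega> + \<theta>) * (m \<bullet> Z \<omega>))) (at 0)"
        unfolding q_def by (intro tendsto_intros)
      then show "(\<lambda>i. q (T i) \<omega>) \<longlonglongrightarrow> - (G \<omega> * (m \<bullet> Z \<omega>) * sin (k \<bullet> Z \<omega> + \<theta>))"
        using T unfolding tendsto_at_iff_sequentially comp_def by (auto simp: mult_ac)
    qed
    have cosd: "\<bar>cos x - cos y\<bar> \<le> \<bar>x - y\<bar>" for x y :: real
    proof -
      have "\<bar>cos x - cos y\<bar> = 2 * \<bar>sin ((x + y) / 2)\<bar> * \<bar>sin ((y - x) / 2)\<bar>"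
        by (simp add: cos_diff_cos abs_mult)
      also have "\<dots> \<le> 2 * 1 * \<bar>(y - x) / 2\<bar>"
        by (intro mult_mono abs_sin_x_le_abs_x) auto
      finally show ?thesis by simp
    qed
    show "AE \<omega> in M. norm (q (T i) \<omega>) \<le> \<bar>G \<omega> * (m \<bullet> Z \<omega>)\<bar>" for i
    proof (intro AE_I2)
      fix \<omega>
      have "T i \<noteq> 0" using T by auto
      then have "\<bar>(cos ((k + T i *\<^sub>R m) \<bullet> Z \<omega> + \<theta>) - cos (k \<bullet> Z \<omega> + \<theta>)) / T i\<bar> \<le> \<bar>m \<bullet> Z \<omega>\<bar>"
        using cosd[of "(k + T i *\<^sub>R m) \<bullet> Z \<omega> + \<theta>" "k \<bullet> Z \<omega> + \<theta>"]
        by (simp add: inner_add_left field_simps abs_mult)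
      then show "norm (q (T i) \<omega>) \<le> \<bar>G \<omega> * (m \<bullet> Z \<omega>)\<bar>"
        unfolding q_def by (simp add: abs_mult mult_left_mono del: abs_divide times_divide_eq_right)
    qed
  qed auto
  have "expectation (q t) = (expectation (\<lambda>\<omega>. G \<omega> * cos ((k + t *\<^sub>R m) \<bullet> Z \<omega> + \<theta>)) -
      expectation (\<lambda>\<omega>. G \<omega> * cos (k \<bullet> Z \<omega> + \<theta>))) / t" for t
    unfolding q_def using intG by (simp add: right_diff_distrib diff_divide_distrib)
  with lim show ?thesis
    by (simp add: has_field_derivative_iff)
qed

text \<open>The real form of E[(u Z) p(Z) e^(ikZ)] = E[D p(Z) e^(ikZ)] + i cov(u, k)
  E[p(Z) e^(ikZ)], where D is the derivative along \<open>cov_vec u\<close>: the exponential is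
  differentiated along with p. The parameter k is kept free so that the identity can be
  differentiated in k; integration by parts itself is the case k = 0.\<close>

definition stein :: "('e \<Rightarrow> real) \<Rightarrow> bool" where
  "stein p \<longleftrightarrow> (\<forall>u k \<theta>. expectation (\<lambda>\<omega>. (u \<bullet> Z \<omega>) * p (Z \<omega>) * cos (k \<bullet> Z \<omega> + \<theta>)) =
     expectation (\<lambda>\<omega>. dir_deriv (cov_vec u) p (Z \<omega>) * cos (k \<bullet> Z \<omega> + \<theta>))
     - cov u k * expectation (\<lambda>\<omega>. p (Z \<omega>) * sin (k \<bullet> Z \<omega> + \<theta>)))"

text \<open>Two computations of the derivative of the characteristic function at k in the direction
  u are equated: one under the expectation, the other from the closed formula
  \<open>expectation_cos\<close>.\<close>

lemma stein_one: "stein (\<lambda>_. 1)"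
  unfolding stein_def
proof (intro allI)
  fix u k \<theta>
  \<comment> \<open>The quarter turn converts the sine produced by differentiation into the cosine
    of \<open>stein\<close>.\<close>
  define \<theta>' where "\<theta>' = \<theta> + pi / 2"
  have sc: "cos (x + \<theta>') = - sin (x + \<theta>)" "sin (x + \<theta>') = cos (x + \<theta>)" for x
    using cos_add[of "x + \<theta>" "pi / 2"] sin_add[of "x + \<theta>" "pi / 2"]
    by (simp_all add: \<theta>'_def add.assoc)
  have "((\<lambda>t. expectation (\<lambda>\<omega>. 1 * cos ((k + t *\<^sub>R u) \<bullet> Z \<omega> + \<theta>'))) has_real_derivative
    - expectation (\<lambda>\<omega>. 1 * (u \<bullet> Z \<omega>) * sin (k \<bullet> Z \<omega> + \<theta>'))) (at 0)"
    by (rule has_derivative_expectation_cos) (auto intro: integrable_polynomial)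
  moreover have "((\<lambda>t. cos \<theta>' * exp (- cov (k + t *\<^sub>R u) (k + t *\<^sub>R u) / 2)) has_real_derivative
    - (cos \<theta>' * exp (- cov k k / 2)) * cov u k) (at 0)"
    unfolding cov_add_left cov_add_right cov_scale_left cov_scale_right
    by (auto intro!: derivative_eq_intros simp: cov_commute[of k u] field_simps)
  ultimately have "- expectation (\<lambda>\<omega>. 1 * (u \<bullet> Z \<omega>) * sin (k \<bullet> Z \<omega> + \<theta>')) =
      - expectation (\<lambda>\<omega>. cos (k \<bullet> Z \<omega> + \<theta>')) * cov u k"
    unfolding expectation_cos mult_1 by (rule DERIV_unique)
  then show "expectation (\<lambda>\<omega>. (u \<bullet> Z \<omega>) * 1 * cos (k \<bullet> Z \<omega> + \<theta>)) =
     expectation (\<lambda>\<omega>. dir_deriv (cov_vec u) (\<lambda>_. 1) (Z \<omega>) * cos (k \<bullet> Z \<omega> + \<theta>))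
     - cov u k * expectation (\<lambda>\<omega>. 1 * sin (k \<bullet> Z \<omega> + \<theta>))"
    by (simp add: sc mult.commute)
qed

lemma stein_add:
  assumes "real_polynomial_function p" "real_polynomial_function q" "stein p" "stein q"
  shows "stein (\<lambda>x. p x + q x)"
  unfolding stein_def
proof (intro allI)
  fix u k \<theta>
  have I: "integrable M (\<lambda>\<omega>. r (Z \<omega>) * cos (k \<bullet> Z \<omega> + \<theta>))"
     "integrable M (\<lambda>\<omega>. r (Z \<omega>) * sin (k \<bullet> Z \<omega> + \<theta>))" if "real_polynomial_function r" for r
    using that by (auto intro: integrable_polynomial_mult_bounded)
  have I2: "integrable M (\<lambda>\<omega>. (u \<bullet> Z \<omega>) * r (Z \<omega>) * cos (k \<bullet> Z \<omega> + \<theta>))" if "real_polynomial_function r" for r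
    using I(1)[of "\<lambda>z. (u \<bullet> z) * r z"] that by auto
  show "expectation (\<lambda>\<omega>. (u \<bullet> Z \<omega>) * (p (Z \<omega>) + q (Z \<omega>)) * cos (k \<bullet> Z \<omega> + \<theta>)) =
     expectation (\<lambda>\<omega>. dir_deriv (cov_vec u) (\<lambda>x. p x + q x) (Z \<omega>) * cos (k \<bullet> Z \<omega> + \<theta>))
     - cov u k * expectation (\<lambda>\<omega>. (p (Z \<omega>) + q (Z \<omega>)) * sin (k \<bullet> Z \<omega> + \<theta>))"
    using assms
    by (simp add: dir_deriv_add distrib_left distrib_right I I2 real_polynomial_function_dir_deriv stein_def)
qed

text \<open>Differentiating the identity \<^term>\<open>stein p\<close> in \<open>k\<close> multiplies \<open>p\<close> by a linear form.\<close>

lemma stein_inner_mult: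
  assumes p: "real_polynomial_function p" and "stein p"
  shows "stein (\<lambda>x. (m \<bullet> x) * p x)"
  unfolding stein_def
proof (intro allI)
  fix u k \<theta>
  define \<theta>' where "\<theta>' = \<theta> + pi / 2"
  have sc: "cos (x + \<theta>') = - sin (x + \<theta>)" "sin (x + \<theta>') = cos (x + \<theta>)" for x
    using cos_add[of "x + \<theta>" "pi / 2"] sin_add[of "x + \<theta>" "pi / 2"]
    by (simp_all add: \<theta>'_def add.assoc)
  let ?d = "dir_deriv (cov_vec u) p"
  have d: "real_polynomial_function ?d" using p by auto
  have D: "((\<lambda>t. expectation (\<lambda>\<omega>. r (Z \<omega>) * cos ((k + t *\<^sub>R m) \<bullet> Z \<omega> + \<theta>))) has_real_derivative
    - expectation (\<lambda>\<omega>. r (Z \<omega>) * (m \<bullet> Z \<omega>) * sin (k \<bullet> Z \<omega> + \<theta>))) (at 0)"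
    if "real_polynomial_function r" for r \<theta>
    using that integrable_polynomial[of "\<lambda>z. r z * (m \<bullet> z)"]
    by (intro has_derivative_expectation_cos) (auto intro!: integrable_polynomial)
  have "((\<lambda>t. expectation (\<lambda>\<omega>. (u \<bullet> Z \<omega>) * p (Z \<omega>) * cos ((k + t *\<^sub>R m) \<bullet> Z \<omega> + \<theta>'))) has_real_derivative
    - expectation (\<lambda>\<omega>. ((u \<bullet> Z \<omega>) * p (Z \<omega>)) * (m \<bullet> Z \<omega>) * sin (k \<bullet> Z \<omega> + \<theta>'))) (at 0)"
    using D[of "\<lambda>z. (u \<bullet> z) * p z" \<theta>'] p by auto
  moreover have "((\<lambda>t. expectation (\<lambda>\<omega>. (u \<bullet> Z \<omega>) * p (Z \<omega>) * cos ((k + t *\<^sub>R m) \<bullet> Z \<omega> + \<theta>'))) has_real_derivative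
    - expectation (\<lambda>\<omega>. ?d (Z \<omega>) * (m \<bullet> Z \<omega>) * sin (k \<bullet> Z \<omega> + \<theta>'))
      - (cov u m * expectation (\<lambda>\<omega>. p (Z \<omega>) * cos (k \<bullet> Z \<omega> + \<theta>))
       - cov u k * expectation (\<lambda>\<omega>. p (Z \<omega>) * (m \<bullet> Z \<omega>) * sin (k \<bullet> Z \<omega> + \<theta>)))) (at 0)"
  proof -
    \<comment> \<open>With the shifted phase every term contains a cosine, hence \<open>D\<close>
      differentiates each of them. The product rule applied to
      \<open>cov u (k + t *\<^sub>R m)\<close> leaves the term with \<open>cov u m\<close>, which is
      the derivative of the new factor \<open>m \<bullet> x\<close> along
      \<open>cov_vec u\<close>.\<close>
    have eq: "expectation (\<lambda>\<omega>. (u \<bullet> Z \<omega>) * p (Z \<omega>) * cos (k' \<bullet> Z \<omega> + \<theta>')) =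
      expectation (\<lambda>\<omega>. ?d (Z \<omega>) * cos (k' \<bullet> Z \<omega> + \<theta>'))
      - cov u k' * expectation (\<lambda>\<omega>. p (Z \<omega>) * cos (k' \<bullet> Z \<omega> + \<theta>))" for k'
      using assms(2) unfolding stein_def sc(2)[symmetric] by blast
    show ?thesis
      unfolding eq cov_add_right cov_scale_right
      by (rule derivative_eq_intros D[OF d] D[OF p] refl)+ simp
  qed
  ultimately have "- expectation (\<lambda>\<omega>. ((u \<bullet> Z \<omega>) * p (Z \<omega>)) * (m \<bullet> Z \<omega>) * sin (k \<bullet> Z \<omega> + \<theta>')) =
     - expectation (\<lambda>\<omega>. ?d (Z \<omega>) * (m \<bullet> Z \<omega>) * sin (k \<bullet> Z \<omega> + \<theta>')) -
      (cov u m * expectation (\<lambda>\<omega>. p (Z \<omega>) * cos (k \<bullet> Z \<omega> + \<theta>))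
       - cov u k * expectation (\<lambda>\<omega>. p (Z \<omega>) * (m \<bullet> Z \<omega>) * sin (k \<bullet> Z \<omega> + \<theta>)))"
    by (rule DERIV_unique)
  moreover have "expectation (\<lambda>\<omega>. dir_deriv (cov_vec u) (\<lambda>x. (m \<bullet> x) * p x) (Z \<omega>) * cos (k \<bullet> Z \<omega> + \<theta>)) =
     expectation (\<lambda>\<omega>. (?d (Z \<omega>) * (m \<bullet> Z \<omega>)) * cos (k \<bullet> Z \<omega> + \<theta>) + cov u m * (p (Z \<omega>) * cos (k \<bullet> Z \<omega> + \<theta>)))"
    by (intro Bochner_Integration.integral_cong refl)
       (simp add: dir_deriv_mult p real_polynomial_function_inner dir_deriv_bounded_linear
         bounded_linear_inner_right inner_cov_vec algebra_simps)
  moreover have "\<dots> = expectation (\<lambda>\<omega>. (?d (Z \<omega>) * (m \<bullet> Z \<omega>)) * cos (k \<bullet> Z \<omega> + \<theta>)) +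
     cov u m * expectation (\<lambda>\<omega>. p (Z \<omega>) * cos (k \<bullet> Z \<omega> + \<theta>))"
    using integrable_polynomial_mult_bounded[of "\<lambda>z. ?d z * (m \<bullet> z)" "\<lambda>\<omega>. cos (k \<bullet> Z \<omega> + \<theta>)"] d p
      integrable_polynomial_mult_bounded[of p "\<lambda>\<omega>. cos (k \<bullet> Z \<omega> + \<theta>)"]
    by (subst Bochner_Integration.integral_add) auto
  ultimately show "expectation (\<lambda>\<omega>. (u \<bullet> Z \<omega>) * ((m \<bullet> Z \<omega>) * p (Z \<omega>)) * cos (k \<bullet> Z \<omega> + \<theta>)) =
     expectation (\<lambda>\<omega>. dir_deriv (cov_vec u) (\<lambda>x. (m \<bullet> x) * p x) (Z \<omega>) * cos (k \<bullet> Z \<omega> + \<theta>))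
     - cov u k * expectation (\<lambda>\<omega>. (m \<bullet> Z \<omega>) * p (Z \<omega>) * sin (k \<bullet> Z \<omega> + \<theta>))"
    unfolding sc by (simp add: mult_ac)
qed

text \<open>The claim is strengthened to multiplication operators so that it is stable under products.\<close>

lemma stein_polynomial:
  assumes "real_polynomial_function p"
  shows "stein p"
proof -
  have "real_polynomial_function q \<Longrightarrow> stein q \<Longrightarrow> stein (\<lambda>x. p x * q x)" for q
    using assms
  proof (induction arbitrary: q)
    case (linear f)
    then obtain u where "f = (\<lambda>x. u \<bullet> x)"
      using bounded_linear_eq_inner[OF bounded_linear.linear] by blast
    with stein_inner_mult[of q u] linear show ?case by simp
  next
    case (const c)
    then have "dir_deriv w (\<lambda>x. c * q x) x = c * dir_deriv w q x" for w x
      by (simp add: dir_deriv_cmult)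
    moreover have "(u \<bullet> x) * (c * q x) * t = c * ((u \<bullet> x) * q x * t)" for u x t by simp
    ultimately show ?case using const(2) unfolding stein_def
      by (simp add: mult.assoc[of c] right_diff_distrib mult.left_commute[of _ c])
  next
    case (add f g)
    then have "stein (\<lambda>x. f x * q x + g x * q x)" by (intro stein_add) auto
    then show ?case by (simp add: distrib_right)
  next
    case (mult f g)
    then have "stein (\<lambda>x. f x * (g x * q x))" by blast
    then show ?case by (simp add: mult.assoc)
  qed
  from this[OF real_polynomial_function_const stein_one] show ?thesis by simp
qed

lemma stein_identity:
  assumes "real_polynomial_function p"
  shows "expectation (\<lambda>\<omega>. (u \<bullet> Z \<omega>) * p (Z \<omega>)) = expectation (\<lambda>\<omega>. dir_deriv (cov_vec u) p (Z \<omega>))"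
proof -
  have "expectation (\<lambda>\<omega>. (u \<bullet> Z \<omega>) * p (Z \<omega>) * cos (0 \<bullet> Z \<omega> + 0)) =
     expectation (\<lambda>\<omega>. dir_deriv (cov_vec u) p (Z \<omega>) * cos (0 \<bullet> Z \<omega> + 0))
     - cov u 0 * expectation (\<lambda>\<omega>. p (Z \<omega>) * sin (0 \<bullet> Z \<omega> + 0))"
    using stein_polynomial[OF assms] unfolding stein_def by blast
  then show ?thesis by simp
qed

end

section \<open>Sums over multi-indices\<close>

lemma multi_indices_0 [simp]: "multi_indices 0 = {[]}"
  by (auto simp: multi_indices_def)

lemma multi_indices_Suc:
  "multi_indices (Suc q) = (\<lambda>(b, I). b # I) ` (Basis \<times> multi_indices q)"
  by (auto simp: multi_indices_def image_iff length_Suc_conv)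

lemma finite_multi_indices [simp, intro]: "finite (multi_indices q)"
  by (induction q) (auto simp: multi_indices_Suc)

lemma length_multi_indices: "I \<in> multi_indices q \<Longrightarrow> length I = q"
  by (simp add: multi_indices_def)

lemma sum_multi_indices_Suc:
  fixes g :: "'w::euclidean_space list \<Rightarrow> 'b::comm_monoid_add"
  shows "sum g (multi_indices (Suc q)) = (\<Sum>b\<in>Basis. \<Sum>I\<in>multi_indices q. g (b # I))"
proof -
  have "sum g (multi_indices (Suc q)) = (\<Sum>(b, I)\<in>Basis \<times> multi_indices q. g (b # I))"
    unfolding multi_indices_Suc
    by (subst sum.reindex) (auto simp: inj_on_def case_prod_beta)
  then show ?thesis by (simp add: sum.cartesian_product)
qed

section \<open>Moving an entry to the front, and permanents\<close>

definition remove_nth :: "nat \<Rightarrow> 'a list \<Rightarrow> 'a list" where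
  "remove_nth i xs = take i xs @ drop (Suc i) xs"

lemma remove_nth_simps [simp]:
  "remove_nth 0 (x # xs) = xs"
  "remove_nth (Suc i) (x # xs) = x # remove_nth i xs"
  by (auto simp: remove_nth_def)

lemma length_remove_nth: "i < length xs \<Longrightarrow> length (remove_nth i xs) = length xs - 1"
  by (simp add: remove_nth_def)

lemma map_remove_nth: "map f (remove_nth i xs) = remove_nth i (map f xs)"
  by (simp add: remove_nth_def take_map drop_map)

lemma mset_remove_nth: "i < length xs \<Longrightarrow> mset xs = add_mset (xs ! i) (mset (remove_nth i xs))"
proof (induction xs arbitrary: i)
  case (Cons x xs)
  then show ?case by (cases i) auto
qed simp

lemma set_remove_nth: "set (remove_nth i xs) \<subseteq> set xs"
  by (auto simp: remove_nth_def dest: in_set_takeD in_set_dropD)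

text \<open>For fixed i the map in the summand permutes the multi-indices. This is how a permanent
  is expanded along its first row under a symmetric summand.\<close>

lemma sum_multi_indices_move_to_front:
  fixes g :: "'w::euclidean_space list \<Rightarrow> 'b::comm_monoid_add"
  assumes "i < q"
  shows "(\<Sum>K\<in>multi_indices q. g (K ! i # remove_nth i K)) = sum g (multi_indices q)"
proof -
  show ?thesis
  proof (rule sum.reindex_bij_witness[where
        i="\<lambda>K. take i (tl K) @ hd K # drop i (tl K)" and j="\<lambda>K. K ! i # remove_nth i K"])
    fix K :: "'w list" assume K: "K \<in> multi_indices q"
    then have len: "length K = q" by (rule length_multi_indices)
    show "take i (tl (K ! i # remove_nth i K)) @ hd (K ! i # remove_nth i K) #
        drop i (tl (K ! i # remove_nth i K)) = K"
      using len assms by (simp add: remove_nth_def id_take_nth_drop[symmetric])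
    show "K ! i # remove_nth i K \<in> multi_indices q"
      using K len assms set_remove_nth[of i K] nth_mem[of i K]
      by (auto simp: multi_indices_def length_remove_nth subset_iff)
    have "K \<noteq> []" using len assms by auto
    then obtain k K' where k: "K = k # K'" by (cases K) auto
    then have len': "length (take i K') = i" using len assms by simp
    have "(take i K' @ k # drop i K') ! i = k" using len' by (metis nth_append_length)
    moreover have "remove_nth i (take i K' @ k # drop i K') = K'"
      using len' by (simp add: remove_nth_def)
    ultimately show "(take i (tl K) @ hd K # drop i (tl K)) ! i #
        remove_nth i (take i (tl K) @ hd K # drop i (tl K)) = K"
      by (simp add: k)
    have "set (take i K' @ k # drop i K') \<subseteq> set K"
      by (auto simp: k dest: in_set_takeD in_set_dropD)
    moreover have "length (take i K' @ k # drop i K') = q"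
      using len k assms by simp
    ultimately show "take i (tl K) @ hd K # drop i (tl K) \<in> multi_indices q"
      using K unfolding multi_indices_def by (auto simp: k)
  qed auto
qed

text \<open>Expansion along the first row; the value is 0 if the lists have different lengths. It
  sums over all complete pairings between two lists, the shape in which Wick's formula appears
  below.\<close>

primrec permanent :: "('a \<Rightarrow> 'b \<Rightarrow> real) \<Rightarrow> 'a list \<Rightarrow> 'b list \<Rightarrow> real" where
  "permanent c [] us = (if us = [] then 1 else 0)"
| "permanent c (w # ws) us = (\<Sum>i<length us. c w (us ! i) * permanent c ws (remove_nth i us))"

lemma permanent_length_neq: "length ws \<noteq> length us \<Longrightarrow> permanent c ws us = 0"
proof (induction ws arbitrary: us)
  case (Cons w ws)
  then have "length ws \<noteq> length (remove_nth i us)" if "i < length us" for i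
    using that by (auto simp: length_remove_nth)
  with Cons.IH show ?case by (auto intro!: sum.neutral)
qed auto

lemma permanent_map: "permanent c (map f ws) (map g us) = permanent (\<lambda>a b. c (f a) (g b)) ws us"
  by (induction ws arbitrary: us) (simp_all add: map_remove_nth[symmetric])

text \<open>All q! bijections contribute equally when g is symmetric. In the induction, moving the
  partner of the first index to the front shows that its \<open>Suc q\<close> possible positions
  give the same sum.\<close>

lemma sum_symmetric_permanent:
  fixes g :: "'w::euclidean_space list \<Rightarrow> real"
  assumes sym: "\<And>K L. mset K = mset L \<Longrightarrow> g K = g L" and "length I = q"
  shows "(\<Sum>K\<in>multi_indices q. g K * permanent c I K) =
    fact q * (\<Sum>K\<in>multi_indices q. g K * (\<Prod>k<q. c (I ! k) (K ! k)))"
  using assms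
proof (induction q arbitrary: g I)
  case 0
  show ?case using 0(2) by simp
next
  case (Suc q)
  from Suc.prems(2) obtain w ws where I: "I = w # ws" and len: "length ws = q"
    by (auto simp: length_Suc_conv)
  define G where "G K = g K * c w (hd K) * permanent c ws (tl K)" for K
  have "(\<Sum>K\<in>multi_indices (Suc q). g K * permanent c I K) =
      (\<Sum>K\<in>multi_indices (Suc q). \<Sum>i<Suc q. G (K ! i # remove_nth i K))"
  proof (rule sum.cong[OF refl])
    fix K :: "'w list" assume "K \<in> multi_indices (Suc q)"
    then have "length K = Suc q" by (rule length_multi_indices)
    moreover from this have "g K = g (K ! i # remove_nth i K)" if "i < Suc q" for i
      using that by (intro Suc.prems(1)) (simp add: mset_remove_nth)
    ultimately show "g K * permanent c I K = (\<Sum>i<Suc q. G (K ! i # remove_nth i K))"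
      by (simp add: I G_def sum_distrib_left mult.assoc del: sum.lessThan_Suc)
  qed
  also have "\<dots> = (\<Sum>i<Suc q. sum G (multi_indices (Suc q)))"
    by (subst sum.swap) (simp add: sum_multi_indices_move_to_front del: sum.lessThan_Suc)
  also have "\<dots> = real (Suc q) * sum G (multi_indices (Suc q))" by simp
  also have "sum G (multi_indices (Suc q)) =
      (\<Sum>b\<in>Basis. c w b * (\<Sum>K\<in>multi_indices q. g (b # K) * permanent c ws K))"
    unfolding sum_multi_indices_Suc by (simp add: G_def sum_distrib_left mult_ac)
  also have "\<dots> = (\<Sum>b\<in>Basis. c w b * (fact q * (\<Sum>K\<in>multi_indices q. g (b # K) * (\<Prod>k<q. c (ws ! k) (K ! k)))))"
    using len by (intro sum.cong arg_cong2[where f="(*)"] refl Suc.IH Suc.prems(1)) auto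
  also have "\<dots> = fact q * (\<Sum>K\<in>multi_indices (Suc q). g K * (\<Prod>k<Suc q. c (I ! k) (K ! k)))"
    unfolding sum_multi_indices_Suc prod.lessThan_Suc_shift
    by (simp add: I sum_distrib_left mult_ac del: prod.lessThan_Suc)
  finally show ?case by (simp add: mult.assoc)
qed

lemma sum_multi_indices_prod:
  fixes h :: "nat \<Rightarrow> 'w::euclidean_space \<Rightarrow> 'b::comm_semiring_1"
  shows "(\<Sum>I\<in>multi_indices q. \<Prod>k<q. h k (I ! k)) = (\<Prod>k<q. \<Sum>b\<in>Basis. h k b)"
proof (induction q arbitrary: h)
  case (Suc q)
  show ?case
    unfolding sum_multi_indices_Suc prod.lessThan_Suc_shift
    using Suc.IH[of "\<lambda>k. h (Suc k)"]
    by (simp add: sum_distrib_left[symmetric] sum_distrib_right[symmetric] del: prod.lessThan_Suc)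
qed simp


section \<open>Hermite forms\<close>

text \<open>The type of \<open>B\<close> admits arbitrary functions as arguments, so the axioms of a
  scalar product are restricted to linear ones.\<close>

locale dual_inner =
  fixes B :: "('w::euclidean_space \<Rightarrow> real) \<Rightarrow> ('w \<Rightarrow> real) \<Rightarrow> real"
  assumes add_left: "linear l \<Longrightarrow> linear l' \<Longrightarrow> linear m \<Longrightarrow> B (\<lambda>x. l x + l' x) m = B l m + B l' m"
    and scale_left: "linear l \<Longrightarrow> linear m \<Longrightarrow> B (\<lambda>x. c * l x) m = c * B l m"
    and sym: "linear l \<Longrightarrow> linear m \<Longrightarrow> B l m = B m l"
    and pos: "linear l \<Longrightarrow> l \<noteq> (\<lambda>_. 0) \<Longrightarrow> B l l > 0"
begin

definition form :: "'w \<Rightarrow> 'w \<Rightarrow> real" where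
  "form u k = B (dual_basis u) (dual_basis k)"

text \<open>In coordinates, \<open>sharp\<close> is the matrix of \<open>B\<close> and
  \<open>flat\<close> its inverse. Hence \<open>riesz B x\<close> becomes
  \<open>dual_basis (flat x)\<close>, and the transported squared norm becomes
  \<open>x \<bullet> flat x\<close>.\<close>

definition sharp :: "'w \<Rightarrow> 'w" where
  "sharp u = (\<Sum>b\<in>Basis. form u b *\<^sub>R b)"

definition flat :: "'w \<Rightarrow> 'w" where
  "flat = (SOME g. linear g \<and> (\<forall>x. g (sharp x) = x) \<and> (\<forall>x. sharp (g x) = x))"

lemma linear_dual_basis [simp, intro]: "linear (dual_basis u)"
  unfolding dual_basis_def by (intro bounded_linear.linear bounded_linear_inner_left)

lemma dual_basis_add: "dual_basis (u + v) = (\<lambda>x. dual_basis u x + dual_basis v x)"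
  by (auto simp: dual_basis_def inner_add_right)

lemma dual_basis_scale: "dual_basis (c *\<^sub>R u) = (\<lambda>x. c * dual_basis u x)"
  by (auto simp: dual_basis_def)

lemma linear_eq_dual_basis: "linear (l :: 'w \<Rightarrow> real) \<Longrightarrow> l = dual_basis (\<Sum>b\<in>Basis. l b *\<^sub>R b)"
  by (rule ext) (unfold dual_basis_def, subst inner_commute, rule bounded_linear_eq_inner)

lemma form_commute: "form u k = form k u"
  unfolding form_def by (rule sym) auto

lemma form_add_left: "form (u + v) k = form u k + form v k"
  unfolding form_def dual_basis_add by (rule add_left) auto

lemma form_scale_left: "form (c *\<^sub>R u) k = c * form u k"
  unfolding form_def dual_basis_scale by (rule scale_left) auto

lemma linear_form_right: "linear (form u)"
  by (rule linearI) (use form_add_left form_scale_left form_commute in \<open>metis real_scaleR_def\<close>)+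

lemma inner_sharp: "k \<bullet> sharp u = form u k"
  unfolding sharp_def using bounded_linear_eq_inner[OF linear_form_right, of u k] by (simp add: inner_commute)

lemma linear_sharp: "linear sharp"
  by (rule linearI) (simp_all add: sharp_def form_add_left form_scale_left scaleR_add_left
      sum.distrib scaleR_sum_right)


lemma
  shows linear_flat: "linear flat" and flat_sharp: "flat (sharp x) = x" and sharp_flat: "sharp (flat x) = x"
proof -
  have "x = 0" if "sharp x = 0" for x
  proof (rule ccontr)
    assume "x \<noteq> 0"
    then have "dual_basis x x \<noteq> 0" by (simp add: dual_basis_def)
    then have "dual_basis x \<noteq> (\<lambda>_. 0)" by metis
    then have "form x x > 0" unfolding form_def by (intro pos linear_dual_basis)
    then show False using inner_sharp[of x x] that by simp
  qed
  then have "inj sharp" using linear_injective_0[OF linear_sharp] by blast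
  from linear_injective_isomorphism[OF linear_sharp this refl]
  have "linear flat \<and> (\<forall>x. flat (sharp x) = x) \<and> (\<forall>x. sharp (flat x) = x)"
    unfolding flat_def by (rule someI_ex)
  then show "linear flat" "flat (sharp x) = x" "sharp (flat x) = x" by auto
qed

lemma form_flat: "form (flat x) k = k \<bullet> x"
  using inner_sharp[of k "flat x"] by (simp add: sharp_flat)

lemma inner_flat_commute: "flat x \<bullet> y = x \<bullet> flat y"
  using form_flat[of x "flat y"] form_flat[of y "flat x"] form_commute by (simp add: inner_commute)

text \<open>Eliminates the definite description; uniqueness holds because \<open>sharp\<close> is
  invertible.\<close>

lemma riesz_eq: "riesz B x = dual_basis (flat x)"
  unfolding riesz_def
proof (rule the_equality)
  have "B (dual_basis (flat x)) m = m x" if m: "linear m" for m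
  proof -
    define k where "k = (\<Sum>b\<in>Basis. m b *\<^sub>R b)"
    have "m = dual_basis k" unfolding k_def using m by (rule linear_eq_dual_basis)
    then show ?thesis using form_flat[of x k] by (simp add: form_def dual_basis_def inner_commute)
  qed
  then show "linear (dual_basis (flat x)) \<and> (\<forall>m. linear m \<longrightarrow> B (dual_basis (flat x)) m = m x)"
    by auto
  fix l assume l: "linear l \<and> (\<forall>m. linear m \<longrightarrow> B l m = m x)"
  define k where "k = (\<Sum>b\<in>Basis. l b *\<^sub>R b)"
  have k: "l = dual_basis k" unfolding k_def using l by (intro linear_eq_dual_basis) auto
  have "sharp k = x"
  proof (rule vector_eq_rdot[THEN iffD1], rule allI)
    fix m
    have "form k m = dual_basis m x" using l k by (auto simp: form_def)
    then show "sharp k \<bullet> m = x \<bullet> m"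
      using inner_sharp[of m k] by (simp add: dual_basis_def inner_commute)
  qed
  then show "l = dual_basis (flat x)" using k flat_sharp by auto
qed

lemma transported_norm_square: "(transported_norm B x)\<^sup>2 = x \<bullet> flat x"
proof -
  have *: "transported_inner B x x = x \<bullet> flat x"
    unfolding transported_inner_def riesz_eq using form_flat[of x "flat x"]
    by (simp add: form_def inner_commute)
  \<comment> \<open>Required to cancel the square root. The axiom \<open>pos\<close> speaks of
    nonzero forms only, hence the two cases.\<close>
  have "0 \<le> transported_inner B x x"
  proof (cases "dual_basis (flat x) = (\<lambda>_. 0)")
    case True
    have "form (flat x) (flat x) = 0"
      using form_flat[of x "flat x"] fun_cong[OF True, of x] by (simp add: dual_basis_def inner_commute)
    then show ?thesis by (simp add: transported_inner_def riesz_eq form_def)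
  next
    case False
    then show ?thesis unfolding transported_inner_def riesz_eq by (intro less_imp_le pos linear_dual_basis)
  qed
  then show ?thesis using * by (simp add: transported_norm_def)
qed

abbreviation hermite :: "'w list \<Rightarrow> 'w \<Rightarrow> real" where
  "hermite ws x \<equiv> hermite_form B x ws"

abbreviation gauss :: "'w \<Rightarrow> real" where
  "gauss x \<equiv> exp (- (transported_norm B x)\<^sup>2 / 2)"

lemma iter_deriv_gauss: "iter_deriv gauss ws x = (- 1) ^ length ws * hermite ws x * gauss x"
proof -
  have "exp ((transported_norm B x)\<^sup>2 / 2) * exp (- ((transported_norm B x)\<^sup>2 / 2)) = 1"
    by (simp add: exp_minus_inverse)
  moreover have "(- 1 :: real) ^ length ws * (- 1) ^ length ws = 1"
    by (simp add: power_mult_distrib[symmetric])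
  moreover have "(- 1) ^ length ws * ((- 1) ^ length ws * e1 * t) * e2 =
      ((- 1) ^ length ws * (- 1) ^ length ws) * (e1 * e2) * t" for e1 e2 t :: real
    by (simp add: mult_ac)
  ultimately show ?thesis unfolding hermite_form_def by simp
qed

lemma hermite_Nil [simp]: "hermite [] x = 1"
  unfolding hermite_form_def by (simp add: exp_minus_inverse)

lemma gauss_has_derivative: "(gauss has_derivative (\<lambda>w. - (flat w \<bullet> x) * gauss x)) (at x)"
proof -
  have fd: "(flat has_derivative flat) (at x)"
    using linear_flat by (rule linear_imp_has_derivative)
  have e: "x \<bullet> flat w = flat w \<bullet> x" "w \<bullet> flat x = flat w \<bullet> x" for w
    by (rule inner_commute, rule inner_flat_commute[symmetric])
  have "((\<lambda>x. x \<bullet> flat x) has_derivative (\<lambda>w. x \<bullet> flat w + w \<bullet> flat x)) (at x)"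
    by (intro has_derivative_inner has_derivative_ident fd)
  from has_derivative_exp[OF has_derivative_mult_right[OF this, of "- (1 / 2)"]]
  have *: "((\<lambda>x. exp (- (1 / 2) * (x \<bullet> flat x))) has_derivative
      (\<lambda>w. exp (- (1 / 2) * (x \<bullet> flat x)) * (- (1 / 2) * (x \<bullet> flat w + w \<bullet> flat x)))) (at x)"
    by (rule has_derivative_eq_rhs) (rule ext, rule mult.commute)
  have **: "- (1 / 2) * (y \<bullet> flat y) = - (y \<bullet> flat y) / 2" for y by linarith
  show ?thesis
    unfolding transported_norm_square
    by (rule has_derivative_eq_rhs[OF *[unfolded **]], rule ext) (unfold e, algebra)
qed

text \<open>The product rule for \<open>hermite ws x * gauss x\<close>, divided by the sign and the
  Gaussian. Polynomiality is a hypothesis here because it is proved afterwards by induction along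
  this very recursion.\<close>

lemma hermite_Cons_aux:
  assumes h: "real_polynomial_function (hermite ws)"
  shows "hermite (w # ws) x = (flat w \<bullet> x) * hermite ws x - dir_deriv w (hermite ws) x"
proof -
  let ?s = "(- 1) ^ length ws :: real"
  have "iter_deriv gauss ws = (\<lambda>x. ?s * hermite ws x * gauss x)"
    using iter_deriv_gauss by auto
  moreover have "((\<lambda>x. ?s * hermite ws x * gauss x) has_derivative
     (\<lambda>w. ?s * hermite ws x * (- (flat w \<bullet> x) * gauss x) + ?s * dir_deriv w (hermite ws) x * gauss x)) (at x)"
    by (intro has_derivative_mult has_derivative_mult_right gauss_has_derivative has_derivative_dir_deriv h)
  ultimately have "iter_deriv gauss (w # ws) x =
     ?s * hermite ws x * (- (flat w \<bullet> x) * gauss x) + ?s * dir_deriv w (hermite ws) x * gauss x"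
    using frechet_derivative_at by (metis (no_types, lifting) iter_deriv.simps(2))
  then have "?s * gauss x * (- hermite (w # ws) x) =
      ?s * gauss x * (- ((flat w \<bullet> x) * hermite ws x - dir_deriv w (hermite ws) x))"
    unfolding iter_deriv_gauss by (simp add: algebra_simps)
  moreover have "?s * gauss x \<noteq> 0" by simp
  ultimately have "- hermite (w # ws) x = - ((flat w \<bullet> x) * hermite ws x - dir_deriv w (hermite ws) x)"
    by (metis mult_left_cancel)
  then show ?thesis by linarith
qed

lemma real_polynomial_function_hermite [intro]: "real_polynomial_function (hermite ws)"
proof (induction ws)
  case Nil
  then show ?case by (simp add: real_polynomial_function_const)
next
  case (Cons w ws)
  show ?case
    unfolding hermite_Cons_aux[OF Cons.IH]
    by (rule real_polynomial_function_diff real_polynomial_function_mult Cons.IH real_polynomial_function_dir_deriv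
        real_polynomial_function_linear[OF bounded_linear_inner_right])+
qed

lemma hermite_Cons: "hermite (w # ws) x = (flat w \<bullet> x) * hermite ws x - dir_deriv w (hermite ws) x"
  by (rule hermite_Cons_aux) blast

lemma dir_deriv_hermite_Cons:
  "dir_deriv w (hermite (v # ws)) x = (flat v \<bullet> w) * hermite ws x
     + (flat v \<bullet> x) * dir_deriv w (hermite ws) x - dir_deriv w (dir_deriv v (hermite ws)) x"
proof -
  have "hermite (v # ws) = (\<lambda>x. (flat v \<bullet> x) * hermite ws x - dir_deriv v (hermite ws) x)"
    using hermite_Cons by auto
  then show ?thesis
    by (simp add: dir_deriv_diff dir_deriv_mult real_polynomial_function_mult real_polynomial_function_hermite
        real_polynomial_function_dir_deriv real_polynomial_function_inner
        dir_deriv_bounded_linear bounded_linear_inner_right)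
qed

text \<open>The multilinear analogue of H_n' = n H_(n-1): differentiating pairs the direction with
  each argument in turn and deletes that argument.\<close>

lemma dir_deriv_hermite:
  "dir_deriv w (hermite ws) x = (\<Sum>i<length ws. (flat w \<bullet> ws ! i) * hermite (remove_nth i ws) x)"
proof (induction ws arbitrary: x)
  case Nil
  have "hermite [] = (\<lambda>x. 1)" by auto
  then show ?case by simp
next
  case (Cons v ws)
  have IH: "dir_deriv w (hermite ws) = (\<lambda>x. \<Sum>i<length ws. (flat w \<bullet> ws ! i) * hermite (remove_nth i ws) x)"
    using Cons.IH by auto
  \<comment> \<open>After the exchange the induction hypothesis for the direction w can be used
    inside the derivative along v.\<close>
  have "dir_deriv w (dir_deriv v (hermite ws)) x = dir_deriv v (dir_deriv w (hermite ws)) x"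
    by (rule dir_deriv_commute) blast
  also have "\<dots> = (\<Sum>i<length ws. (flat w \<bullet> ws ! i) * dir_deriv v (hermite (remove_nth i ws)) x)"
    unfolding IH
    by (subst dir_deriv_sum) (auto intro!: real_polynomial_function_mult real_polynomial_function_const simp: dir_deriv_cmult real_polynomial_function_hermite)
  finally have d: "dir_deriv w (dir_deriv v (hermite ws)) x =
      (\<Sum>i<length ws. (flat w \<bullet> ws ! i) * dir_deriv v (hermite (remove_nth i ws)) x)" .
  have c: "flat v \<bullet> w = flat w \<bullet> v"
    by (subst inner_flat_commute) (rule inner_commute)
  show ?case
    unfolding dir_deriv_hermite_Cons d Cons.IH list.size add_Suc_right add_0_right sum.lessThan_Suc_shift
    by (simp add: hermite_Cons c right_diff_distrib sum_subtractf
        sum_distrib_left mult.left_commute del: sum.lessThan_Suc)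
qed

lemma hermite_swap: "hermite (a # b # ws) x = hermite (b # a # ws) x"
proof -
  have "dir_deriv a (dir_deriv b (hermite ws)) x = dir_deriv b (dir_deriv a (hermite ws)) x"
    by (rule dir_deriv_commute) blast
  moreover have "flat a \<bullet> b = flat b \<bullet> a" using inner_flat_commute inner_commute by metis
  moreover have e: "hermite (a # b # ws) x = (flat a \<bullet> x) * ((flat b \<bullet> x) * hermite ws x - dir_deriv b (hermite ws) x)
      - ((flat b \<bullet> a) * hermite ws x + (flat b \<bullet> x) * dir_deriv a (hermite ws) x
         - dir_deriv a (dir_deriv b (hermite ws)) x)" for a b
    unfolding hermite_Cons[where w=a and ws="b # ws"] dir_deriv_hermite_Cons
    unfolding hermite_Cons[where w=b and ws=ws and x=x] ..
  ultimately show ?thesis unfolding e[of a b] e[of b a] by (simp add: algebra_simps)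
qed

lemma hermite_Cons_cong: "hermite ws = hermite us \<Longrightarrow> hermite (w # ws) = hermite (w # us)"
  by (auto simp: hermite_Cons fun_eq_iff)

lemma hermite_move_to_front: "i < length ws \<Longrightarrow> hermite ws = hermite (ws ! i # remove_nth i ws)"
proof (induction ws arbitrary: i)
  case (Cons v ws)
  show ?case
  proof (cases i)
    case (Suc j)
    then have "hermite (v # ws) = hermite (v # ws ! j # remove_nth j ws)"
      using Cons by (intro hermite_Cons_cong) auto
    with Suc show ?thesis using hermite_swap by auto
  qed simp
qed simp

text \<open>Exchanges of the first two arguments, applied at every depth, generate all permutations.
  Through this the chaos coefficients are symmetric.\<close>

lemma hermite_mset: "mset ws = mset us \<Longrightarrow> hermite ws = hermite us"
proof (induction ws arbitrary: us)
  case (Cons w ws)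
  then have "w \<in> set us" by (metis list.set_intros(1) set_mset_mset)
  then obtain i where i: "i < length us" "us ! i = w" by (auto simp: in_set_conv_nth)
  then have "mset ws = mset (remove_nth i us)"
    using Cons.prems mset_remove_nth[of i us] by simp
  then have "hermite ws = hermite (remove_nth i us)" by (rule Cons.IH)
  then show ?case using hermite_move_to_front[OF i(1)] i(2) hermite_Cons_cong by metis
qed simp

lemma hermite_multilinear:
  "hermite ws x = (\<Sum>J\<in>multi_indices (length ws). (\<Prod>k<length ws. ws ! k \<bullet> J ! k) * hermite J x)"
proof (induction ws arbitrary: x)
  case (Cons w ws)
  let ?c = "\<lambda>J. \<Prod>k<length ws. ws ! k \<bullet> J ! k"
  have IH: "hermite ws = (\<lambda>x. \<Sum>J\<in>multi_indices (length ws). ?c J * hermite J x)"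
    using Cons.IH by auto
  have "dir_deriv v (hermite ws) x = (\<Sum>J\<in>multi_indices (length ws). ?c J * dir_deriv v (hermite J) x)" for v
    unfolding IH
    by (subst dir_deriv_sum) (auto intro!: real_polynomial_function_mult real_polynomial_function_const simp: dir_deriv_cmult real_polynomial_function_hermite)
  then have H: "hermite (v # ws) x = (\<Sum>J\<in>multi_indices (length ws). ?c J * hermite (v # J) x)" for v
    unfolding hermite_Cons Cons.IH
    by (simp add: right_diff_distrib sum_subtractf sum_distrib_left mult.left_commute)
  have "linear (\<lambda>v. hermite (v # J) x)" for J
    unfolding hermite_Cons
    by (intro linear_compose_sub linear_dir_deriv real_polynomial_function_hermite)
       (rule linearI; simp add: linear_add[OF linear_flat] linear_scale[OF linear_flat] inner_add_left algebra_simps)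
  then have "hermite (w # J) x = (\<Sum>b\<in>Basis. (w \<bullet> b) * hermite (b # J) x)" for J
    using bounded_linear_eq_inner[of "\<lambda>v. hermite (v # J) x" w]
    by (simp add: inner_sum_left) (simp add: inner_commute mult.commute)
  then show ?case
    unfolding H list.size add_Suc_right add_0_right sum_multi_indices_Suc prod.lessThan_Suc_shift
    by (subst sum.swap) (simp add: sum_distrib_left mult_ac del: prod.lessThan_Suc)
qed simp

text \<open>Contracting every argument with \<open>form\<close> amounts to evaluating at the vectors
  \<open>sharp\<close>. The scalar product inside \<open>chaos_proj\<close> thereby turns into a
  combination of values of Hermite forms.\<close>

lemma hermite_sharp:
  "hermite (map sharp I) x = (\<Sum>J\<in>multi_indices (length I). (\<Prod>k<length I. form (I ! k) (J ! k)) * hermite J x)"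
  using hermite_multilinear[where ws="map sharp I" and x=x] by (simp add: inner_commute[of "sharp _"] inner_sharp)

end

section \<open>Polynomials in two vectors and contractions of tensors\<close>

lemma
  fixes p :: "'e::euclidean_space \<Rightarrow> real"
  assumes "real_polynomial_function p"
  shows real_polynomial_function_fst: "real_polynomial_function (\<lambda>z :: 'e \<times> 'f::euclidean_space. p (fst z))"
    and real_polynomial_function_snd: "real_polynomial_function (\<lambda>z :: 'f \<times> 'e. p (snd z))"
  using real_polynomial_function_compose[OF polynomial_function_bounded_linear[OF bounded_linear_fst] assms]
    real_polynomial_function_compose[OF polynomial_function_bounded_linear[OF bounded_linear_snd] assms]
  by (simp_all add: o_def)

lemma dir_deriv_product:
  fixes p :: "'e::euclidean_space \<Rightarrow> real" and q :: "'f::euclidean_space \<Rightarrow> real"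
  assumes p: "real_polynomial_function p" and q: "real_polynomial_function q"
  shows "dir_deriv s (\<lambda>z. p (fst z) * q (snd z)) z =
     dir_deriv (fst s) p (fst z) * q (snd z) + p (fst z) * dir_deriv (snd s) q (snd z)"
proof -
  have 1: "((\<lambda>z. p (fst z)) has_derivative (\<lambda>s. dir_deriv (fst s) p (fst z))) (at z)"
    by (rule has_derivative_compose[OF has_derivative_fst[OF has_derivative_ident] has_derivative_dir_deriv[OF p]])
  have 2: "((\<lambda>z. q (snd z)) has_derivative (\<lambda>s. dir_deriv (snd s) q (snd z))) (at z)"
    by (rule has_derivative_compose[OF has_derivative_snd[OF has_derivative_ident] has_derivative_dir_deriv[OF q]])
  show ?thesis
    using dir_deriv_eqI[OF has_derivative_mult[OF 1 2]] by (simp add: add.commute)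
qed

text \<open>\<open>tensor_inner\<close> with an arbitrary matrix c; c may be the covariance between
  two different points of the field.\<close>

definition tensor_contraction ::
  "('w::euclidean_space \<Rightarrow> 'w \<Rightarrow> 'b::comm_ring_1) \<Rightarrow> nat \<Rightarrow> ('w list \<Rightarrow> 'b) \<Rightarrow> ('w list \<Rightarrow> 'b) \<Rightarrow> 'b" where
  "tensor_contraction c q g h =
     (\<Sum>I\<in>multi_indices q. \<Sum>K\<in>multi_indices q. g I * h K * (\<Prod>k<q. c (I ! k) (K ! k)))"

text \<open>Decomposable tensors contract factor by factor. The chaos coefficients of a cosine are
  of this form.\<close>

lemma tensor_contraction_prod:
  fixes c :: "'w::euclidean_space \<Rightarrow> 'w \<Rightarrow> real"
  assumes "\<And>u. linear (c u)" "\<And>v. linear (\<lambda>u. c u v)"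
  shows "tensor_contraction c q (\<lambda>I. \<Prod>k<q. u \<bullet> I ! k) (\<lambda>K. \<Prod>k<q. v \<bullet> K ! k) = c u v ^ q"
proof -
  have "c u v = (\<Sum>a\<in>Basis. (u \<bullet> a) * c a v)"
    using bounded_linear_eq_inner[OF assms(2)[of v], of u]
    by (simp add: inner_sum_left) (simp add: inner_commute mult.commute)
  also have "\<dots> = (\<Sum>a\<in>Basis. \<Sum>b\<in>Basis. (u \<bullet> a) * (v \<bullet> b) * c a b)"
  proof (rule sum.cong[OF refl])
    fix a :: 'w
    have "c a v = (\<Sum>b\<in>Basis. (v \<bullet> b) * c a b)"
      using bounded_linear_eq_inner[OF assms(1)[of a], of v]
      by (simp add: inner_sum_left) (simp add: inner_commute mult.commute)
    then show "(u \<bullet> a) * c a v = (\<Sum>b\<in>Basis. (u \<bullet> a) * (v \<bullet> b) * c a b)"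
      by (simp add: sum_distrib_left mult.assoc)
  qed
  finally have *: "c u v = (\<Sum>a\<in>Basis. \<Sum>b\<in>Basis. (u \<bullet> a) * (v \<bullet> b) * c a b)" .
  have "tensor_contraction c q (\<lambda>I. \<Prod>k<q. u \<bullet> I ! k) (\<lambda>K. \<Prod>k<q. v \<bullet> K ! k) =
     (\<Sum>I\<in>multi_indices q. \<Sum>K\<in>multi_indices q. \<Prod>k<q. (u \<bullet> I ! k) * (v \<bullet> K ! k) * c (I ! k) (K ! k))"
    by (simp add: tensor_contraction_def prod.distrib)
  also have "\<dots> = (\<Prod>k<q. \<Sum>a\<in>Basis. \<Sum>b\<in>Basis. (u \<bullet> a) * (v \<bullet> b) * c a b)"
    using sum_multi_indices_prod[of "\<lambda>k a. \<Sum>b\<in>Basis. (u \<bullet> a) * (v \<bullet> b) * c a b" q]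
      sum_multi_indices_prod[of "\<lambda>k b. (u \<bullet> I ! k) * (v \<bullet> b) * c (I ! k) b" q for I]
    by simp
  finally show ?thesis by (simp add: *[symmetric])
qed

section \<open>Chaos projections and the Hermite coefficients of cosines\<close>

context dual_inner
begin

lemma linear_form_left: "linear (\<lambda>u. form u v)"
  using linear_form_right[of v] form_commute[of _ v] by simp

lemma chaos_coeff_mset: "mset ws = mset us \<Longrightarrow> chaos_coeff B \<eta> f ws = chaos_coeff B \<eta> f us"
  unfolding chaos_coeff_def by (drule hermite_mset) (simp add: fun_eq_iff)

lemma tensor_inner_eq: "tensor_inner B q g h = tensor_contraction form q g h"
  by (simp add: tensor_inner_def tensor_contraction_def form_def)

lemma chaos_proj_eq:
  "chaos_proj B \<eta> q f x =
     (\<Sum>I\<in>multi_indices q. chaos_coeff B \<eta> f I * hermite (map sharp I) x) / fact q"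
proof -
  have "chaos_coeff B \<eta> f I * hermite (map sharp I) x =
     (\<Sum>K\<in>multi_indices q. chaos_coeff B \<eta> f I * hermite K x * (\<Prod>k<q. form (I ! k) (K ! k)))"
    if "I \<in> multi_indices q" for I
    using length_multi_indices[OF that] by (simp add: hermite_sharp sum_distrib_left mult_ac)
  then show ?thesis
    unfolding chaos_proj_def tensor_inner_eq tensor_contraction_def by simp
qed

lemma real_polynomial_function_chaos_proj [intro]: "real_polynomial_function (chaos_proj B \<eta> q f)"
proof -
  have "chaos_proj B \<eta> q f =
     (\<lambda>x. (\<Sum>I\<in>multi_indices q. chaos_coeff B \<eta> f I * hermite (map sharp I) x) / fact q)"
    by (rule ext) (rule chaos_proj_eq)
  then show ?thesis
    by (simp only:) (intro real_polynomial_function_divide real_polynomial_function_sum real_polynomial_function_mult real_polynomial_function_const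
        real_polynomial_function_hermite finite_multi_indices)
qed

text \<open>Because \<open>flat\<close> inverts the covariance, integration by parts cancels the
  derivative in \<open>hermite_Cons\<close> and leaves the sine term only. Every argument w
  therefore contributes a factor \<open>k \<bullet> w\<close> and a quarter turn of the
  phase.\<close>

lemma expectation_hermite_cos:
  assumes "gaussian_vector M X" and cov: "\<And>a b. gaussian_vector.cov M X a b = form a b"
  shows "(\<integral>\<omega>. hermite ws (X \<omega>) * cos (k \<bullet> X \<omega> + \<theta>) \<partial>M) =
    cos (\<theta> + real (length ws) * (pi / 2)) * (\<Prod>i<length ws. k \<bullet> ws ! i) * exp (- form k k / 2)"
proof -
  interpret gaussian_vector M X by fact
  have cv: "cov_vec (flat w) = w" for w
    unfolding cov_vec_def cov sharp_def[symmetric] by (rule sharp_flat)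
  show ?thesis
  proof (induction ws arbitrary: \<theta>)
    case Nil
    show ?case using expectation_cos[of k \<theta>] by (simp add: cov)
  next
    case (Cons w ws)
    have sin: "sin (x + \<theta>) = - cos (x + (\<theta> + pi / 2))" for x
      using cos_add[of "x + \<theta>" "pi / 2"] by (simp add: add.assoc)
    have int: "integrable M (\<lambda>\<omega>. p (X \<omega>) * cos (k \<bullet> X \<omega> + \<theta>))" if "real_polynomial_function p" for p
      using that by (intro integrable_polynomial_mult_bounded) auto
    have "(\<integral>\<omega>. hermite (w # ws) (X \<omega>) * cos (k \<bullet> X \<omega> + \<theta>) \<partial>M) =
       (\<integral>\<omega>. (flat w \<bullet> X \<omega>) * hermite ws (X \<omega>) * cos (k \<bullet> X \<omega> + \<theta>)
         - dir_deriv w (hermite ws) (X \<omega>) * cos (k \<bullet> X \<omega> + \<theta>) \<partial>M)"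
      by (simp add: hermite_Cons left_diff_distrib)
    also have "\<dots> = (\<integral>\<omega>. (flat w \<bullet> X \<omega>) * hermite ws (X \<omega>) * cos (k \<bullet> X \<omega> + \<theta>) \<partial>M)
         - (\<integral>\<omega>. dir_deriv w (hermite ws) (X \<omega>) * cos (k \<bullet> X \<omega> + \<theta>) \<partial>M)"
      using int[OF real_polynomial_function_mult[OF real_polynomial_function_inner real_polynomial_function_hermite]]
      by (intro Bochner_Integration.integral_diff int) auto
    also have "\<dots> = - cov (flat w) k * (\<integral>\<omega>. hermite ws (X \<omega>) * sin (k \<bullet> X \<omega> + \<theta>) \<partial>M)"
      using stein_polynomial[OF real_polynomial_function_hermite[of ws]]
      unfolding stein_def by (simp add: cv)
    also have "\<dots> = (k \<bullet> w) * (\<integral>\<omega>. hermite ws (X \<omega>) * cos (k \<bullet> X \<omega> + (\<theta> + pi / 2)) \<partial>M)"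
      unfolding sin by (simp add: cov form_flat)
    also have "\<dots> = (k \<bullet> w) * (cos (\<theta> + pi / 2 + real (length ws) * (pi / 2))
        * (\<Prod>i<length ws. k \<bullet> ws ! i) * exp (- form k k / 2))"
      unfolding Cons.IH ..
    also have "\<theta> + pi / 2 + real (length ws) * (pi / 2) = \<theta> + real (length (w # ws)) * (pi / 2)"
      by (simp add: field_simps)
    finally show ?case
      unfolding list.size add_Suc_right add_0_right prod.lessThan_Suc_shift
      by (simp add: mult_ac del: prod.lessThan_Suc)
  qed
qed

end

section \<open>Covariances of Hermite forms in a Gaussian pair\<close>

locale gaussian_pair = dual_inner B + gaussian_vector M "\<lambda>\<omega>. (X \<omega>, Y \<omega>)"
  for B :: "('w::euclidean_space \<Rightarrow> real) \<Rightarrow> ('w \<Rightarrow> real) \<Rightarrow> real"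
    and M :: "'a measure" and X Y :: "'a \<Rightarrow> 'w" +
  fixes c :: "'w \<Rightarrow> 'w \<Rightarrow> real"
  assumes cov_fst: "cov (a, 0) (b, 0) = form a b"
    and cov_snd: "cov (0, a) (0, b) = form a b"
    and cov_cross: "cov (a, 0) (0, b) = c a b"
begin

lemma cov_vec_inner: "fst (cov_vec u) \<bullet> a = cov u (a, 0)" "snd (cov_vec u) \<bullet> a = cov u (0, a)"
  using inner_cov_vec[of "(a, 0)" u] inner_cov_vec[of "(0, a)" u]
  by (simp_all add: inner_prod_def inner_commute)

lemma fst_cov_vec_flat: "fst (cov_vec (flat w, 0)) = w"
  by (rule vector_eq_rdot[THEN iffD1]) (simp add: cov_vec_inner cov_fst form_flat, simp add: inner_commute)

lemma snd_cov_vec_flat: "snd (cov_vec (0, flat w)) = w"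
  by (rule vector_eq_rdot[THEN iffD1]) (simp add: cov_vec_inner cov_snd form_flat, simp add: inner_commute)

lemma integrable_product:
  assumes "real_polynomial_function p" "real_polynomial_function q"
  shows "integrable M (\<lambda>\<omega>. p (X \<omega>) * q (Y \<omega>))"
  using integrable_polynomial[OF real_polynomial_function_mult[OF real_polynomial_function_fst[OF assms(1)]
        real_polynomial_function_snd[OF assms(2)]]] by simp

text \<open>Integration by parts makes the expectations of the two terms of
  \<open>hermite_Cons\<close> equal. This is the base case of the next induction.\<close>

lemma expectation_hermite_zero: "expectation (\<lambda>\<omega>. hermite (u # us) (Y \<omega>)) = 0"
proof -
  \<comment> \<open>The factor 1 gives the polynomial the product shape that
    \<open>dir_deriv_product\<close> expects.\<close>
  have p: "real_polynomial_function (\<lambda>z :: 'w \<times> 'w. 1 * hermite us (snd z))"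
    using real_polynomial_function_snd[OF real_polynomial_function_hermite] by simp
  have "expectation (\<lambda>\<omega>. hermite (u # us) (Y \<omega>)) =
     expectation (\<lambda>\<omega>. (flat u \<bullet> Y \<omega>) * hermite us (Y \<omega>) - dir_deriv u (hermite us) (Y \<omega>))"
    by (simp add: hermite_Cons)
  also have "\<dots> = expectation (\<lambda>\<omega>. (flat u \<bullet> Y \<omega>) * hermite us (Y \<omega>)) - expectation (\<lambda>\<omega>. dir_deriv u (hermite us) (Y \<omega>))"
    using integrable_product[OF real_polynomial_function_const[of 1]
        real_polynomial_function_mult[OF real_polynomial_function_inner[of "flat u"] real_polynomial_function_hermite[of us]]]
      integrable_product[OF real_polynomial_function_const[of 1] real_polynomial_function_dir_deriv[OF real_polynomial_function_hermite, of u us]]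
    by (intro Bochner_Integration.integral_diff) simp_all
  also have "expectation (\<lambda>\<omega>. (flat u \<bullet> Y \<omega>) * hermite us (Y \<omega>)) =
      expectation (\<lambda>\<omega>. dir_deriv (cov_vec (0, flat u)) (\<lambda>z. 1 * hermite us (snd z)) (X \<omega>, Y \<omega>))"
    using stein_identity[OF p, of "(0, flat u)"] by simp
  also have "\<dots> = expectation (\<lambda>\<omega>. dir_deriv u (hermite us) (Y \<omega>))"
    unfolding dir_deriv_product[OF real_polynomial_function_const[of 1] real_polynomial_function_hermite[of us]]
    by (simp add: snd_cov_vec_flat)
  finally show ?thesis by simp
qed

text \<open>Wick's formula. When the factor \<open>flat w \<bullet> X \<omega>\<close> is integrated
  by parts, the derivative in the first component cancels the second term of
  \<open>hermite_Cons\<close>. The derivative in the second component deletes one entry of us at a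
  time, which is the expansion of a permanent along its first row.\<close>

lemma expectation_hermite_product:
  "expectation (\<lambda>\<omega>. hermite ws (X \<omega>) * hermite us (Y \<omega>)) = permanent (\<lambda>w u. c (flat w) (flat u)) ws us"
proof (induction ws arbitrary: us)
  case Nil
  show ?case
  proof (cases us)
    case Nil
    then show ?thesis by (simp add: prob_space)
  qed (simp add: expectation_hermite_zero)
next
  case (Cons w ws)
  let ?p = "\<lambda>z. hermite ws (fst z) * hermite us (snd z)"
  have p: "real_polynomial_function ?p"
    by (intro real_polynomial_function_mult real_polynomial_function_fst real_polynomial_function_snd real_polynomial_function_hermite)
  let ?s = "snd (cov_vec (flat w, 0))"
  note int = integrable_product[OF _ real_polynomial_function_hermite[of us]]
  have "expectation (\<lambda>\<omega>. hermite (w # ws) (X \<omega>) * hermite us (Y \<omega>)) =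
      expectation (\<lambda>\<omega>. (flat w \<bullet> X \<omega>) * hermite ws (X \<omega>) * hermite us (Y \<omega>)
        - dir_deriv w (hermite ws) (X \<omega>) * hermite us (Y \<omega>))"
    by (simp add: hermite_Cons left_diff_distrib)
  also have "\<dots> = expectation (\<lambda>\<omega>. (flat w \<bullet> X \<omega>) * hermite ws (X \<omega>) * hermite us (Y \<omega>))
        - expectation (\<lambda>\<omega>. dir_deriv w (hermite ws) (X \<omega>) * hermite us (Y \<omega>))"
    by (intro Bochner_Integration.integral_diff int[of "\<lambda>x. (flat w \<bullet> x) * hermite ws x"] int
        real_polynomial_function_mult real_polynomial_function_inner real_polynomial_function_hermite
         real_polynomial_function_dir_deriv)
  also have "expectation (\<lambda>\<omega>. (flat w \<bullet> X \<omega>) * hermite ws (X \<omega>) * hermite us (Y \<omega>)) =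
      expectation (\<lambda>\<omega>. dir_deriv (cov_vec (flat w, 0)) ?p (X \<omega>, Y \<omega>))"
    using stein_identity[OF p, of "(flat w, 0)"] by (simp add: mult.assoc)
  also have "\<dots> = expectation (\<lambda>\<omega>. dir_deriv w (hermite ws) (X \<omega>) * hermite us (Y \<omega>)
      + hermite ws (X \<omega>) * dir_deriv ?s (hermite us) (Y \<omega>))"
    by (simp add: dir_deriv_product[OF real_polynomial_function_hermite real_polynomial_function_hermite, of _ ws us] fst_cov_vec_flat)
  also have "\<dots> = expectation (\<lambda>\<omega>. dir_deriv w (hermite ws) (X \<omega>) * hermite us (Y \<omega>))
      + expectation (\<lambda>\<omega>. hermite ws (X \<omega>) * dir_deriv ?s (hermite us) (Y \<omega>))"
    by (intro Bochner_Integration.integral_add integrable_product real_polynomial_function_hermite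
        real_polynomial_function_dir_deriv)
  also have "expectation (\<lambda>\<omega>. hermite ws (X \<omega>) * dir_deriv ?s (hermite us) (Y \<omega>)) =
      expectation (\<lambda>\<omega>. \<Sum>i<length us. (flat ?s \<bullet> us ! i) * (hermite ws (X \<omega>) * hermite (remove_nth i us) (Y \<omega>)))"
    by (simp add: dir_deriv_hermite sum_distrib_left mult.left_commute)
  also have "\<dots> = (\<Sum>i<length us. (flat ?s \<bullet> us ! i) * permanent (\<lambda>w u. c (flat w) (flat u)) ws (remove_nth i us))"
    by (subst Bochner_Integration.integral_sum)
       (auto simp: Cons.IH intro!: integrable_product real_polynomial_function_hermite)
  \<comment> \<open>\<open>flat\<close> is self-adjoint, so the coefficient is
    \<open>cov_vec (flat w, 0)\<close> tested against \<open>(0, flat (us ! i))\<close>, that is, a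
    cross covariance.\<close>
  also have "\<dots> = permanent (\<lambda>w u. c (flat w) (flat u)) (w # ws) us"
    by (simp add: inner_flat_commute cov_vec_inner cov_cross)
  finally show ?case by simp
qed

text \<open>The \<open>sharp\<close> of \<open>chaos_proj_eq\<close> cancels the \<open>flat\<close>
  of Wick's formula. The permanent vanishes for p \<noteq> q; for p = q its q! cancels one of the
  two factorials in the denominator.\<close>

theorem expectation_chaos_proj_product:
  "expectation (\<lambda>\<omega>. chaos_proj B \<eta> p f (X \<omega>) * chaos_proj B \<eta>' q g (Y \<omega>)) =
    (if p = q then tensor_contraction c q (chaos_coeff B \<eta> f) (chaos_coeff B \<eta>' g) / fact q else 0)"
proof -
  let ?f = "chaos_coeff B \<eta> f" and ?g = "chaos_coeff B \<eta>' g"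
  have perm: "permanent (\<lambda>w u. c (flat w) (flat u)) (map sharp I) (map sharp K) = permanent c I K" for I K
    by (simp add: permanent_map flat_sharp)
  have "expectation (\<lambda>\<omega>. chaos_proj B \<eta> p f (X \<omega>) * chaos_proj B \<eta>' q g (Y \<omega>)) =
     expectation (\<lambda>\<omega>. (\<Sum>I\<in>multi_indices p. \<Sum>K\<in>multi_indices q.
       (?f I * ?g K / (fact p * fact q)) * (hermite (map sharp I) (X \<omega>) * hermite (map sharp K) (Y \<omega>))))"
    unfolding chaos_proj_eq times_divide_times_eq sum_product sum_divide_distrib
    by (simp add: mult_ac)
  also have "\<dots> = (\<Sum>I\<in>multi_indices p. \<Sum>K\<in>multi_indices q.
       (?f I * ?g K / (fact p * fact q)) * permanent c I K)"
    by (subst Bochner_Integration.integral_sum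
        | (intro Bochner_Integration.integrable_sum integrable_mult_right integrable_product
            real_polynomial_function_hermite)
        | simp add: expectation_hermite_product perm)+
  also have "\<dots> = (if p = q then tensor_contraction c q ?f ?g / fact q else 0)"
  proof (cases "p = q")
    case False
    then show ?thesis by (auto simp: permanent_length_neq length_multi_indices intro!: sum.neutral)
  next
    case True
    have "(\<Sum>I\<in>multi_indices p. \<Sum>K\<in>multi_indices q. (?f I * ?g K / (fact p * fact q)) * permanent c I K) =
      (\<Sum>I\<in>multi_indices q. ?f I / (fact q * fact q) * (\<Sum>K\<in>multi_indices q. ?g K * permanent c I K))"
      using True by (simp add: sum_distrib_left mult.assoc)
    also have "\<dots> = (\<Sum>I\<in>multi_indices q. ?f I / (fact q * fact q) *
       (fact q * (\<Sum>K\<in>multi_indices q. ?g K * (\<Prod>k<q. c (I ! k) (K ! k)))))"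
      by (intro sum.cong refl arg_cong2[where f="(*)"] sum_symmetric_permanent)
         (erule chaos_coeff_mset, erule length_multi_indices)
    also have "\<dots> = tensor_contraction c q ?f ?g / fact q"
      by (simp add: tensor_contraction_def sum_distrib_left sum_divide_distrib mult.assoc)
    finally show ?thesis using True by simp
  qed
  finally show ?thesis .
qed

end

section \<open>Square integrable functions\<close>

lemma square_integrableD:
  assumes "square_integrable M f"
  shows "f \<in> borel_measurable M" "integrable M (\<lambda>x. (f x)\<^sup>2)"
  using assms by (auto simp: square_integrable_def)

lemma square_integrable_mult:
  assumes "square_integrable M f" "square_integrable M g"
  shows "integrable M (\<lambda>x. f x * g x)"
proof (rule Bochner_Integration.integrable_bound)
  note [measurable] = square_integrableD(1)[OF assms(1)] square_integrableD(1)[OF assms(2)]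
  show "integrable M (\<lambda>x. (f x)\<^sup>2 + (g x)\<^sup>2)"
    using assms by (intro Bochner_Integration.integrable_add square_integrableD)
  show "(\<lambda>x. f x * g x) \<in> borel_measurable M" by measurable
  have "\<bar>a * b\<bar> \<le> a\<^sup>2 + b\<^sup>2" for a b :: real
  proof -
    have "2 * (\<bar>a\<bar> * \<bar>b\<bar>) \<le> a\<^sup>2 + b\<^sup>2"
      using sum_squares_bound[of "\<bar>a\<bar>" "\<bar>b\<bar>"] by (simp add: mult.assoc)
    moreover have "0 \<le> \<bar>a\<bar> * \<bar>b\<bar>" by simp
    ultimately show ?thesis unfolding abs_mult by linarith
  qed
  then show "AE x in M. norm (f x * g x) \<le> norm ((f x)\<^sup>2 + (g x)\<^sup>2)" by auto
qed

lemma square_integrable_add: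
  assumes "square_integrable M f" "square_integrable M g"
  shows "square_integrable M (\<lambda>x. f x + g x)"
  using square_integrableD[OF assms(1)] square_integrableD[OF assms(2)] square_integrable_mult[OF assms]
  unfolding square_integrable_def power2_sum
  by (auto simp: mult.assoc)

lemma square_integrable_cmult:
  assumes "square_integrable M f"
  shows "square_integrable M (\<lambda>x. c * f x)"
  using square_integrableD[OF assms] unfolding square_integrable_def power_mult_distrib by auto

lemma square_integrable_diff:
  assumes "square_integrable M f" "square_integrable M g"
  shows "square_integrable M (\<lambda>x. f x - g x)"
  using square_integrable_add[OF assms(1) square_integrable_cmult[OF assms(2), of "-1"]] by simp

lemma square_integrable_sum:
  assumes "\<And>i. i \<in> I \<Longrightarrow> square_integrable M (f i)"
  shows "square_integrable M (\<lambda>x. \<Sum>i\<in>I. f i x)"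
  using assms
proof (induction I rule: infinite_finite_induct)
  case (insert i I)
  then show ?case by (simp add: square_integrable_add)
qed (simp_all add: square_integrable_def)

lemma square_integrable_mono:
  assumes "square_integrable M g" "f \<in> borel_measurable M" "\<And>x. x \<in> space M \<Longrightarrow> \<bar>f x\<bar> \<le> \<bar>g x\<bar>"
  shows "square_integrable M f"
  unfolding square_integrable_def
proof
  show "f \<in> borel_measurable M" by fact
  then show "integrable M (\<lambda>x. (f x)\<^sup>2)"
    by (intro Bochner_Integration.integrable_bound[OF square_integrableD(2)[OF assms(1)]] AE_I2)
       (auto simp: abs_le_square_iff[symmetric] assms(3))
qed

lemma (in finite_measure) square_integrable_bounded:
  assumes "f \<in> borel_measurable M" "\<And>x. \<bar>f x\<bar> \<le> C"
  shows "square_integrable M f"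
proof -
  have "\<bar>f x\<bar> \<le> \<bar>C\<bar>" for x using assms(2)[of x] by simp
  then show ?thesis
    by (intro square_integrable_mono[OF _ assms(1), of "\<lambda>_. C"]) (auto simp: square_integrable_def)
qed

lemma square_add_le: "(a + b)\<^sup>2 \<le> 2 * a\<^sup>2 + 2 * (b :: real)\<^sup>2"
  using sum_squares_bound[of a b] by (simp add: power2_sum)

lemma integral_square_add_le:
  assumes "square_integrable M f" "square_integrable M g"
  shows "(\<integral>x. (f x + g x)\<^sup>2 \<partial>M) \<le> 2 * (\<integral>x. (f x)\<^sup>2 \<partial>M) + 2 * (\<integral>x. (g x)\<^sup>2 \<partial>M)"
proof -
  note i = square_integrableD(2)[OF assms(1)] square_integrableD(2)[OF assms(2)]
  have "(\<integral>x. (f x + g x)\<^sup>2 \<partial>M) \<le> (\<integral>x. 2 * (f x)\<^sup>2 + 2 * (g x)\<^sup>2 \<partial>M)"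
    using square_integrableD(2)[OF square_integrable_add[OF assms]] i
    by (intro integral_mono square_add_le) auto
  then show ?thesis using i by simp
qed


section \<open>Density of trigonometric polynomials\<close>

text \<open>The free phase makes sines and constants members, and products are expanded by a single
  addition formula.\<close>

inductive_set trig_polynomials :: "('w::euclidean_space \<Rightarrow> real) set" where
  cos: "(\<lambda>x. cos (u \<bullet> x + \<theta>)) \<in> trig_polynomials"
| scale: "p \<in> trig_polynomials \<Longrightarrow> (\<lambda>x. c * p x) \<in> trig_polynomials"
| add: "p \<in> trig_polynomials \<Longrightarrow> q \<in> trig_polynomials \<Longrightarrow> (\<lambda>x. p x + q x) \<in> trig_polynomials"

lemma continuous_trig_polynomial: "p \<in> trig_polynomials \<Longrightarrow> continuous_on UNIV p"
  by (induction rule: trig_polynomials.induct) (auto intro!: continuous_intros)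

lemma measurable_trig_polynomial: "p \<in> trig_polynomials \<Longrightarrow> p \<in> borel_measurable borel"
  by (intro borel_measurable_continuous_onI continuous_trig_polynomial)

lemma bounded_trig_polynomial: "p \<in> trig_polynomials \<Longrightarrow> \<exists>C. \<forall>x. \<bar>p x\<bar> \<le> C"
proof (induction rule: trig_polynomials.induct)
  case (cos u \<theta>)
  then show ?case by (intro exI[of _ 1]) auto
next
  case (scale p c)
  then obtain C where "\<And>x. \<bar>p x\<bar> \<le> C" by blast
  then show ?case by (intro exI[of _ "\<bar>c\<bar> * C"]) (auto simp: abs_mult mult_left_mono)
next
  case (add p q)
  then obtain C D where "\<And>x. \<bar>p x\<bar> \<le> C" "\<And>x. \<bar>q x\<bar> \<le> D" by blast
  then have "\<bar>p x + q x\<bar> \<le> C + D" for x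
    using abs_triangle_ineq[of "p x" "q x"] add_mono order_trans by blast
  then show ?case by blast
qed

lemma trig_polynomial_mult:
  assumes "p \<in> trig_polynomials" "q \<in> trig_polynomials"
  shows "(\<lambda>x. p x * q x) \<in> trig_polynomials"
  using assms(1)
proof induction
  case (cos u \<theta>)
  show ?case using assms(2)
  proof induction
    case (cos v \<tau>)
    have "cos (u \<bullet> x + \<theta>) * cos (v \<bullet> x + \<tau>) =
        1 / 2 * cos ((u - v) \<bullet> x + (\<theta> - \<tau>)) + 1 / 2 * cos ((u + v) \<bullet> x + (\<theta> + \<tau>))" for x
    proof -
      have "(u - v) \<bullet> x + (\<theta> - \<tau>) = (u \<bullet> x + \<theta>) - (v \<bullet> x + \<tau>)"
        "(u + v) \<bullet> x + (\<theta> + \<tau>) = (u \<bullet> x + \<theta>) + (v \<bullet> x + \<tau>)"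
        by (simp_all add: algebra_simps)
      then show ?thesis by (simp only: cos_times_cos) (simp add: add_divide_distrib)
    qed
    then show ?case by (simp only:) (intro trig_polynomials.intros)
  next
    case (scale p c)
    have "cos (u \<bullet> x + \<theta>) * (c * p x) = c * (cos (u \<bullet> x + \<theta>) * p x)" for x by simp
    with scale.IH show ?case by (simp only:) (rule trig_polynomials.intros)
  next
    case (add p q)
    then show ?case unfolding distrib_left by (intro trig_polynomials.intros)
  qed
next
  case (scale p c)
  then show ?case unfolding mult.assoc by (intro trig_polynomials.intros)
next
  case (add p q)
  then show ?case unfolding distrib_right by (intro trig_polynomials.intros)
qed

section \<open>The L2-closure of the trigonometric polynomials\<close>

locale finite_borel_measure = finite_measure M for M :: "'w::euclidean_space measure" +
  assumes sets_eq_borel [measurable_cong]: "sets M = sets borel"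
begin

definition trig_approximable :: "('w \<Rightarrow> real) \<Rightarrow> bool" where
  "trig_approximable g \<longleftrightarrow> square_integrable M g \<and>
     (\<forall>\<epsilon>>0. \<exists>p\<in>trig_polynomials. (\<integral>x. (g x - p x)\<^sup>2 \<partial>M) < \<epsilon>)"

lemma square_integrable_trig: "p \<in> trig_polynomials \<Longrightarrow> square_integrable M p"
  using bounded_trig_polynomial[of p] measurable_trig_polynomial[of p] square_integrable_bounded[of p]
  by (auto simp: measurable_cong_sets[OF sets_eq_borel refl])

lemma trig_approximable_trig: "p \<in> trig_polynomials \<Longrightarrow> trig_approximable p"
  unfolding trig_approximable_def by (auto intro!: bexI[of _ p] simp: square_integrable_trig)

lemma trig_approximable_limit:
  assumes g: "square_integrable M g"
    and lim: "\<And>\<epsilon>. \<epsilon> > 0 \<Longrightarrow> \<exists>h. trig_approximable h \<and> (\<integral>x. (g x - h x)\<^sup>2 \<partial>M) < \<epsilon>"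
  shows "trig_approximable g"
  unfolding trig_approximable_def
proof (intro conjI allI impI)
  show "square_integrable M g" by fact
  fix \<epsilon> :: real assume "\<epsilon> > 0"
  \<comment> \<open>The quarter absorbs the factor 2 that \<open>integral_square_add_le\<close> puts
    before each of the two errors.\<close>
  then obtain h where h: "trig_approximable h" "(\<integral>x. (g x - h x)\<^sup>2 \<partial>M) < \<epsilon> / 4"
    using lim[of "\<epsilon> / 4"] by auto
  then obtain p where p: "p \<in> trig_polynomials" "(\<integral>x. (h x - p x)\<^sup>2 \<partial>M) < \<epsilon> / 4"
    using \<open>\<epsilon> > 0\<close> unfolding trig_approximable_def by (meson zero_less_divide_iff zero_less_numeral)
  have hs: "square_integrable M h" using h by (simp add: trig_approximable_def)
  have "(\<integral>x. ((g x - h x) + (h x - p x))\<^sup>2 \<partial>M) \<le> 2 * (\<integral>x. (g x - h x)\<^sup>2 \<partial>M) + 2 * (\<integral>x. (h x - p x)\<^sup>2 \<partial>M)"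
    by (intro integral_square_add_le square_integrable_diff g hs square_integrable_trig p)
  then have "(\<integral>x. (g x - p x)\<^sup>2 \<partial>M) < \<epsilon>" using h p by simp
  then show "\<exists>p\<in>trig_polynomials. (\<integral>x. (g x - p x)\<^sup>2 \<partial>M) < \<epsilon>" using p by blast
qed

lemma trig_approximable_add:
  assumes g: "trig_approximable g" and h: "trig_approximable h"
  shows "trig_approximable (\<lambda>x. g x + h x)"
  unfolding trig_approximable_def
proof (intro conjI allI impI)
  have s: "square_integrable M g" "square_integrable M h" using assms by (auto simp: trig_approximable_def)
  then show "square_integrable M (\<lambda>x. g x + h x)" by (rule square_integrable_add)
  fix \<epsilon> :: real assume e: "\<epsilon> > 0"
  obtain p where p: "p \<in> trig_polynomials" "(\<integral>x. (g x - p x)\<^sup>2 \<partial>M) < \<epsilon> / 4"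
    using g e unfolding trig_approximable_def by (meson zero_less_divide_iff zero_less_numeral)
  obtain q where q: "q \<in> trig_polynomials" "(\<integral>x. (h x - q x)\<^sup>2 \<partial>M) < \<epsilon> / 4"
    using h e unfolding trig_approximable_def by (meson zero_less_divide_iff zero_less_numeral)
  have "(\<integral>x. ((g x - p x) + (h x - q x))\<^sup>2 \<partial>M) \<le> 2 * (\<integral>x. (g x - p x)\<^sup>2 \<partial>M) + 2 * (\<integral>x. (h x - q x)\<^sup>2 \<partial>M)"
    by (intro integral_square_add_le square_integrable_diff s square_integrable_trig p q)
  moreover have "(g x - p x) + (h x - q x) = (g x + h x) - (p x + q x)" for x by simp
  ultimately have "(\<integral>x. ((g x + h x) - (p x + q x))\<^sup>2 \<partial>M) < \<epsilon>" using p q by simp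
  then show "\<exists>p\<in>trig_polynomials. (\<integral>x. ((g x + h x) - p x)\<^sup>2 \<partial>M) < \<epsilon>"
    using trig_polynomials.add[OF p(1) q(1)] by (intro bexI[of _ "\<lambda>x. p x + q x"])
qed

lemma integral_square_mult_le:
  assumes "square_integrable M g" "b \<in> borel_measurable M" "\<And>x. \<bar>b x\<bar> \<le> C"
  shows "square_integrable M (\<lambda>x. b x * g x)"
    and "(\<integral>x. (b x * g x)\<^sup>2 \<partial>M) \<le> C\<^sup>2 * (\<integral>x. (g x)\<^sup>2 \<partial>M)"
proof -
  have C: "\<bar>b x * g x\<bar> \<le> \<bar>C * g x\<bar>" for x
    using assms(3)[of x] by (auto simp: abs_mult intro!: mult_right_mono)
  note [measurable] = square_integrableD(1)[OF assms(1)] assms(2)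
  show s: "square_integrable M (\<lambda>x. b x * g x)"
    by (rule square_integrable_mono[OF square_integrable_cmult[OF assms(1), of C]]) (use C in auto)
  have "(\<integral>x. (b x * g x)\<^sup>2 \<partial>M) \<le> (\<integral>x. (C * g x)\<^sup>2 \<partial>M)"
    by (intro integral_mono square_integrableD(2)[OF s] abs_le_square_iff[THEN iffD1] C
        square_integrableD(2)[OF square_integrable_cmult[OF assms(1)]])
  then show "(\<integral>x. (b x * g x)\<^sup>2 \<partial>M) \<le> C\<^sup>2 * (\<integral>x. (g x)\<^sup>2 \<partial>M)" by (simp add: power_mult_distrib)
qed

lemma trig_approximable_mult_trig:
  assumes p: "p \<in> trig_polynomials" and g: "trig_approximable g"
  shows "trig_approximable (\<lambda>x. p x * g x)"
  unfolding trig_approximable_def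
proof (intro conjI allI impI)
  obtain C where C: "\<And>x. \<bar>p x\<bar> \<le> C" using bounded_trig_polynomial[OF p] by blast
  have pm: "p \<in> borel_measurable M" using square_integrable_trig[OF p] by (rule square_integrableD)
  have s: "square_integrable M g" using g by (auto simp: trig_approximable_def)
  then show "square_integrable M (\<lambda>x. p x * g x)"
    using integral_square_mult_le(1) pm C by blast
  fix \<epsilon> :: real assume e: "\<epsilon> > 0"
  \<comment> \<open>The summand 1 keeps the divisor positive when C = 0.\<close>
  have C1: "C\<^sup>2 + 1 > 0" by (simp add: add_nonneg_pos)
  obtain q where q: "q \<in> trig_polynomials" "(\<integral>x. (g x - q x)\<^sup>2 \<partial>M) < \<epsilon> / (C\<^sup>2 + 1)"
    using g e C1 unfolding trig_approximable_def by (meson zero_less_divide_iff)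
  have "(\<integral>x. (p x * (g x - q x))\<^sup>2 \<partial>M) \<le> C\<^sup>2 * (\<integral>x. (g x - q x)\<^sup>2 \<partial>M)"
    by (intro integral_square_mult_le square_integrable_diff s square_integrable_trig q pm C)
  also have "\<dots> \<le> (C\<^sup>2 + 1) * (\<integral>x. (g x - q x)\<^sup>2 \<partial>M)" by (intro mult_right_mono) auto
  also have "\<dots> < \<epsilon>" using q(2) C1 by (simp add: field_simps)
  finally have "(\<integral>x. (p x * g x - p x * q x)\<^sup>2 \<partial>M) < \<epsilon>" by (simp add: right_diff_distrib)
  then show "\<exists>r\<in>trig_polynomials. (\<integral>x. (p x * g x - r x)\<^sup>2 \<partial>M) < \<epsilon>"
    using trig_polynomial_mult[OF p q(1)] by (intro bexI[of _ "\<lambda>x. p x * q x"])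
qed

text \<open>Only h is replaced by a trigonometric polynomial q. The bounded factor g stays, and the
  product of q with g is approximable by the previous lemma.\<close>

lemma trig_approximable_mult:
  assumes g: "trig_approximable g" and h: "trig_approximable h" and C: "\<And>x. \<bar>g x\<bar> \<le> C"
  shows "trig_approximable (\<lambda>x. g x * h x)"
proof (rule trig_approximable_limit)
  have s: "square_integrable M g" "square_integrable M h" using assms by (auto simp: trig_approximable_def)
  show "square_integrable M (\<lambda>x. g x * h x)"
    by (rule integral_square_mult_le(1)[OF s(2) square_integrableD(1)[OF s(1)] C])
  fix \<epsilon> :: real assume e: "\<epsilon> > 0"
  have C1: "C\<^sup>2 + 1 > 0" by (simp add: add_nonneg_pos)
  obtain q where q: "q \<in> trig_polynomials" "(\<integral>x. (h x - q x)\<^sup>2 \<partial>M) < \<epsilon> / (C\<^sup>2 + 1)"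
    using h e C1 unfolding trig_approximable_def by (meson zero_less_divide_iff)
  have "(\<integral>x. (g x * (h x - q x))\<^sup>2 \<partial>M) \<le> C\<^sup>2 * (\<integral>x. (h x - q x)\<^sup>2 \<partial>M)"
    by (intro integral_square_mult_le square_integrable_diff s square_integrable_trig q C square_integrableD(1)[OF s(1)])
  also have "\<dots> \<le> (C\<^sup>2 + 1) * (\<integral>x. (h x - q x)\<^sup>2 \<partial>M)" by (intro mult_right_mono) auto
  also have "\<dots> < \<epsilon>" using q(2) C1 by (simp add: field_simps)
  finally have "(\<integral>x. (g x * h x - q x * g x)\<^sup>2 \<partial>M) < \<epsilon>" by (simp add: algebra_simps)
  then show "\<exists>r. trig_approximable r \<and> (\<integral>x. (g x * h x - r x)\<^sup>2 \<partial>M) < \<epsilon>"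
    using trig_approximable_mult_trig[OF q(1) g] by blast
qed

lemma trig_approximable_dominated_limit:
  assumes g: "\<And>n. trig_approximable (g n)" and w: "square_integrable M w"
    and bound: "\<And>n x. x \<in> space M \<Longrightarrow> \<bar>g n x\<bar> \<le> w x"
    and lim: "\<And>x. x \<in> space M \<Longrightarrow> (\<lambda>n. g n x) \<longlonglongrightarrow> l x"
  shows "trig_approximable l"
proof (rule trig_approximable_limit)
  have s: "square_integrable M (g n)" for n using g by (simp add: trig_approximable_def)
  note [measurable] = square_integrableD(1)[OF s] square_integrableD(1)[OF w]
  have lw: "\<bar>l x\<bar> \<le> w x" if "x \<in> space M" for x
    using lim[OF that] bound[OF that] by (intro LIMSEQ_le_const2[OF tendsto_rabs]) auto
  have [measurable]: "l \<in> borel_measurable M"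
    using lim square_integrableD(1)[OF s] by (rule borel_measurable_LIMSEQ_real)
  show ls: "square_integrable M l"
    by (rule square_integrable_mono[OF w]) (use lw in \<open>auto intro: order_trans[OF _ abs_ge_self]\<close>)
  have "(\<lambda>n. \<integral>x. (l x - g n x)\<^sup>2 \<partial>M) \<longlonglongrightarrow> (\<integral>x. 0 \<partial>M)"
  \<comment> \<open>Both l and g n are bounded by w in absolute value, so their difference is at
    most 2 * w; squaring gives the 4.\<close>
  proof (rule integral_dominated_convergence[where w="\<lambda>x. 4 * (w x)\<^sup>2"])
    show "integrable M (\<lambda>x. 4 * (w x)\<^sup>2)" using square_integrableD(2)[OF w] by simp
    show "AE x in M. (\<lambda>n. (l x - g n x)\<^sup>2) \<longlonglongrightarrow> 0"
    proof (rule AE_I2)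
      fix x assume "x \<in> space M"
      from tendsto_power[OF tendsto_diff[OF tendsto_const[of "l x"] lim[OF this]], of 2]
      show "(\<lambda>n. (l x - g n x)\<^sup>2) \<longlonglongrightarrow> 0" by simp
    qed
    show "AE x in M. norm ((l x - g n x)\<^sup>2) \<le> 4 * (w x)\<^sup>2" for n
    proof (rule AE_I2)
      fix x assume "x \<in> space M"
      then have "\<bar>l x - g n x\<bar> \<le> \<bar>2 * w x\<bar>" using lw[of x] bound[where n=n and x=x] by linarith
      then have "(l x - g n x)\<^sup>2 \<le> (2 * w x)\<^sup>2" by (simp only: abs_le_square_iff)
      then show "norm ((l x - g n x)\<^sup>2) \<le> 4 * (w x)\<^sup>2" by (simp add: power_mult_distrib)
    qed
  qed auto
  then have "(\<lambda>n. \<integral>x. (l x - g n x)\<^sup>2 \<partial>M) \<longlonglongrightarrow> 0" by simp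
  then have "eventually (\<lambda>n. (\<integral>x. (l x - g n x)\<^sup>2 \<partial>M) < \<epsilon>) sequentially" if "\<epsilon> > 0" for \<epsilon>
    using that by (rule order_tendstoD(2))
  then show "\<exists>h. trig_approximable h \<and> (\<integral>x. (l x - h x)\<^sup>2 \<partial>M) < \<epsilon>" if "\<epsilon> > 0" for \<epsilon>
    using g that unfolding eventually_sequentially by blast
qed

lemma trig_approximable_bounded_limit:
  assumes "\<And>n. trig_approximable (g n)" and "\<And>n x. \<bar>g n x\<bar> \<le> C"
    and "\<And>x. (\<lambda>n. g n x) \<longlonglongrightarrow> l x"
  shows "trig_approximable l"
  by (rule trig_approximable_dominated_limit[OF assms(1), of "\<lambda>_. C"])
     (use assms in \<open>auto simp: square_integrable_def\<close>)

lemma trig_approximable_const: "trig_approximable (\<lambda>_. c)"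
  using trig_approximable_trig[OF trig_polynomials.scale[OF trig_polynomials.cos[of 0 0], of c]] by simp

lemma trig_approximable_cmult: "trig_approximable g \<Longrightarrow> trig_approximable (\<lambda>x. c * g x)"
  using trig_approximable_mult[OF trig_approximable_const[of c], of g "\<bar>c\<bar>"] by simp

lemma trig_approximable_polynomial:
  assumes g: "trig_approximable g" and C: "\<And>x. \<bar>g x\<bar> \<le> C"
    and "real_polynomial_function (p :: real \<Rightarrow> real)"
  shows "trig_approximable (\<lambda>x. p (g x)) \<and> (\<exists>D. \<forall>x. \<bar>p (g x)\<bar> \<le> D)"
  using assms(3)
proof induction
  case (linear f)
  then have f: "f t = f 1 * t" for t using linear_scale[OF bounded_linear.linear, of f t 1] by simp
  have e: "(\<lambda>x. f (g x)) = (\<lambda>x. f 1 * g x)" using f by blast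
  have "\<bar>f 1 * g x\<bar> \<le> \<bar>f 1\<bar> * C" for x using C by (simp add: abs_mult mult_left_mono)
  then have "\<bar>f (g x)\<bar> \<le> \<bar>f 1\<bar> * C" for x using fun_cong[OF e, of x] by simp
  then show ?case using trig_approximable_cmult[OF g, of "f 1"] unfolding e[symmetric] by blast
next
  case (const c)
  then show ?case using trig_approximable_const by auto
next
  case (add f h)
  then obtain D E where "\<And>x. \<bar>f (g x)\<bar> \<le> D" "\<And>x. \<bar>h (g x)\<bar> \<le> E" by blast
  then have "\<bar>f (g x) + h (g x)\<bar> \<le> D + E" for x
    using abs_triangle_ineq add_mono order_trans by blast
  then show ?case using add trig_approximable_add by blast
next
  case (mult f h)
  then obtain D E where DE: "\<And>x. \<bar>f (g x)\<bar> \<le> D" "\<And>x. \<bar>h (g x)\<bar> \<le> E" by blast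
  have b: "\<bar>f (g x) * h (g x)\<bar> \<le> D * E" for x
    unfolding abs_mult by (intro mult_mono DE abs_ge_zero order_trans[OF abs_ge_zero DE(1)])
  have "trig_approximable (\<lambda>x. f (g x))" "trig_approximable (\<lambda>x. h (g x))"
    by (rule mult.IH[THEN conjunct1])+
  from trig_approximable_mult[OF this DE(1)] b show ?case by (intro conjI exI allI)
qed

text \<open>The range of g lies in \<open>{-C..C}\<close>, where Weierstrass approximation reduces F
  to polynomials in g; these are approximable as g is bounded.\<close>

lemma trig_approximable_continuous:
  assumes g: "trig_approximable g" and C: "\<And>x. \<bar>g x\<bar> \<le> C" and F: "continuous_on UNIV (F :: real \<Rightarrow> real)"
  shows "trig_approximable (\<lambda>x. F (g x))"
proof -
  have F': "continuous_on {-C..C} F" using F continuous_on_subset by blast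
  have gC: "g x \<in> {-C..C}" for x using C[of x] by (auto simp: abs_le_iff)
  have "bounded (F ` {-C..C})"
    using compact_continuous_image[OF F'] by (simp add: compact_imp_bounded)
  then obtain K where K: "\<bar>F t\<bar> \<le> K" if "t \<in> {-C..C}" for t
    unfolding bounded_iff by (metis image_eqI real_norm_def)
  have "\<exists>p. real_polynomial_function p \<and> (\<forall>t\<in>{-C..C}. \<bar>F t - p t\<bar> < 1 / Suc n)" for n
    by (rule Stone_Weierstrass_real_polynomial_function[OF compact_Icc F', of "1 / Suc n"]) auto
  then obtain p where p: "\<And>n. real_polynomial_function (p n)"
    "\<And>n t. t \<in> {-C..C} \<Longrightarrow> \<bar>F t - p n t\<bar> < 1 / Suc n" by metis
  show ?thesis
  proof (rule trig_approximable_bounded_limit)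
    show "trig_approximable (\<lambda>x. p n (g x))" for n
      using trig_approximable_polynomial[OF g C p(1)] by blast
    show "\<bar>p n (g x)\<bar> \<le> K + 1" for n x
    proof -
      have "1 / real (Suc n) \<le> 1" by simp
      then show ?thesis using p(2)[OF gC, of x n] K[OF gC, of x] by linarith
    qed
    show "(\<lambda>n. p n (g x)) \<longlonglongrightarrow> F (g x)" for x
    proof (rule LIMSEQ_I)
      fix r :: real assume "r > 0"
      then obtain N where N: "1 / Suc N < r" using nat_approx_posE by blast
      have "norm (p n (g x) - F (g x)) < r" if "n \<ge> N" for n
      proof -
        have "1 / real (Suc n) \<le> 1 / real (Suc N)" using that by (simp add: frac_le)
        then show ?thesis using p(2)[OF gC, of x n] N by (simp add: abs_minus_commute)
      qed
      then show "\<exists>N. \<forall>n\<ge>N. norm (p n (g x) - F (g x)) < r" by blast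
    qed
  qed
qed

text \<open>
  The indicator of a half-space is a limit of continuous functions of \<open>b \<bullet> x\<close>, which itself is
  the limit of the bounded functions \<open>n sin (b \<bullet> x / n)\<close>.
\<close>

lemma trig_approximable_halfspace: "trig_approximable (indicator {x. x \<bullet> b \<le> c})"
proof -
  \<comment> \<open>A ramp: for m > 0 it is 1 up to c and 0 from c + 1/m on, so that it tends
    pointwise to the indicator of t \<le> c.\<close>
  define \<psi> where "\<psi> m t = max 0 (min 1 (1 - real m * (t - c)))" for m t
  have \<psi>c: "continuous_on UNIV (\<psi> m)" for m
    unfolding \<psi>_def by (intro continuous_intros)
  have \<psi>1: "\<bar>\<psi> m t\<bar> \<le> 1" for m t unfolding \<psi>_def by auto
  have sin: "(\<lambda>x. cos ((1 / Suc n) *\<^sub>R b \<bullet> x + - pi / 2)) = (\<lambda>x. sin ((b \<bullet> x) / Suc n))" for n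
    using cos_add[of y "- pi / 2" for y] by (auto simp: cos_diff)
  have "trig_approximable (\<lambda>x. \<psi> m (b \<bullet> x))" for m
  proof (rule trig_approximable_bounded_limit)
    show "trig_approximable (\<lambda>x. \<psi> m (Suc n * sin ((b \<bullet> x) / Suc n)))" for n
    proof (rule trig_approximable_continuous[of "\<lambda>x. sin ((b \<bullet> x) / Suc n)" 1 "\<lambda>t::real. \<psi> m (real (Suc n) * t)"])
      show "trig_approximable (\<lambda>x. sin ((b \<bullet> x) / Suc n))"
        unfolding sin[symmetric] by (intro trig_approximable_trig trig_polynomials.cos)
      show "continuous_on UNIV (\<lambda>t::real. \<psi> m (real (Suc n) * t))"
        by (rule continuous_on_compose2[OF \<psi>c]) (auto intro!: continuous_intros)
    qed auto
    show "(\<lambda>n. \<psi> m (Suc n * sin ((b \<bullet> x) / Suc n))) \<longlonglongrightarrow> \<psi> m (b \<bullet> x)" for x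
    proof -
      have "((\<lambda>t. sin ((b \<bullet> x) * t)) has_real_derivative b \<bullet> x) (at 0)"
        by (auto intro!: derivative_eq_intros)
      then have "((\<lambda>t. sin ((b \<bullet> x) * t) / t) \<longlongrightarrow> b \<bullet> x) (at 0)"
        by (simp add: has_field_derivative_iff)
      moreover have "filterlim (\<lambda>n. 1 / real (Suc n)) (at 0) sequentially"
        using LIMSEQ_Suc[OF lim_1_over_n[where 'a=real]] by (intro filterlim_atI) auto
      ultimately have "(\<lambda>n. sin ((b \<bullet> x) * (1 / real (Suc n))) / (1 / real (Suc n))) \<longlonglongrightarrow> b \<bullet> x"
        by (rule filterlim_compose)
      then have "(\<lambda>n. Suc n * sin ((b \<bullet> x) / Suc n)) \<longlonglongrightarrow> b \<bullet> x"
        by (simp add: mult.commute)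
      then show ?thesis using \<psi>c[of m]
        by (intro isCont_tendsto_compose[where g="\<psi> m"]) (auto simp: continuous_on_eq_continuous_at)
    qed
  qed (rule \<psi>1)
  then show ?thesis
  proof (rule trig_approximable_bounded_limit)
    show "(\<lambda>m. \<psi> m (b \<bullet> x)) \<longlonglongrightarrow> indicator {x. x \<bullet> b \<le> c} x" for x
    proof (cases "b \<bullet> x \<le> c")
      case True
      then have "real m * (b \<bullet> x - c) \<le> 0" for m by (simp add: mult_nonneg_nonpos)
      then have "\<psi> m (b \<bullet> x) = 1" for m unfolding \<psi>_def by (simp add: min_def)
      then show ?thesis using True by (simp add: inner_commute)
    next
      case False
      obtain N :: nat where N: "1 / (b \<bullet> x - c) < N" using reals_Archimedean2 by blast
      have "\<psi> m (b \<bullet> x) = 0" if "m \<ge> N" for m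
      proof -
        have "1 < real N * (b \<bullet> x - c)" using N False by (simp add: field_simps)
        also have "\<dots> \<le> real m * (b \<bullet> x - c)" using that False by (intro mult_right_mono) auto
        finally show ?thesis unfolding \<psi>_def by simp
      qed
      then have "eventually (\<lambda>m. \<psi> m (b \<bullet> x) = 0) sequentially"
        using eventually_sequentially by blast
      then show ?thesis using False by (simp add: inner_commute tendsto_eventually)
    qed
  qed (rule \<psi>1)
qed

text \<open>Induction over the sigma-algebra generated by half-spaces. The indicator of a finite
  union is written as 1 minus a product of complementary indicators, so that overlapping sets are
  handled by closure under bounded products; countable unions follow by bounded limits.\<close>

lemma trig_approximable_indicator:
  assumes "A \<in> sets borel"
  shows "trig_approximable (indicator A)"
proof -
  let ?G = "(\<lambda>(a, i). {x::'w. x \<bullet> i \<le> a}) ` (UNIV \<times> Basis)"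
  have "A \<in> sigma_sets UNIV ?G"
    using assms unfolding borel_eq_halfspace_le by (simp add: sets_measure_of)
  then show ?thesis
  proof induction
    case (Basic a)
    then show ?case using trig_approximable_halfspace by auto
  next
    case Empty
    then show ?case using trig_approximable_const[of 0] by simp
  next
    case (Compl a)
    have "indicator (UNIV - a) = (\<lambda>x. 1 + (-1) * indicator a x :: real)" by (auto simp: indicator_def)
    then show ?case
      using trig_approximable_add[OF trig_approximable_const[of 1] trig_approximable_cmult[OF Compl.IH, of "-1"]]
      by simp
  next
    case (Union a)
    have fin: "trig_approximable (\<lambda>x. \<Prod>i<n. 1 + (-1) * indicator (a i) x)" for n
    proof (induction n)
      case 0
      then show ?case using trig_approximable_const[of 1] by simp
    next
      case (Suc n)
      have "\<bar>\<Prod>i<n. 1 + (-1) * indicator (a i) x :: real\<bar> \<le> 1" for x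
        unfolding abs_prod by (rule prod_le_1) (auto simp: indicator_def)
      from trig_approximable_mult[OF Suc trig_approximable_add[OF trig_approximable_const[of 1]
            trig_approximable_cmult[OF Union.IH, of "-1" n]] this]
      show ?case by simp
    qed
    show ?case
    proof (rule trig_approximable_bounded_limit)
      show "trig_approximable (\<lambda>x. 1 + (-1) * (\<Prod>i<n. 1 + (-1) * indicator (a i) x))" for n
        by (intro trig_approximable_add trig_approximable_const trig_approximable_cmult fin)
      have p: "(\<Prod>i<n. 1 + (-1) * indicator (a i) x :: real) \<in> {0..1}" for n x
        by (auto intro!: prod_nonneg prod_le_1 simp: indicator_def)
      show "\<bar>1 + (-1) * (\<Prod>i<n. 1 + (-1) * indicator (a i) x :: real)\<bar> \<le> 1" for n x
        using p[where n=n and x=x] by auto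
      show "(\<lambda>n. 1 + (-1) * (\<Prod>i<n. 1 + (-1) * indicator (a i) x :: real)) \<longlonglongrightarrow> indicator (\<Union>i. a i) x" for x
      proof (cases "x \<in> (\<Union>i. a i)")
        case True
        then obtain i where i: "x \<in> a i" by blast
        have "(\<Prod>i<n. 1 + (-1) * indicator (a i) x :: real) = 0" if "n \<ge> Suc i" for n
          using i that by (intro prod_zero) (auto intro!: bexI[of _ i])
        then have "eventually (\<lambda>n. 1 + (-1) * (\<Prod>i<n. 1 + (-1) * indicator (a i) x :: real) = 1) sequentially"
          unfolding eventually_sequentially by (metis add_0_right mult_zero_right)
        then have "(\<lambda>n. 1 + (-1) * (\<Prod>i<n. 1 + (-1) * indicator (a i) x :: real)) \<longlonglongrightarrow> 1"
          by (rule tendsto_eventually)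
        then show ?thesis using True by simp
      qed auto
    qed
  qed
qed

theorem trig_approximable:
  assumes "square_integrable M f"
  shows "trig_approximable f"
proof -
  \<comment> \<open>Square integrability stays a premise of the induction, since it has to be
    inherited by summands and by approximating functions. In the monotone case the limit itself is
    the dominating function.\<close>
  have nonneg: "trig_approximable u" if "square_integrable M u" "\<And>x. 0 \<le> u x" for u
    using square_integrableD(1)[OF that(1)] that(2) that(1)
  proof (induction rule: borel_measurable_induct_real)
    case (set A)
    then show ?case using trig_approximable_indicator sets_eq_borel by auto
  next
    case (mult u c)
    show ?case
    proof (cases "c = 0")
      case True
      then show ?thesis using trig_approximable_const[of 0] by simp
    next
      case False
      then have "square_integrable M u"
        using square_integrable_cmult[OF mult.prems, of "1 / c"] by simp
      then show ?thesis using mult by (intro trig_approximable_cmult) auto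
    qed
  next
    case (add u v)
    have "square_integrable M u" "square_integrable M v"
      by (rule square_integrable_mono[OF add.prems]; use add.hyps in fastforce)+
    then show ?case using add by (intro trig_approximable_add) auto
  next
    case (seq U)
    have le: "U i x \<le> u x" if "x \<in> space M" for i x
      using seq.hyps(3) seq.hyps(4)[OF that] by (intro incseq_le) (auto simp: incseq_def le_fun_def)
    have u: "\<bar>U i x\<bar> \<le> u x" if "x \<in> space M" for i x
      using le[OF that] seq.hyps(2) by simp
    then have "square_integrable M (U i)" for i
      by (intro square_integrable_mono[OF seq.prems seq.hyps(1)]) (auto intro: order_trans[OF _ abs_ge_self])
    then have "trig_approximable (U i)" for i by (rule seq.IH)
    then show ?case
      by (rule trig_approximable_dominated_limit[OF _ seq.prems u seq.hyps(4)])
  qed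
  have s: "square_integrable M (\<lambda>x. max 0 (f x))" "square_integrable M (\<lambda>x. max 0 (- f x))"
    using square_integrableD(1)[OF assms] by (auto intro!: square_integrable_mono[OF assms])
  have "f = (\<lambda>x. max 0 (f x) + (-1) * max 0 (- f x))" by auto
  then show ?thesis
    using trig_approximable_add[OF nonneg[OF s(1)] trig_approximable_cmult[OF nonneg[OF s(2)], of "-1"]] by simp
qed

end

section \<open>The Hermite expansion\<close>

locale gaussian_law = dual_inner B + gaussian_vector M X
  for B :: "('w::euclidean_space \<Rightarrow> real) \<Rightarrow> ('w \<Rightarrow> real) \<Rightarrow> real"
    and M :: "'a measure" and X :: "'a \<Rightarrow> 'w" +
  assumes cov_eq_form: "cov a b = form a b"
begin

abbreviation law :: "'w measure" where
  "law \<equiv> distr M borel X"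

sublocale law: prob_space law
  by (rule prob_space_distr) simp

sublocale law: finite_borel_measure law
  by unfold_locales simp

text \<open>The vector (X, X) is concentrated on the diagonal. Treating it as a degenerate Gaussian
  pair makes orthogonality in L2 of the law an instance of Wick's formula.\<close>

lemma gaussian_pair_diagonal: "gaussian_pair B M X X form"
proof -
  have e: "u \<bullet> (X \<omega>, X \<omega>) = (fst u + snd u) \<bullet> X \<omega>" for u :: "'w \<times> 'w" and \<omega>
    by (simp add: inner_prod_def inner_add_left)
  interpret XX: gaussian_vector M "\<lambda>\<omega>. (X \<omega>, X \<omega>)"
    by unfold_locales (auto simp only: e gaussian centered intro!: borel_measurable_Pair measurable_Z)
  have "XX.cov u v = form (fst u + snd u) (fst v + snd v)" for u v
    unfolding XX.cov_def e cov_eq_form[symmetric] cov_def ..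
  then show ?thesis
    by unfold_locales simp_all
qed

lemma square_integrable_polynomial:
  assumes "real_polynomial_function p"
  shows "square_integrable law p"
proof -
  have [measurable]: "p \<in> borel_measurable borel" using assms by (rule measurable_real_polynomial_function)
  have "integrable M (\<lambda>\<omega>. (p (X \<omega>))\<^sup>2)"
    using integrable_polynomial[OF real_polynomial_function_mult[OF assms assms]] by (simp add: power2_eq_square)
  then show ?thesis unfolding square_integrable_def by (simp add: integrable_distr_eq)
qed

lemma square_integrable_chaos_proj: "square_integrable law (chaos_proj B \<eta> q f)"
  by (rule square_integrable_polynomial) blast

lemma square_integrable_hermite: "square_integrable law (hermite ws)"
  by (rule square_integrable_polynomial) blast

lemma integral_chaos_proj_chaos_proj:
  "(\<integral>x. chaos_proj B \<eta> p f x * chaos_proj B \<eta>' q g x \<partial>law) =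
    (if p = q then tensor_contraction form q (chaos_coeff B \<eta> f) (chaos_coeff B \<eta>' g) / fact q else 0)"
proof -
  interpret XX: gaussian_pair B M X X form by (rule gaussian_pair_diagonal)
  have "(\<integral>x. chaos_proj B \<eta> p f x * chaos_proj B \<eta>' q g x \<partial>law) =
      expectation (\<lambda>\<omega>. chaos_proj B \<eta> p f (X \<omega>) * chaos_proj B \<eta>' q g (X \<omega>))"
    by (intro integral_distr measurable_Z measurable_real_polynomial_function real_polynomial_function_mult
        real_polynomial_function_chaos_proj)
  then show ?thesis unfolding XX.expectation_chaos_proj_product .
qed

lemma integral_mult_chaos_proj:
  assumes "square_integrable law g"
  shows "(\<integral>x. g x * chaos_proj B \<eta> q f x \<partial>law) =
    tensor_contraction form q (chaos_coeff B \<eta> f) (chaos_coeff B law g) / fact q"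
proof -
  have int: "integrable law (\<lambda>x. g x * hermite J x)" for J
    by (intro square_integrable_mult assms square_integrable_hermite)
  have "(\<integral>x. g x * chaos_proj B \<eta> q f x \<partial>law) =
     (\<integral>x. (\<Sum>I\<in>multi_indices q. \<Sum>J\<in>multi_indices q.
        (chaos_coeff B \<eta> f I * (\<Prod>k<q. form (I ! k) (J ! k)) / fact q) * (g x * hermite J x)) \<partial>law)"
    unfolding chaos_proj_def tensor_inner_eq tensor_contraction_def
    by (simp add: sum_distrib_left sum_divide_distrib mult_ac)
  also have "\<dots> = (\<Sum>I\<in>multi_indices q. \<Sum>J\<in>multi_indices q.
        (chaos_coeff B \<eta> f I * (\<Prod>k<q. form (I ! k) (J ! k)) / fact q) * chaos_coeff B law g J)"
    unfolding chaos_coeff_def[of B law g]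
    by (subst Bochner_Integration.integral_sum
        | (intro Bochner_Integration.integrable_sum integrable_mult_right int)
        | simp)+
  finally show ?thesis
    by (simp add: tensor_contraction_def sum_divide_distrib mult_ac)
qed

definition partial_chaos :: "nat \<Rightarrow> ('w \<Rightarrow> real) \<Rightarrow> 'w \<Rightarrow> real" where
  "partial_chaos n f x = (\<Sum>q<n. chaos_proj B law q f x)"

lemma square_integrable_partial_chaos: "square_integrable law (partial_chaos n f)"
  unfolding partial_chaos_def[abs_def]
  by (intro square_integrable_sum square_integrable_chaos_proj)

text \<open>The squared L2 norm of the q-th projection, by
  \<open>integral_chaos_proj_chaos_proj\<close>.\<close>

definition chaos_energy :: "nat \<Rightarrow> ('w \<Rightarrow> real) \<Rightarrow> real" where
  "chaos_energy q f = tensor_contraction form q (chaos_coeff B law f) (chaos_coeff B law f) / fact q"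

text \<open>The partial sum has the same inner product with f as with itself, namely the sum of the
  energies. Hence convergence of the expansion of f is equivalent to Parseval's identity for
  f.\<close>

lemma integral_partial_chaos_error:
  assumes f: "square_integrable law f"
  shows "(\<integral>x. (f x - partial_chaos n f x)\<^sup>2 \<partial>law) = (\<integral>x. (f x)\<^sup>2 \<partial>law) - (\<Sum>q<n. chaos_energy q f)"
proof -
  let ?S = "partial_chaos n f"
  note S = square_integrable_partial_chaos[of n f]
  have fS: "(\<integral>x. f x * ?S x \<partial>law) = (\<Sum>q<n. chaos_energy q f)"
    unfolding partial_chaos_def sum_distrib_left chaos_energy_def
    by (subst Bochner_Integration.integral_sum)
       (auto intro!: square_integrable_mult f square_integrable_chaos_proj simp: integral_mult_chaos_proj f)
  have "(\<integral>x. ?S x * ?S x \<partial>law) =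
      (\<integral>x. (\<Sum>p<n. \<Sum>q<n. chaos_proj B law p f x * chaos_proj B law q f x) \<partial>law)"
    unfolding partial_chaos_def sum_product ..
  also have "\<dots> = (\<Sum>p<n. \<Sum>q<n. \<integral>x. chaos_proj B law p f x * chaos_proj B law q f x \<partial>law)"
    by (subst Bochner_Integration.integral_sum
        | (intro Bochner_Integration.integrable_sum square_integrable_mult square_integrable_chaos_proj)
        | simp)+
  also have "\<dots> = (\<Sum>q<n. chaos_energy q f)"
    unfolding integral_chaos_proj_chaos_proj chaos_energy_def
    by (simp add: sum.delta' if_distrib cong: if_cong)
  finally have SS: "(\<integral>x. ?S x * ?S x \<partial>law) = (\<Sum>q<n. chaos_energy q f)" .
  have "(\<integral>x. (f x - ?S x)\<^sup>2 \<partial>law) = (\<integral>x. (f x * f x - 2 * (f x * ?S x)) + ?S x * ?S x \<partial>law)"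
    by (simp add: power2_eq_square algebra_simps)
  also have "\<dots> = (\<integral>x. f x * f x \<partial>law) - 2 * (\<integral>x. f x * ?S x \<partial>law) + (\<integral>x. ?S x * ?S x \<partial>law)"
    using square_integrable_mult[OF f f] square_integrable_mult[OF f S] square_integrable_mult[OF S S]
    by simp
  finally show ?thesis using fS SS by (simp add: power2_eq_square)
qed

lemma chaos_energy_nonneg: "0 \<le> chaos_energy q f"
  using integral_chaos_proj_chaos_proj[of law q f law q f]
    Bochner_Integration.integral_nonneg[of law "\<lambda>x. chaos_proj B law q f x * chaos_proj B law q f x"]
  by (simp add: chaos_energy_def)

lemma integral_partial_chaos_error_le:
  "square_integrable law f \<Longrightarrow> (\<integral>x. (f x - partial_chaos n f x)\<^sup>2 \<partial>law) \<le> (\<integral>x. (f x)\<^sup>2 \<partial>law)"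
  by (simp add: integral_partial_chaos_error sum_nonneg chaos_energy_nonneg)

lemma chaos_coeff_add:
  assumes "square_integrable law f" "square_integrable law g"
  shows "chaos_coeff B law (\<lambda>x. f x + g x) ws = chaos_coeff B law f ws + chaos_coeff B law g ws"
  unfolding chaos_coeff_def distrib_right
  by (intro Bochner_Integration.integral_add square_integrable_mult assms square_integrable_hermite)

lemma chaos_coeff_cmult: "chaos_coeff B law (\<lambda>x. c * f x) ws = c * chaos_coeff B law f ws"
  unfolding chaos_coeff_def by (simp add: mult.assoc)

lemma partial_chaos_add:
  assumes "square_integrable law f" "square_integrable law g"
  shows "partial_chaos n (\<lambda>x. f x + g x) x = partial_chaos n f x + partial_chaos n g x"
  unfolding partial_chaos_def chaos_proj_eq
  by (simp add: chaos_coeff_add[OF assms] distrib_right sum.distrib add_divide_distrib)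

lemma partial_chaos_cmult: "partial_chaos n (\<lambda>x. c * f x) x = c * partial_chaos n f x"
  unfolding partial_chaos_def chaos_proj_eq
  by (simp add: chaos_coeff_cmult sum_distrib_left mult.assoc)

lemma partial_chaos_error_add:
  assumes "square_integrable law f" "square_integrable law g"
  shows "(\<integral>x. ((f x + g x) - partial_chaos n (\<lambda>x. f x + g x) x)\<^sup>2 \<partial>law) \<le>
    2 * (\<integral>x. (f x - partial_chaos n f x)\<^sup>2 \<partial>law) + 2 * (\<integral>x. (g x - partial_chaos n g x)\<^sup>2 \<partial>law)"
proof -
  have e: "(f x + g x) - partial_chaos n (\<lambda>x. f x + g x) x =
     (f x - partial_chaos n f x) + (g x - partial_chaos n g x)" for x
    by (simp add: partial_chaos_add[OF assms])
  show ?thesis unfolding e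
    by (intro integral_square_add_le square_integrable_diff assms square_integrable_partial_chaos)
qed

lemma chaos_energy_cos:
  "chaos_energy q (\<lambda>x. cos (k \<bullet> x + \<theta>)) =
    exp (- form k k) * ((cos (\<theta> + real q * (pi / 2)))\<^sup>2 * (form k k ^ q / fact q))"
proof -
  let ?f = "\<lambda>x. cos (k \<bullet> x + \<theta>)"
  let ?c = "cos (\<theta> + real q * (pi / 2)) * exp (- form k k / 2)"
  have c: "chaos_coeff B law ?f I = ?c * (\<Prod>i<q. k \<bullet> I ! i)" if "I \<in> multi_indices q" for I
  proof -
    have [measurable]: "hermite I \<in> borel_measurable borel"
      by (intro measurable_real_polynomial_function real_polynomial_function_hermite)
    have "chaos_coeff B law ?f I = expectation (\<lambda>\<omega>. hermite I (X \<omega>) * cos (k \<bullet> X \<omega> + \<theta>))"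
      unfolding chaos_coeff_def by (subst integral_distr) (simp_all add: mult.commute)
    then show ?thesis
      using expectation_hermite_cos[OF gaussian_vector_axioms cov_eq_form] length_multi_indices[OF that]
      by simp
  qed
  have "tensor_contraction form q (chaos_coeff B law ?f) (chaos_coeff B law ?f) =
     ?c\<^sup>2 * tensor_contraction form q (\<lambda>I. \<Prod>i<q. k \<bullet> I ! i) (\<lambda>I. \<Prod>i<q. k \<bullet> I ! i)"
    unfolding tensor_contraction_def sum_distrib_left
    by (intro sum.cong refl) (simp add: c power2_eq_square mult_ac)
  also have "\<dots> = ?c\<^sup>2 * form k k ^ q"
    using tensor_contraction_prod[OF linear_form_right linear_form_left] by simp
  also have "?c\<^sup>2 = exp (- form k k) * (cos (\<theta> + real q * (pi / 2)))\<^sup>2"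
    by (simp add: power_mult_distrib exp_double[symmetric] power2_eq_square[of "exp _"] exp_add[symmetric])
  finally show ?thesis unfolding chaos_energy_def by simp
qed

text \<open>The double angle formula shows that the squared cosine after q quarter turns depends on
  q through (-1)^q only. The energies therefore split into the exponential series at
  \<open>form k k\<close> and at its negative; the right hand side is \<open>expectation_cos\<close>
  at 2k.\<close>

lemma chaos_energy_cos_sums:
  "(\<lambda>q. chaos_energy q (\<lambda>x. cos (k \<bullet> x + \<theta>))) sums (\<integral>x. (cos (k \<bullet> x + \<theta>))\<^sup>2 \<partial>law)"
proof -
  let ?F = "form k k"
  have "(\<lambda>q. 1 / 2 * (?F ^ q / fact q) + 1 / 2 * cos (2 * \<theta>) * ((- ?F) ^ q / fact q)) sums
      (1 / 2 * exp ?F + 1 / 2 * cos (2 * \<theta>) * exp (- ?F))"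
    using exp_converges[of ?F] exp_converges[of "- ?F"]
    by (intro sums_add sums_mult) (simp_all add: divide_inverse mult.commute)
  moreover have "1 / 2 * (?F ^ q / fact q) + 1 / 2 * cos (2 * \<theta>) * ((- ?F) ^ q / fact q) =
     (cos (\<theta> + real q * (pi / 2)))\<^sup>2 * (?F ^ q / fact q)" for q
  proof -
    have "cos (2 * (\<theta> + real q * (pi / 2))) = cos (2 * \<theta> + real q * pi)" by (simp add: algebra_simps)
    also have "\<dots> = (- 1) ^ q * cos (2 * \<theta>)" by (simp add: cos_add cos_npi sin_npi)
    finally have "(cos (\<theta> + real q * (pi / 2)))\<^sup>2 = 1 / 2 + 1 / 2 * ((- 1) ^ q * cos (2 * \<theta>))"
      unfolding cos_double_cos by (simp add: field_simps)
    moreover have "(- ?F) ^ q = (- 1) ^ q * ?F ^ q" by (simp add: power_mult_distrib[symmetric])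
    ultimately show ?thesis by (simp add: algebra_simps)
  qed
  ultimately have "(\<lambda>q. exp (- ?F) * ((cos (\<theta> + real q * (pi / 2)))\<^sup>2 * (?F ^ q / fact q))) sums
     (exp (- ?F) * (1 / 2 * exp ?F + 1 / 2 * cos (2 * \<theta>) * exp (- ?F)))"
    by (intro sums_mult) simp
  moreover have "exp (- ?F) * (1 / 2 * exp ?F + 1 / 2 * cos (2 * \<theta>) * exp (- ?F)) =
     1 / 2 + 1 / 2 * (cos (2 * \<theta>) * exp (- (2 * ?F)))"
    by (simp add: algebra_simps exp_minus_inverse exp_add[symmetric] flip: exp_double)
  moreover have "(\<integral>x. (cos (k \<bullet> x + \<theta>))\<^sup>2 \<partial>law) = 1 / 2 + 1 / 2 * (cos (2 * \<theta>) * exp (- (2 * ?F)))"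
  proof -
    have "(cos y)\<^sup>2 = 1 / 2 + 1 / 2 * cos (2 * y)" for y :: real
      unfolding cos_double_cos by (simp add: field_simps)
    then have "(\<integral>x. (cos (k \<bullet> x + \<theta>))\<^sup>2 \<partial>law) =
       (\<integral>x. 1 / 2 + 1 / 2 * cos ((2 *\<^sub>R k) \<bullet> x + 2 * \<theta>) \<partial>law)"
      by (simp add: distrib_left)
    also have "\<dots> = expectation (\<lambda>\<omega>. 1 / 2 + 1 / 2 * cos ((2 *\<^sub>R k) \<bullet> X \<omega> + 2 * \<theta>))"
      by (rule integral_distr) auto
    also have "\<dots> = 1 / 2 + 1 / 2 * expectation (\<lambda>\<omega>. cos ((2 *\<^sub>R k) \<bullet> X \<omega> + 2 * \<theta>))"
    proof -
      have "integrable M (\<lambda>\<omega>. cos ((2 *\<^sub>R k) \<bullet> X \<omega> + 2 * \<theta>))"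
        by (rule integrable_const_bound[where B=1]) auto
      then show ?thesis
        by (subst Bochner_Integration.integral_add) (auto simp: prob_space simp del: inner_scaleR_left)
    qed
    also have "expectation (\<lambda>\<omega>. cos ((2 *\<^sub>R k) \<bullet> X \<omega> + 2 * \<theta>)) = cos (2 * \<theta>) * exp (- (2 * ?F))"
      unfolding expectation_cos cov_scale_left cov_scale_right by (simp add: cov_eq_form)
    finally show ?thesis .
  qed
  ultimately show ?thesis unfolding chaos_energy_cos by simp
qed

lemma partial_chaos_trig_tendsto:
  assumes "p \<in> trig_polynomials"
  shows "(\<lambda>n. \<integral>x. (p x - partial_chaos n p x)\<^sup>2 \<partial>law) \<longlonglongrightarrow> 0"
  using assms
proof induction
  case (cos k \<theta>)
  have "(\<lambda>n. (\<integral>x. (cos (k \<bullet> x + \<theta>))\<^sup>2 \<partial>law) - (\<Sum>q<n. chaos_energy q (\<lambda>x. cos (k \<bullet> x + \<theta>)))) \<longlonglongrightarrow>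
      (\<integral>x. (cos (k \<bullet> x + \<theta>))\<^sup>2 \<partial>law) - (\<integral>x. (cos (k \<bullet> x + \<theta>))\<^sup>2 \<partial>law)"
    using chaos_energy_cos_sums unfolding sums_def by (intro tendsto_diff tendsto_const)
  then show ?case
    using integral_partial_chaos_error[OF law.square_integrable_trig[OF trig_polynomials.cos]] by simp
next
  case (scale p c)
  have "(\<lambda>n. c\<^sup>2 * (\<integral>x. (p x - partial_chaos n p x)\<^sup>2 \<partial>law)) \<longlonglongrightarrow> c\<^sup>2 * 0"
    by (intro tendsto_mult tendsto_const scale)
  moreover have "(c * p x - partial_chaos n (\<lambda>x. c * p x) x)\<^sup>2 = c\<^sup>2 * (p x - partial_chaos n p x)\<^sup>2" for n x
    by (simp add: partial_chaos_cmult right_diff_distrib[symmetric] power_mult_distrib)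
  ultimately show ?case by simp
next
  case (add p q)
  have "(\<lambda>n. 2 * (\<integral>x. (p x - partial_chaos n p x)\<^sup>2 \<partial>law) + 2 * (\<integral>x. (q x - partial_chaos n q x)\<^sup>2 \<partial>law))
     \<longlonglongrightarrow> 2 * 0 + 2 * 0"
    by (intro tendsto_intros add)
  then have *: "(\<lambda>n. 2 * (\<integral>x. (p x - partial_chaos n p x)\<^sup>2 \<partial>law) + 2 * (\<integral>x. (q x - partial_chaos n q x)\<^sup>2 \<partial>law))
     \<longlonglongrightarrow> 0" by simp
  show ?case
  proof (rule tendsto_sandwich[OF _ _ tendsto_const *]; intro always_eventually allI)
    fix n
    show "0 \<le> (\<integral>x. (p x + q x - partial_chaos n (\<lambda>x. p x + q x) x)\<^sup>2 \<partial>law)" by simp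
    show "(\<integral>x. (p x + q x - partial_chaos n (\<lambda>x. p x + q x) x)\<^sup>2 \<partial>law) \<le>
      2 * (\<integral>x. (p x - partial_chaos n p x)\<^sup>2 \<partial>law) + 2 * (\<integral>x. (q x - partial_chaos n q x)\<^sup>2 \<partial>law)"
      by (intro partial_chaos_error_add law.square_integrable_trig add.hyps)
  qed
qed

text \<open>For a trigonometric polynomial p near f, the error of f is at most twice the error of f
  - p plus twice the error of p. By Bessel's inequality the former error is bounded by the squared
  norm of f - p, uniformly in n.\<close>

theorem partial_chaos_tendsto:
  assumes f: "square_integrable law f"
  shows "(\<lambda>n. \<integral>x. (f x - partial_chaos n f x)\<^sup>2 \<partial>law) \<longlonglongrightarrow> 0"
proof (rule LIMSEQ_I)
  fix \<epsilon> :: real assume e: "\<epsilon> > 0"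
  then obtain p where p: "p \<in> trig_polynomials" "(\<integral>x. (f x - p x)\<^sup>2 \<partial>law) < \<epsilon> / 4"
    using law.trig_approximable[OF f] unfolding law.trig_approximable_def
    by (meson zero_less_divide_iff zero_less_numeral)
  note ps = law.square_integrable_trig[OF p(1)]
  have "eventually (\<lambda>n. (\<integral>x. (p x - partial_chaos n p x)\<^sup>2 \<partial>law) < \<epsilon> / 4) sequentially"
    using partial_chaos_trig_tendsto[OF p(1)] by (rule order_tendstoD(2)) (use e in simp)
  then obtain N where N: "\<And>n. n \<ge> N \<Longrightarrow> (\<integral>x. (p x - partial_chaos n p x)\<^sup>2 \<partial>law) < \<epsilon> / 4"
    unfolding eventually_sequentially by blast
  have "(\<integral>x. (f x - partial_chaos n f x)\<^sup>2 \<partial>law) < \<epsilon>" if "n \<ge> N" for n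
  proof -
    note fp = square_integrable_diff[OF f ps]
    have "(\<integral>x. (((f x - p x) + p x) - partial_chaos n (\<lambda>x. (f x - p x) + p x) x)\<^sup>2 \<partial>law) \<le>
      2 * (\<integral>x. ((f x - p x) - partial_chaos n (\<lambda>x. f x - p x) x)\<^sup>2 \<partial>law)
      + 2 * (\<integral>x. (p x - partial_chaos n p x)\<^sup>2 \<partial>law)"
      by (rule partial_chaos_error_add[OF fp ps])
    moreover have "(\<integral>x. ((f x - p x) - partial_chaos n (\<lambda>x. f x - p x) x)\<^sup>2 \<partial>law) \<le> (\<integral>x. (f x - p x)\<^sup>2 \<partial>law)"
      by (rule integral_partial_chaos_error_le[OF fp])
    ultimately show ?thesis using p(2) N[OF that] by simp
  qed
  then show "\<exists>N. \<forall>n\<ge>N. norm ((\<integral>x. (f x - partial_chaos n f x)\<^sup>2 \<partial>law) - 0) < \<epsilon>"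
    by (intro exI[of _ N]) simp
qed

end

section \<open>Integrals of a random field\<close>

lemma Cauchy_Schwarz_integral:
  assumes f: "square_integrable M f" and g: "square_integrable M g"
  shows "(\<integral>x. f x * g x \<partial>M)\<^sup>2 \<le> (\<integral>x. (f x)\<^sup>2 \<partial>M) * (\<integral>x. (g x)\<^sup>2 \<partial>M)"
proof -
  let ?A = "\<integral>x. (f x)\<^sup>2 \<partial>M" and ?B = "\<integral>x. f x * g x \<partial>M" and ?C = "\<integral>x. (g x)\<^sup>2 \<partial>M"
  note i = square_integrableD(2)[OF f] square_integrableD(2)[OF g] square_integrable_mult[OF f g]
  have nn: "0 \<le> t\<^sup>2 * ?A + 2 * t * ?B + ?C" for t
  proof -
    have "0 \<le> (\<integral>x. (t * f x + g x)\<^sup>2 \<partial>M)" by simp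
    also have "\<dots> = (\<integral>x. t\<^sup>2 * (f x)\<^sup>2 + 2 * t * (f x * g x) + (g x)\<^sup>2 \<partial>M)"
      by (simp add: power2_sum power_mult_distrib algebra_simps)
    also have "\<dots> = t\<^sup>2 * ?A + 2 * t * ?B + ?C" using i by simp
    finally show ?thesis .
  qed
  show ?thesis
  proof (cases "?A = 0")
    case True
    have "?B = 0"
    proof (rule ccontr)
      assume B: "?B \<noteq> 0"
      \<comment> \<open>For vanishing leading coefficient the quadratic is affine in t; this t would
        give it the value -1.\<close>
      have "0 \<le> 2 * (- (?C + 1) / (2 * ?B)) * ?B + ?C" using nn[of "- (?C + 1) / (2 * ?B)"] True by simp
      then show False using B by (simp add: field_simps)
    qed
    then show ?thesis using True by simp
  next
    case False
    moreover have "0 \<le> ?A" by simp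
    ultimately have A: "?A > 0" by linarith
    \<comment> \<open>The quadratic at its minimum.\<close>
    have "0 \<le> (- ?B / ?A)\<^sup>2 * ?A + 2 * (- ?B / ?A) * ?B + ?C" by (rule nn)
    also have "\<dots> = ?C - ?B\<^sup>2 / ?A" using A by (simp add: field_simps power2_eq_square)
    finally show ?thesis using A by (simp add: field_simps)
  qed
qed

lemma integral_square_tendsto:
  assumes f: "square_integrable M f" and g: "\<And>n. square_integrable M (g n)"
    and lim: "(\<lambda>n. \<integral>x. (f x - g n x)\<^sup>2 \<partial>M) \<longlonglongrightarrow> 0"
  shows "(\<lambda>n. \<integral>x. (g n x)\<^sup>2 \<partial>M) \<longlonglongrightarrow> (\<integral>x. (f x)\<^sup>2 \<partial>M)"
proof -
  let ?e = "\<lambda>n. \<integral>x. (f x - g n x)\<^sup>2 \<partial>M" and ?A = "\<integral>x. (f x)\<^sup>2 \<partial>M"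
  have bound: "\<bar>(\<integral>x. (g n x)\<^sup>2 \<partial>M) - ?A\<bar> \<le> ?e n + 2 * sqrt (?A * ?e n)" for n
  proof -
    note d = square_integrable_diff[OF f g[of n]]
    have "(\<integral>x. (g n x)\<^sup>2 \<partial>M) = (\<integral>x. (f x)\<^sup>2 + (f x - g n x)\<^sup>2 - 2 * (f x * (f x - g n x)) \<partial>M)"
      by (simp add: power2_eq_square algebra_simps)
    also have "\<dots> = ?A + ?e n - 2 * (\<integral>x. f x * (f x - g n x) \<partial>M)"
      using square_integrableD(2)[OF f] square_integrableD(2)[OF d] square_integrable_mult[OF f d] by simp
    finally have "(\<integral>x. (g n x)\<^sup>2 \<partial>M) - ?A = ?e n - 2 * (\<integral>x. f x * (f x - g n x) \<partial>M)" by simp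
    moreover have "\<bar>\<integral>x. f x * (f x - g n x) \<partial>M\<bar> \<le> sqrt (?A * ?e n)"
      using Cauchy_Schwarz_integral[OF f d] by (metis real_sqrt_abs real_sqrt_le_mono)
    moreover have "0 \<le> ?e n" by simp
    ultimately show ?thesis by linarith
  qed
  have "(\<lambda>n. ?e n + 2 * sqrt (?A * ?e n)) \<longlonglongrightarrow> 0 + 2 * sqrt (?A * 0)"
    by (intro tendsto_intros lim)
  then have "(\<lambda>n. ?e n + 2 * sqrt (?A * ?e n)) \<longlonglongrightarrow> 0" by simp
  then have "(\<lambda>n. (\<integral>x. (g n x)\<^sup>2 \<partial>M) - ?A) \<longlonglongrightarrow> 0"
    by (rule Lim_null_comparison[rotated]) (use bound in auto)
  then show ?thesis by (simp add: LIM_zero_iff)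
qed

text \<open>\<open>\<psi>\<close> stands for the rescaled test function with its normalizing power
  included. Of the distribution of the field, only the common one-point law enters here.\<close>

locale integrated_field = prob_space M for M :: "'a measure" +
  fixes X :: "'v::euclidean_space \<Rightarrow> 'a \<Rightarrow> 'w::euclidean_space"
    and \<eta> :: "'w measure" and \<psi> :: "'v \<Rightarrow> real"
  assumes measurable_field: "(\<lambda>(v, \<omega>). X v \<omega>) \<in> borel_measurable (borel \<Otimes>\<^sub>M M)"
    and law_field: "distr M borel (X v) = \<eta>"
    and integrable_weight: "integrable lborel \<psi>"
begin

definition weighted_integral :: "('w \<Rightarrow> real) \<Rightarrow> 'a \<Rightarrow> real" where
  "weighted_integral g \<omega> = (\<integral>v. \<psi> v * g (X v \<omega>) \<partial>lborel)"

lemma measurable_weight [measurable]: "\<psi> \<in> borel_measurable borel"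
  using integrable_weight by auto

lemma measurable_field_pair [measurable]:
  "f \<in> borel_measurable N \<Longrightarrow> k \<in> measurable N M \<Longrightarrow> (\<lambda>x. X (f x) (k x)) \<in> borel_measurable N"
  using measurable_compose[OF measurable_Pair measurable_field, of f N k] by simp

lemma measurable_X [measurable]: "X v \<in> borel_measurable M"
  by measurable

lemma sets_law: "sets \<eta> = sets borel"
  using law_field[of 0] by auto

sublocale PM: pair_sigma_finite lborel M ..
sublocale PVM: pair_sigma_finite "(lborel :: 'v measure) \<Otimes>\<^sub>M lborel" M ..

lemma measurable_of_square_integrable: "square_integrable \<eta> g \<Longrightarrow> g \<in> borel_measurable borel"
  using square_integrableD(1) measurable_cong_sets[OF sets_law refl] by blast

lemma integral_field: "g \<in> borel_measurable borel \<Longrightarrow> expectation (\<lambda>\<omega>. g (X v \<omega>)) = (\<integral>x. g x \<partial>\<eta>)"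
  for g :: "'w \<Rightarrow> real"
  unfolding law_field[of v, symmetric] by (simp add: integral_distr)

lemma square_integrable_field:
  assumes "square_integrable \<eta> g"
  shows "square_integrable M (\<lambda>\<omega>. g (X v \<omega>))"
proof -
  have [measurable]: "g \<in> borel_measurable borel" using assms by (rule measurable_of_square_integrable)
  show ?thesis
    using assms unfolding law_field[of v, symmetric] square_integrable_def
    by (simp add: integrable_distr_eq)
qed

lemma expectation_abs_product_le:
  assumes "square_integrable \<eta> g" "square_integrable \<eta> h"
  shows "expectation (\<lambda>\<omega>. \<bar>g (X v \<omega>) * h (X w \<omega>)\<bar>) \<le> ((\<integral>x. (g x)\<^sup>2 \<partial>\<eta>) + (\<integral>x. (h x)\<^sup>2 \<partial>\<eta>)) / 2"
proof -
  have [measurable]: "g \<in> borel_measurable borel" "h \<in> borel_measurable borel"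
    using assms by (auto intro: measurable_of_square_integrable)
  note G = square_integrable_field[OF assms(1), of v] and H = square_integrable_field[OF assms(2), of w]
  have "\<bar>a * b\<bar> \<le> (a\<^sup>2 + b\<^sup>2) / 2" for a b :: real
    using sum_squares_bound[of "\<bar>a\<bar>" "\<bar>b\<bar>"] by (simp add: abs_mult field_simps)
  then have "expectation (\<lambda>\<omega>. \<bar>g (X v \<omega>) * h (X w \<omega>)\<bar>) \<le> expectation (\<lambda>\<omega>. ((g (X v \<omega>))\<^sup>2 + (h (X w \<omega>))\<^sup>2) / 2)"
    using square_integrable_mult[OF G H] square_integrableD(2)[OF G] square_integrableD(2)[OF H]
    by (intro integral_mono) auto
  also have "\<dots> = ((\<integral>x. (g x)\<^sup>2 \<partial>\<eta>) + (\<integral>x. (h x)\<^sup>2 \<partial>\<eta>)) / 2"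
    using square_integrableD(2)[OF G] square_integrableD(2)[OF H]
    by (simp add: integral_field[of "\<lambda>x. (g x)\<^sup>2"] integral_field[of "\<lambda>x. (h x)\<^sup>2"])
  finally show ?thesis .
qed

lemma integrable_weight_product: "integrable (lborel \<Otimes>\<^sub>M lborel) (\<lambda>p. \<psi> (fst p) * \<psi> (snd p))"
  by (rule lborel_pair.Fubini_integrable) (use integrable_weight in \<open>auto simp: abs_mult integrable_abs\<close>)

text \<open>Since all points have the same law, the expectation of
  \<open>\<bar>g (X v \<omega>) * h (X w \<omega>)\<bar>\<close> is bounded uniformly in v and w,
  and the product of the weights is integrable.\<close>

lemma integrable_field_product:
  assumes g: "square_integrable \<eta> g" and h: "square_integrable \<eta> h"
  shows "integrable ((lborel \<Otimes>\<^sub>M lborel) \<Otimes>\<^sub>M M)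
    (\<lambda>(p, \<omega>). (\<psi> (fst p) * \<psi> (snd p)) * (g (X (fst p) \<omega>) * h (X (snd p) \<omega>)))"
proof (rule PVM.Fubini_integrable)
  have [measurable]: "g \<in> borel_measurable borel" "h \<in> borel_measurable borel"
    using assms by (auto intro: measurable_of_square_integrable)
  show "(\<lambda>(p, \<omega>). (\<psi> (fst p) * \<psi> (snd p)) * (g (X (fst p) \<omega>) * h (X (snd p) \<omega>))) \<in>
      borel_measurable ((lborel \<Otimes>\<^sub>M lborel) \<Otimes>\<^sub>M M)"
    by measurable
  let ?K = "((\<integral>x. (g x)\<^sup>2 \<partial>\<eta>) + (\<integral>x. (h x)\<^sup>2 \<partial>\<eta>)) / 2"
  have e: "expectation (\<lambda>\<omega>. norm (case (p, \<omega>) of (p, \<omega>) \<Rightarrow>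
      (\<psi> (fst p) * \<psi> (snd p)) * (g (X (fst p) \<omega>) * h (X (snd p) \<omega>)))) =
      \<bar>\<psi> (fst p) * \<psi> (snd p)\<bar> * expectation (\<lambda>\<omega>. \<bar>g (X (fst p) \<omega>) * h (X (snd p) \<omega>)\<bar>)" for p
    by (simp add: case_prod_beta abs_mult)
  show "integrable (lborel \<Otimes>\<^sub>M lborel) (\<lambda>p. expectation (\<lambda>\<omega>. norm (case (p, \<omega>) of (p, \<omega>) \<Rightarrow>
      (\<psi> (fst p) * \<psi> (snd p)) * (g (X (fst p) \<omega>) * h (X (snd p) \<omega>)))))"
    unfolding e
  proof (rule Bochner_Integration.integrable_bound)
    show "integrable (lborel \<Otimes>\<^sub>M lborel) (\<lambda>p. \<bar>\<psi> (fst p) * \<psi> (snd p)\<bar> * ?K)"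
      using integrable_weight_product by (intro integrable_mult_left integrable_abs)
    show "AE p in lborel \<Otimes>\<^sub>M lborel. norm (\<bar>\<psi> (fst p) * \<psi> (snd p)\<bar> *
        expectation (\<lambda>\<omega>. \<bar>g (X (fst p) \<omega>) * h (X (snd p) \<omega>)\<bar>)) \<le> norm (\<bar>\<psi> (fst p) * \<psi> (snd p)\<bar> * ?K)"
    proof (rule AE_I2)
      fix p :: "'v \<times> 'v"
      have "0 \<le> expectation (\<lambda>\<omega>. \<bar>g (X (fst p) \<omega>) * h (X (snd p) \<omega>)\<bar>)" by simp
      with expectation_abs_product_le[OF g h, of "fst p" "snd p"]
      have "\<bar>expectation (\<lambda>\<omega>. \<bar>g (X (fst p) \<omega>) * h (X (snd p) \<omega>)\<bar>)\<bar> \<le> \<bar>?K\<bar>" by linarith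
      then show "norm (\<bar>\<psi> (fst p) * \<psi> (snd p)\<bar> *
        expectation (\<lambda>\<omega>. \<bar>g (X (fst p) \<omega>) * h (X (snd p) \<omega>)\<bar>)) \<le> norm (\<bar>\<psi> (fst p) * \<psi> (snd p)\<bar> * ?K)"
        unfolding real_norm_def abs_mult[of "\<bar>_\<bar>"] by (intro mult_left_mono) auto
    qed
  qed measurable
  show "AE p in lborel \<Otimes>\<^sub>M lborel. integrable M (\<lambda>\<omega>. case (p, \<omega>) of (p, \<omega>) \<Rightarrow>
      (\<psi> (fst p) * \<psi> (snd p)) * (g (X (fst p) \<omega>) * h (X (snd p) \<omega>)))"
    by (rule AE_I2) (auto simp: case_prod_beta intro!: integrable_mult_right square_integrable_mult
        square_integrable_field g h)
qed

lemma
  assumes g: "square_integrable \<eta> g" and h: "square_integrable \<eta> h"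
  shows integrable_weighted_integral_mult:
      "integrable M (\<lambda>\<omega>. weighted_integral g \<omega> * weighted_integral h \<omega>)"
    and expectation_weighted_integral_mult:
      "expectation (\<lambda>\<omega>. weighted_integral g \<omega> * weighted_integral h \<omega>) =
        (\<integral>p. \<psi> (fst p) * \<psi> (snd p) * expectation (\<lambda>\<omega>. g (X (fst p) \<omega>) * h (X (snd p) \<omega>)) \<partial>(lborel \<Otimes>\<^sub>M lborel))"
proof -
  have [measurable]: "g \<in> borel_measurable borel" "h \<in> borel_measurable borel"
    using assms by (auto intro: measurable_of_square_integrable)
  let ?F = "\<lambda>p \<omega>. (\<psi> (fst p) * \<psi> (snd p)) * (g (X (fst p) \<omega>) * h (X (snd p) \<omega>))"
  have int: "integrable ((lborel \<Otimes>\<^sub>M lborel) \<Otimes>\<^sub>M M) (case_prod ?F)"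
    by (rule integrable_field_product[OF g h])
  have [measurable]: "weighted_integral g \<in> borel_measurable M" "weighted_integral h \<in> borel_measurable M"
    unfolding weighted_integral_def[abs_def] by measurable
  \<comment> \<open>The integral over pairs factorizes at those \<open>\<omega>\<close> where the
    pair integrand is integrable, which is almost everywhere.\<close>
  have ae: "AE \<omega> in M. (\<integral>p. ?F p \<omega> \<partial>(lborel \<Otimes>\<^sub>M lborel)) = weighted_integral g \<omega> * weighted_integral h \<omega>"
    using PVM.AE_integrable_snd[OF int]
  proof eventually_elim
    case (elim \<omega>)
    have "(\<integral>p. ?F p \<omega> \<partial>(lborel \<Otimes>\<^sub>M lborel)) = (\<integral>v. \<integral>w. ?F (v, w) \<omega> \<partial>lborel \<partial>lborel)"
      by (rule lborel_pair.integral_fst'[OF elim, symmetric])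
    also have "\<dots> = (\<integral>v. (\<psi> v * g (X v \<omega>)) * weighted_integral h \<omega> \<partial>lborel)"
    proof (rule Bochner_Integration.integral_cong[OF refl])
      fix v
      have "(\<integral>w. ?F (v, w) \<omega> \<partial>lborel) = (\<integral>w. (\<psi> v * g (X v \<omega>)) * (\<psi> w * h (X w \<omega>)) \<partial>lborel)"
        by (simp add: mult_ac)
      then show "(\<integral>w. ?F (v, w) \<omega> \<partial>lborel) = (\<psi> v * g (X v \<omega>)) * weighted_integral h \<omega>"
        by (simp only: integral_mult_right_zero weighted_integral_def)
    qed
    finally show ?case by (simp add: weighted_integral_def)
  qed
  have "integrable M (\<lambda>\<omega>. \<integral>p. ?F p \<omega> \<partial>(lborel \<Otimes>\<^sub>M lborel))" by (rule PVM.integrable_snd[OF int])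
  then show "integrable M (\<lambda>\<omega>. weighted_integral g \<omega> * weighted_integral h \<omega>)"
    by (rule integrable_cong_AE_imp) (use ae in auto)
  have "expectation (\<lambda>\<omega>. weighted_integral g \<omega> * weighted_integral h \<omega>) =
     expectation (\<lambda>\<omega>. \<integral>p. ?F p \<omega> \<partial>(lborel \<Otimes>\<^sub>M lborel))"
    by (rule integral_cong_AE) (use ae in auto)
  also have "\<dots> = (\<integral>p. expectation (\<lambda>\<omega>. ?F p \<omega>) \<partial>(lborel \<Otimes>\<^sub>M lborel))"
    by (rule PVM.Fubini_integral[OF int])
  finally show "expectation (\<lambda>\<omega>. weighted_integral g \<omega> * weighted_integral h \<omega>) =
        (\<integral>p. \<psi> (fst p) * \<psi> (snd p) * expectation (\<lambda>\<omega>. g (X (fst p) \<omega>) * h (X (snd p) \<omega>)) \<partial>(lborel \<Otimes>\<^sub>M lborel))"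
    by simp
qed

lemma measurable_weighted_integral [measurable]:
  assumes [measurable]: "g \<in> borel_measurable borel"
  shows "weighted_integral g \<in> borel_measurable M"
  unfolding weighted_integral_def[abs_def] by measurable

lemma square_integrable_weighted_integral:
  assumes "square_integrable \<eta> g"
  shows "square_integrable M (weighted_integral g)"
  using measurable_weighted_integral[OF measurable_of_square_integrable[OF assms]]
    integrable_weighted_integral_mult[OF assms assms]
  by (simp add: square_integrable_def power2_eq_square)

text \<open>Boundedness from L2 of the law to L2 of M; the constant is the squared L1 norm of
  \<open>\<psi>\<close>, left as a double integral.\<close>

lemma expectation_weighted_integral_square_le:
  assumes g: "square_integrable \<eta> g"
  shows "expectation (\<lambda>\<omega>. (weighted_integral g \<omega>)\<^sup>2) \<le>
    (\<integral>p. \<bar>\<psi> (fst p) * \<psi> (snd p)\<bar> \<partial>(lborel \<Otimes>\<^sub>M lborel)) * (\<integral>x. (g x)\<^sup>2 \<partial>\<eta>)"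
proof -
  have [measurable]: "g \<in> borel_measurable borel" using assms by (rule measurable_of_square_integrable)
  let ?E = "\<lambda>p. expectation (\<lambda>\<omega>. g (X (fst p) \<omega>) * g (X (snd p) \<omega>))"
  have E: "\<bar>?E p\<bar> \<le> (\<integral>x. (g x)\<^sup>2 \<partial>\<eta>)" for p
    by (rule order_trans[OF integral_abs_bound])
       (use expectation_abs_product_le[OF g g, of "fst p" "snd p"] in simp)
  have le: "\<psi> (fst p) * \<psi> (snd p) * ?E p \<le> \<bar>\<psi> (fst p) * \<psi> (snd p)\<bar> * (\<integral>x. (g x)\<^sup>2 \<partial>\<eta>)" for p
  proof -
    have "\<psi> (fst p) * \<psi> (snd p) * ?E p \<le> \<bar>\<psi> (fst p) * \<psi> (snd p)\<bar> * \<bar>?E p\<bar>"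
      using abs_ge_self[of "\<psi> (fst p) * \<psi> (snd p) * ?E p"] by (simp only: abs_mult)
    also have "\<dots> \<le> \<bar>\<psi> (fst p) * \<psi> (snd p)\<bar> * (\<integral>x. (g x)\<^sup>2 \<partial>\<eta>)"
      by (intro mult_left_mono E) simp
    finally show ?thesis .
  qed
  have "expectation (\<lambda>\<omega>. (weighted_integral g \<omega>)\<^sup>2) = (\<integral>p. \<psi> (fst p) * \<psi> (snd p) * ?E p \<partial>(lborel \<Otimes>\<^sub>M lborel))"
    using expectation_weighted_integral_mult[OF g g] by (simp add: power2_eq_square)
  also have "\<dots> \<le> (\<integral>p. \<bar>\<psi> (fst p) * \<psi> (snd p)\<bar> * (\<integral>x. (g x)\<^sup>2 \<partial>\<eta>) \<partial>(lborel \<Otimes>\<^sub>M lborel))"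
  proof (rule integral_mono)
    show i: "integrable (lborel \<Otimes>\<^sub>M lborel) (\<lambda>p. \<bar>\<psi> (fst p) * \<psi> (snd p)\<bar> * (\<integral>x. (g x)\<^sup>2 \<partial>\<eta>))"
      using integrable_weight_product by (intro integrable_mult_left integrable_abs)
    show "integrable (lborel \<Otimes>\<^sub>M lborel) (\<lambda>p. \<psi> (fst p) * \<psi> (snd p) * ?E p)"
    proof (rule Bochner_Integration.integrable_bound[OF i])
      show "AE p in lborel \<Otimes>\<^sub>M lborel. norm (\<psi> (fst p) * \<psi> (snd p) * ?E p)
        \<le> norm (\<bar>\<psi> (fst p) * \<psi> (snd p)\<bar> * (\<integral>x. (g x)\<^sup>2 \<partial>\<eta>))"
        using E by (intro AE_I2) (simp add: abs_mult mult_left_mono)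
    qed measurable
  qed (rule le)
  finally show ?thesis by simp
qed

lemma integrable_field:
  assumes "square_integrable \<eta> g"
  shows "integrable (lborel \<Otimes>\<^sub>M M) (\<lambda>(v, \<omega>). \<psi> v * g (X v \<omega>))"
proof (rule PM.Fubini_integrable)
  have [measurable]: "g \<in> borel_measurable borel" using assms by (rule measurable_of_square_integrable)
  show "(\<lambda>(v, \<omega>). \<psi> v * g (X v \<omega>)) \<in> borel_measurable (lborel \<Otimes>\<^sub>M M)" by measurable
  have i: "integrable M (\<lambda>\<omega>. g (X v \<omega>))" for v
    using square_integrable_mult[OF square_integrable_field[OF assms, of v], of "\<lambda>_. 1"]
    by (simp add: square_integrable_def)
  have "expectation (\<lambda>\<omega>. norm (case (v, \<omega>) of (v, \<omega>) \<Rightarrow> \<psi> v * g (X v \<omega>))) = \<bar>\<psi> v\<bar> * (\<integral>x. \<bar>g x\<bar> \<partial>\<eta>)" for v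
    using integral_field[of "\<lambda>x. \<bar>g x\<bar>" v] by (simp add: abs_mult)
  then show "integrable lborel (\<lambda>v. expectation (\<lambda>\<omega>. norm (case (v, \<omega>) of (v, \<omega>) \<Rightarrow> \<psi> v * g (X v \<omega>))))"
    using integrable_weight by (simp add: integrable_abs)
  show "AE v in lborel. integrable M (\<lambda>\<omega>. case (v, \<omega>) of (v, \<omega>) \<Rightarrow> \<psi> v * g (X v \<omega>))"
    using i by simp
qed

lemma expectation_weighted_integral:
  assumes "square_integrable \<eta> g"
  shows "expectation (weighted_integral g) = (\<integral>v. \<psi> v \<partial>lborel) * (\<integral>x. g x \<partial>\<eta>)"
proof -
  have [measurable]: "g \<in> borel_measurable borel" using assms by (rule measurable_of_square_integrable)
  have "expectation (weighted_integral g) = (\<integral>v. expectation (\<lambda>\<omega>. \<psi> v * g (X v \<omega>)) \<partial>lborel)"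
    unfolding weighted_integral_def[abs_def] by (rule PM.Fubini_integral[OF integrable_field[OF assms]])
  then show ?thesis by (simp add: integral_field)
qed

text \<open>The equality is almost sure: where an integrand fails to be integrable its integral has
  the default value 0 and linearity may break down.\<close>

lemma weighted_integral_diff:
  assumes "square_integrable \<eta> g" "square_integrable \<eta> h"
  shows "AE \<omega> in M. weighted_integral (\<lambda>x. g x - h x) \<omega> = weighted_integral g \<omega> - weighted_integral h \<omega>"
  using PM.AE_integrable_snd[OF integrable_field[OF assms(1)]]
    PM.AE_integrable_snd[OF integrable_field[OF assms(2)]]
  by eventually_elim (simp add: weighted_integral_def right_diff_distrib)

lemma weighted_integral_sum:
  assumes "finite I" "\<And>i. i \<in> I \<Longrightarrow> square_integrable \<eta> (g i)"
  shows "AE \<omega> in M. weighted_integral (\<lambda>x. \<Sum>i\<in>I. g i x) \<omega> = (\<Sum>i\<in>I. weighted_integral (g i) \<omega>)"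
proof -
  have "AE \<omega> in M. \<forall>i\<in>I. integrable lborel (\<lambda>v. \<psi> v * g i (X v \<omega>))"
    using assms PM.AE_integrable_snd[OF integrable_field] by (intro AE_finite_allI) auto
  then show ?thesis
    by eventually_elim (simp add: weighted_integral_def sum_distrib_left)
qed

end

section \<open>Chaos decomposition of the variance\<close>

locale gaussian_integrated_field =
  integrated_field M X "distr M borel (X 0)" \<psi> + gaussian_law B M "X 0"
  for B :: "('w::euclidean_space \<Rightarrow> real) \<Rightarrow> ('w \<Rightarrow> real) \<Rightarrow> real"
    and M :: "'a measure" and X :: "'v::euclidean_space \<Rightarrow> 'a \<Rightarrow> 'w" and \<psi> :: "'v \<Rightarrow> real" +
  fixes c :: "'v \<Rightarrow> 'v \<Rightarrow> 'w \<Rightarrow> 'w \<Rightarrow> real"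
  assumes pair: "gaussian_pair B M (X v) (X w) (c v w)"
begin

abbreviation chaos_functional :: "nat \<Rightarrow> ('w \<Rightarrow> real) \<Rightarrow> 'a \<Rightarrow> real" where
  "chaos_functional q f \<equiv> weighted_integral (chaos_proj B law q f)"

lemma expectation_chaos_functional_mult:
  "expectation (\<lambda>\<omega>. chaos_functional p f \<omega> * chaos_functional q f \<omega>) =
    (if p = q then \<integral>x. \<psi> (fst x) * \<psi> (snd x) *
        (tensor_contraction (c (fst x) (snd x)) q (chaos_coeff B law f) (chaos_coeff B law f) / fact q)
          \<partial>(lborel \<Otimes>\<^sub>M lborel) else 0)"
proof -
  have "expectation (\<lambda>\<omega>. chaos_proj B law p f (X v \<omega>) * chaos_proj B law q f (X w \<omega>)) =
    (if p = q then tensor_contraction (c v w) q (chaos_coeff B law f) (chaos_coeff B law f) / fact q else 0)" for v w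
  proof -
    interpret XX: gaussian_pair B M "X v" "X w" "c v w" by (rule pair)
    show ?thesis by (rule XX.expectation_chaos_proj_product)
  qed
  then show ?thesis
    unfolding expectation_weighted_integral_mult[OF square_integrable_chaos_proj square_integrable_chaos_proj]
    by simp
qed

lemma chaos_proj_0: "chaos_proj B law 0 f x = (\<integral>x. f x \<partial>law)"
  unfolding chaos_proj_eq by (simp add: chaos_coeff_def)

text \<open>Orthogonality to the constants, which are recovered as the zeroth projection of the
  function 1.\<close>

lemma integral_chaos_proj:
  assumes "q \<ge> 1"
  shows "(\<integral>x. chaos_proj B law q f x \<partial>law) = 0"
proof -
  have "chaos_proj B law 0 (\<lambda>_. 1) x = 1" for x
    unfolding chaos_proj_0 using law.prob_space by simp
  then show ?thesis
    using integral_chaos_proj_chaos_proj[of law q f law 0 "\<lambda>_. 1"] assms by simp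
qed

lemma expectation_chaos_functional: "q \<ge> 1 \<Longrightarrow> expectation (chaos_functional q f) = 0"
  by (simp add: expectation_weighted_integral[OF square_integrable_chaos_proj] integral_chaos_proj)

lemma integrable_of_square_integrable: "square_integrable M Y \<Longrightarrow> integrable M Y"
  using square_integrable_mult[of M Y "\<lambda>_. 1"] by (simp add: square_integrable_def)

lemma variance_weighted_integral:
  assumes "square_integrable law g"
  shows "variance (weighted_integral g) =
    expectation (\<lambda>\<omega>. (weighted_integral g \<omega>)\<^sup>2) - (expectation (weighted_integral g))\<^sup>2"
  using square_integrable_weighted_integral[OF assms]
  by (intro variance_eq integrable_of_square_integrable square_integrableD(2))

lemma variance_chaos_functional:
  assumes "q \<ge> 1"
  shows "variance (chaos_functional q f) =
    (\<integral>x. \<psi> (fst x) * \<psi> (snd x) *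
        (tensor_contraction (c (fst x) (snd x)) q (chaos_coeff B law f) (chaos_coeff B law f) / fact q)
          \<partial>(lborel \<Otimes>\<^sub>M lborel))"
  unfolding variance_weighted_integral[OF square_integrable_chaos_proj] expectation_chaos_functional[OF assms]
  using expectation_chaos_functional_mult[of q f q] by (simp add: power2_eq_square)

text \<open>Boundedness of the weighted integral transfers the L2 convergence of the expansion to
  the functionals; orthogonality of different orders removes the cross terms.\<close>

lemma expectation_square_tendsto:
  assumes f: "square_integrable law f"
  shows "(\<lambda>n. \<Sum>q<n. expectation (\<lambda>\<omega>. (chaos_functional q f \<omega>)\<^sup>2)) \<longlonglongrightarrow>
    expectation (\<lambda>\<omega>. (weighted_integral f \<omega>)\<^sup>2)"
proof -
  let ?S = "\<lambda>n. weighted_integral (partial_chaos n f)"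
  have s: "square_integrable M (?S n)" for n
    by (intro square_integrable_weighted_integral square_integrable_partial_chaos)
  have F: "square_integrable M (weighted_integral f)"
    by (intro square_integrable_weighted_integral f)
  have cs: "square_integrable M (chaos_functional q f)" for q
    by (intro square_integrable_weighted_integral square_integrable_chaos_proj)
  note [measurable] = square_integrableD(1)[OF s] square_integrableD(1)[OF F] square_integrableD(1)[OF cs]
  let ?K = "\<integral>p. \<bar>\<psi> (fst p) * \<psi> (snd p)\<bar> \<partial>(lborel \<Otimes>\<^sub>M lborel)"
  have "(\<lambda>n. expectation (\<lambda>\<omega>. (weighted_integral f \<omega> - ?S n \<omega>)\<^sup>2)) \<longlonglongrightarrow> 0"
  proof (rule tendsto_sandwich[OF _ _ tendsto_const])
    have "(\<lambda>n. ?K * (\<integral>x. (f x - partial_chaos n f x)\<^sup>2 \<partial>law)) \<longlonglongrightarrow> ?K * 0"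
      by (intro tendsto_mult tendsto_const partial_chaos_tendsto f)
    then show "(\<lambda>n. ?K * (\<integral>x. (f x - partial_chaos n f x)\<^sup>2 \<partial>law)) \<longlonglongrightarrow> 0" by simp
    show "\<forall>\<^sub>F n in sequentially. 0 \<le> expectation (\<lambda>\<omega>. (weighted_integral f \<omega> - ?S n \<omega>)\<^sup>2)" by simp
    have "expectation (\<lambda>\<omega>. (weighted_integral f \<omega> - ?S n \<omega>)\<^sup>2) \<le>
       ?K * (\<integral>x. (f x - partial_chaos n f x)\<^sup>2 \<partial>law)" for n
    proof -
      note d = square_integrable_diff[OF f square_integrable_partial_chaos[of n f]]
      note [measurable] = square_integrableD(1)[OF square_integrable_weighted_integral[OF d]]
      have "expectation (\<lambda>\<omega>. (weighted_integral f \<omega> - ?S n \<omega>)\<^sup>2) =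
        expectation (\<lambda>\<omega>. (weighted_integral (\<lambda>x. f x - partial_chaos n f x) \<omega>)\<^sup>2)"
      proof (rule integral_cong_AE)
        show "AE \<omega> in M. (weighted_integral f \<omega> - ?S n \<omega>)\<^sup>2 =
            (weighted_integral (\<lambda>x. f x - partial_chaos n f x) \<omega>)\<^sup>2"
          using weighted_integral_diff[OF f square_integrable_partial_chaos[of n f]]
          by eventually_elim simp
      qed measurable
      also have "\<dots> \<le> ?K * (\<integral>x. (f x - partial_chaos n f x)\<^sup>2 \<partial>law)"
        by (rule expectation_weighted_integral_square_le[OF d])
      finally show ?thesis .
    qed
    then show "\<forall>\<^sub>F n in sequentially. expectation (\<lambda>\<omega>. (weighted_integral f \<omega> - ?S n \<omega>)\<^sup>2) \<le>
       ?K * (\<integral>x. (f x - partial_chaos n f x)\<^sup>2 \<partial>law)" by simp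
  qed
  then have "(\<lambda>n. expectation (\<lambda>\<omega>. (?S n \<omega>)\<^sup>2)) \<longlonglongrightarrow> expectation (\<lambda>\<omega>. (weighted_integral f \<omega>)\<^sup>2)"
    by (rule integral_square_tendsto[OF F s])
  moreover have "expectation (\<lambda>\<omega>. (?S n \<omega>)\<^sup>2) = (\<Sum>q<n. expectation (\<lambda>\<omega>. (chaos_functional q f \<omega>)\<^sup>2))" for n
  proof -
    have "AE \<omega> in M. ?S n \<omega> = (\<Sum>q<n. chaos_functional q f \<omega>)"
      unfolding partial_chaos_def[abs_def]
      by (intro weighted_integral_sum square_integrable_chaos_proj) simp
    then have "AE \<omega> in M. (?S n \<omega>)\<^sup>2 = (\<Sum>p<n. \<Sum>q<n. chaos_functional p f \<omega> * chaos_functional q f \<omega>)"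
      by eventually_elim (simp add: power2_eq_square sum_product)
    then have "expectation (\<lambda>\<omega>. (?S n \<omega>)\<^sup>2) =
       expectation (\<lambda>\<omega>. \<Sum>p<n. \<Sum>q<n. chaos_functional p f \<omega> * chaos_functional q f \<omega>)"
      by (intro integral_cong_AE) auto
    also have "\<dots> = (\<Sum>p<n. \<Sum>q<n. expectation (\<lambda>\<omega>. chaos_functional p f \<omega> * chaos_functional q f \<omega>))"
      by (subst Bochner_Integration.integral_sum
          | (intro Bochner_Integration.integrable_sum square_integrable_mult cs)
          | simp)+
    also have "\<dots> = (\<Sum>p<n. \<Sum>q<n. if p = q then expectation (\<lambda>\<omega>. (chaos_functional p f \<omega>)\<^sup>2) else 0)"
      by (intro sum.cong refl) (simp add: power2_eq_square expectation_chaos_functional_mult)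
    also have "\<dots> = (\<Sum>q<n. expectation (\<lambda>\<omega>. (chaos_functional q f \<omega>)\<^sup>2))"
      by (simp add: sum.delta')
    finally show ?thesis .
  qed
  ultimately show ?thesis by simp
qed

theorem variance_sums:
  assumes f: "square_integrable law f"
  shows "(\<lambda>n. variance (chaos_functional (Suc n) f)) sums variance (weighted_integral f)"
proof -
  \<comment> \<open>The zeroth projection is the constant
    \<open>\<integral>x. f x \<partial>law\<close>, so its functional contributes exactly the
    squared mean that separates the second moment from the variance.\<close>
  have 0: "expectation (\<lambda>\<omega>. (chaos_functional 0 f \<omega>)\<^sup>2) = (expectation (weighted_integral f))\<^sup>2"
    unfolding expectation_weighted_integral[OF f] weighted_integral_def chaos_proj_0
    by (simp add: prob_space)
  have "(\<lambda>q. expectation (\<lambda>\<omega>. (chaos_functional q f \<omega>)\<^sup>2)) sums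
     (variance (weighted_integral f) + expectation (\<lambda>\<omega>. (chaos_functional 0 f \<omega>)\<^sup>2))"
    using expectation_square_tendsto[OF f] unfolding sums_def 0 variance_weighted_integral[OF f] by simp
  then have "(\<lambda>n. expectation (\<lambda>\<omega>. (chaos_functional (Suc n) f \<omega>)\<^sup>2)) sums variance (weighted_integral f)"
    by (rule sums_Suc_iff[THEN iffD2])
  moreover have "variance (chaos_functional (Suc n) f) = expectation (\<lambda>\<omega>. (chaos_functional (Suc n) f \<omega>)\<^sup>2)" for n
    unfolding variance_weighted_integral[OF square_integrable_chaos_proj]
    by (simp add: expectation_chaos_functional)
  ultimately show ?thesis by simp
qed

end

section \<open>Positive semi-definite matrices\<close>

definition psd_matrix :: "'i set \<Rightarrow> ('i \<Rightarrow> 'i \<Rightarrow> complex) \<Rightarrow> bool" where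
  "psd_matrix S A \<longleftrightarrow> (\<forall>i\<in>S. \<forall>j\<in>S. A j i = cnj (A i j)) \<and>
     (\<forall>z. 0 \<le> Re (\<Sum>i\<in>S. \<Sum>j\<in>S. z i * cnj (z j) * A i j))"

lemma quadratic_form_insert:
  fixes A :: "'i \<Rightarrow> 'i \<Rightarrow> complex"
  assumes "finite S" "s \<notin> S" and h: "\<And>i. i \<in> S \<Longrightarrow> A s i = cnj (A i s)"
  shows "(\<Sum>i\<in>insert s S. \<Sum>j\<in>insert s S. z i * cnj (z j) * A i j) =
    z s * cnj (z s) * A s s + z s * cnj (\<Sum>i\<in>S. z i * A i s) + cnj (z s) * (\<Sum>i\<in>S. z i * A i s)
     + (\<Sum>i\<in>S. \<Sum>j\<in>S. z i * cnj (z j) * A i j)"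
  using assms(1,2)
  by (simp add: sum.distrib sum_distrib_left h cnj_sum mult_ac)

text \<open>The Schur complement of a positive diagonal entry is again positive semi-definite.\<close>

lemma psd_matrix_decomposition:
  assumes "finite S" "psd_matrix S A"
  shows "\<exists>(n::nat) u. \<forall>i\<in>S. \<forall>j\<in>S. A i j = (\<Sum>r<n. u r i * cnj (u r j))"
  using assms
proof (induction S arbitrary: A rule: finite_induct)
  case empty
  then show ?case by simp
next
  case (insert s S)
  have herm: "A j i = cnj (A i j)" if "i \<in> insert s S" "j \<in> insert s S" for i j
    using insert.prems that unfolding psd_matrix_def by blast
  have pos: "0 \<le> Re (\<Sum>i\<in>insert s S. \<Sum>j\<in>insert s S. z i * cnj (z j) * A i j)" for z
    using insert.prems unfolding psd_matrix_def by blast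
  define a where "a = Re (A s s)"
  have a: "A s s = of_real a"
    using herm[of s s] unfolding a_def by (simp add: complex_eq_iff)
  let ?\<beta> = "\<lambda>z. \<Sum>i\<in>S. z i * A i s"
  let ?q = "\<lambda>A z. \<Sum>i\<in>S. \<Sum>j\<in>S. z i * cnj (z j) * A i j"
  have pos': "0 \<le> Re (t * cnj t * of_real a + t * cnj (?\<beta> z) + cnj t * ?\<beta> z + ?q A z)" for z t
  proof -
    let ?z = "z(s := t)"
    have e: "?\<beta> ?z = ?\<beta> z" "?q A ?z = ?q A z"
      using insert.hyps by (auto intro!: sum.cong)
    have "(\<Sum>i\<in>insert s S. \<Sum>j\<in>insert s S. ?z i * cnj (?z j) * A i j) =
      ?z s * cnj (?z s) * A s s + ?z s * cnj (?\<beta> ?z) + cnj (?z s) * ?\<beta> ?z + ?q A ?z"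
      by (rule quadratic_form_insert[OF insert.hyps]) (rule herm; simp)
    then show ?thesis
      using pos[of ?z] unfolding e a by (simp only: fun_upd_same)
  qed
  show ?case
  proof (cases "a = 0")
    case True
    \<comment> \<open>With a zero diagonal entry the form is affine in the coordinate t, so
      non-negativity forces the coefficient of t to vanish.\<close>
    have \<beta>0: "?\<beta> z = 0" for z
    proof (rule ccontr)
      define w where "w = ?\<beta> z"
      define Q where "Q = ?q A z"
      assume "?\<beta> z \<noteq> 0"
      then have b: "(cmod w)\<^sup>2 > 0" unfolding w_def by simp
      \<comment> \<open>Chosen so that the form takes the value -1 at t = - r * w.\<close>
      define r where "r = (Re Q + 1) / (2 * (cmod w)\<^sup>2)"
      have "0 \<le> Re ((- of_real r * w) * cnj (- of_real r * w) * of_real a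
          + (- of_real r * w) * cnj w + cnj (- of_real r * w) * w + Q)"
        unfolding w_def Q_def by (rule pos')
      also have "\<dots> = - 2 * r * (cmod w)\<^sup>2 + Re Q"
        unfolding cmod_power2 True by (simp add: algebra_simps power2_eq_square)
      also have "\<dots> = - 1" unfolding r_def using b by (simp add: field_simps)
      finally show False by simp
    qed
    have z: "A i s = 0" if "i \<in> S" for i
      using \<beta>0[of "\<lambda>j. if j = i then 1 else 0"] that insert.hyps
      by (simp add: if_distrib[of "\<lambda>x. x * _"] sum.delta cong: if_cong)
    have "psd_matrix S A"
      unfolding psd_matrix_def
    proof (intro conjI ballI allI)
      show "A j i = cnj (A i j)" if "i \<in> S" "j \<in> S" for i j using that by (intro herm) auto
      show "0 \<le> Re (?q A z)" for z using pos'[of 0 z] by simp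
    qed
    from insert.IH[OF this] obtain n :: nat and u where
      u: "\<And>i j. i \<in> S \<Longrightarrow> j \<in> S \<Longrightarrow> A i j = (\<Sum>r<n. u r i * cnj (u r j))" by blast
    have "A i j = (\<Sum>r<n. (if i = s then 0 else u r i) * cnj (if j = s then 0 else u r j))"
      if "i \<in> insert s S" "j \<in> insert s S" for i j
    proof (cases "i = s \<or> j = s")
      case True
      have "A i s = 0" "A s j = 0" using that z herm[of j s] a \<open>a = 0\<close> by auto
      then show ?thesis using True by (auto intro!: sum.neutral)
    next
      case False
      then show ?thesis using u[of i j] that by simp
    qed
    then show ?thesis by (intro exI[of _ n] exI[of _ "\<lambda>r i. if i = s then 0 else u r i"]) blast
  next
    case False
    moreover have "0 \<le> a"
      using pos'[of 1 "\<lambda>_. 0"] by simp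
    ultimately have a0: "a > 0" by simp
    define A' where "A' i j = A i j - A i s * A s j / of_real a" for i j
    have "psd_matrix S A'"
      unfolding psd_matrix_def
    proof (intro conjI ballI allI)
      fix i j assume "i \<in> S" "j \<in> S"
      then show "A' j i = cnj (A' i j)"
        unfolding A'_def using herm[of i j] herm[of s j] herm[of i s] by (simp add: mult.commute)
    next
      fix z :: "'a \<Rightarrow> complex"
      have "?q A' z = ?q A z - (\<Sum>i\<in>S. \<Sum>j\<in>S. (z i * A i s) * (cnj (z j) * A s j) / of_real a)"
        unfolding A'_def by (simp add: right_diff_distrib sum_subtractf mult_ac)
      also have "(\<Sum>i\<in>S. \<Sum>j\<in>S. (z i * A i s) * (cnj (z j) * A s j) / of_real a) = ?\<beta> z * cnj (?\<beta> z) / of_real a"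
        unfolding cnj_sum sum_product sum_divide_distrib
        by (intro sum.cong refl) (simp add: herm[of _ s])
      finally have q: "?q A' z = ?q A z - ?\<beta> z * cnj (?\<beta> z) / of_real a" .
      \<comment> \<open>The minimizer in the coordinate s; the minimum is the form of the Schur
        complement.\<close>
      define t where "t = - ?\<beta> z / of_real a"
      have "t * cnj t * of_real a + t * cnj (?\<beta> z) + cnj t * ?\<beta> z = - (?\<beta> z * cnj (?\<beta> z) / of_real a)"
        unfolding t_def using a0 by (simp add: field_simps)
      then have "t * cnj t * of_real a + t * cnj (?\<beta> z) + cnj t * ?\<beta> z + ?q A z = ?q A' z"
        using q by simp
      then show "0 \<le> Re (?q A' z)" using pos'[of t z] by simp
    qed
    from insert.IH[OF this] obtain n :: nat and u where
      u: "\<And>i j. i \<in> S \<Longrightarrow> j \<in> S \<Longrightarrow> A' i j = (\<Sum>r<n. u r i * cnj (u r j))" by blast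
    \<comment> \<open>The vector with index n is the column at s divided by the root of a, and it
      accounts for the rank one term that was subtracted. The other vectors are extended by 0 at s,
      where the Schur complement has a zero row and column.\<close>
    define w where "w r i = (if r = n then A i s / of_real (sqrt a) else if i = s then 0 else u r i)" for r i
    have "A i j = (\<Sum>r<Suc n. w r i * cnj (w r j))" if ij: "i \<in> insert s S" "j \<in> insert s S" for i j
    proof -
      have last: "w n i * cnj (w n j) = A i s * A s j / of_real a"
        unfolding w_def using herm[of j s] ij a0
        by (simp flip: of_real_mult)
      have "(\<Sum>r<n. w r i * cnj (w r j)) = A i j - A i s * A s j / of_real a"
      proof (cases "i = s \<or> j = s")
        case True
        then have "(\<Sum>r<n. w r i * cnj (w r j)) = 0" unfolding w_def by (auto intro!: sum.neutral)
        then show ?thesis using True a a0 by auto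
      next
        case False
        then have "(\<Sum>r<n. w r i * cnj (w r j)) = A' i j"
          using u[of i j] ij unfolding w_def by simp
        then show ?thesis by (simp add: A'_def)
      qed
      then show ?thesis using last by simp
    qed
    then show ?thesis by blast
  qed
qed

text \<open>Tensor products of positive semi-definite matrices are positive semi-definite. The first
  matrix is split into rank one terms, each of which is absorbed into the vector, leaving q factors.
  The matrices may differ from factor to factor because they will be densities at different
  points.\<close>

lemma tensor_contraction_psd:
  fixes A :: "nat \<Rightarrow> 'w::euclidean_space \<Rightarrow> 'w \<Rightarrow> complex"
  assumes "\<And>k. k < q \<Longrightarrow> psd_matrix Basis (A k)"
  shows "0 \<le> Re (\<Sum>I\<in>multi_indices q. \<Sum>J\<in>multi_indices q.
     g I * cnj (g J) * (\<Prod>k<q. A k (I ! k) (J ! k)))"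
  using assms
proof (induction q arbitrary: A g)
  case 0
  then show ?case by simp
next
  case (Suc q)
  obtain n :: nat and u where
    u: "\<And>i j. i \<in> Basis \<Longrightarrow> j \<in> Basis \<Longrightarrow> A 0 i j = (\<Sum>r<n. u r i * cnj (u r j))"
    using psd_matrix_decomposition[OF finite_Basis Suc.prems[of 0]] by blast
  define G where "G r I = (\<Sum>b\<in>Basis. u r b * g (b # I))" for r I
  let ?P = "\<lambda>I J. \<Prod>k<q. A (Suc k) (I ! k) (J ! k)"
  have "(\<Sum>I\<in>multi_indices (Suc q). \<Sum>J\<in>multi_indices (Suc q). g I * cnj (g J) * (\<Prod>k<Suc q. A k (I ! k) (J ! k))) =
     (\<Sum>b\<in>Basis. \<Sum>I\<in>multi_indices q. \<Sum>b'\<in>Basis. \<Sum>J\<in>multi_indices q.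
        (\<Sum>r<n. (u r b * g (b # I)) * cnj (u r b' * g (b' # J)) * ?P I J))"
    unfolding sum_multi_indices_Suc prod.lessThan_Suc_shift
    by (intro sum.cong refl) (simp add: u sum_distrib_left sum_distrib_right mult_ac)
  \<comment> \<open>The exchanges move r outermost and both sums over the basis innermost, where
    they form \<open>G r I\<close> and the conjugate of \<open>G r J\<close>.\<close>
  also have "\<dots> = (\<Sum>b\<in>Basis. \<Sum>I\<in>multi_indices q. \<Sum>b'\<in>Basis. \<Sum>r<n. \<Sum>J\<in>multi_indices q.
        (u r b * g (b # I)) * cnj (u r b' * g (b' # J)) * ?P I J)"
    by (intro sum.cong refl sum.swap)
  also have "\<dots> = (\<Sum>b\<in>Basis. \<Sum>I\<in>multi_indices q. \<Sum>r<n. \<Sum>b'\<in>Basis. \<Sum>J\<in>multi_indices q.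
        (u r b * g (b # I)) * cnj (u r b' * g (b' # J)) * ?P I J)"
    by (intro sum.cong refl sum.swap)
  also have "\<dots> = (\<Sum>b\<in>Basis. \<Sum>r<n. \<Sum>I\<in>multi_indices q. \<Sum>b'\<in>Basis. \<Sum>J\<in>multi_indices q.
        (u r b * g (b # I)) * cnj (u r b' * g (b' # J)) * ?P I J)"
    by (intro sum.cong refl sum.swap)
  also have "\<dots> = (\<Sum>r<n. \<Sum>b\<in>Basis. \<Sum>I\<in>multi_indices q. \<Sum>b'\<in>Basis. \<Sum>J\<in>multi_indices q.
        (u r b * g (b # I)) * cnj (u r b' * g (b' # J)) * ?P I J)"
    by (rule sum.swap)
  also have "\<dots> = (\<Sum>r<n. \<Sum>I\<in>multi_indices q. \<Sum>b\<in>Basis. \<Sum>b'\<in>Basis. \<Sum>J\<in>multi_indices q.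
        (u r b * g (b # I)) * cnj (u r b' * g (b' # J)) * ?P I J)"
    by (intro sum.cong refl sum.swap)
  also have "\<dots> = (\<Sum>r<n. \<Sum>I\<in>multi_indices q. \<Sum>b\<in>Basis. \<Sum>J\<in>multi_indices q. \<Sum>b'\<in>Basis.
        (u r b * g (b # I)) * cnj (u r b' * g (b' # J)) * ?P I J)"
    by (intro sum.cong refl sum.swap)
  also have "\<dots> = (\<Sum>r<n. \<Sum>I\<in>multi_indices q. \<Sum>J\<in>multi_indices q. \<Sum>b\<in>Basis. \<Sum>b'\<in>Basis.
        (u r b * g (b # I)) * cnj (u r b' * g (b' # J)) * ?P I J)"
    by (intro sum.cong refl sum.swap)
  also have "\<dots> = (\<Sum>r<n. \<Sum>I\<in>multi_indices q. \<Sum>J\<in>multi_indices q. G r I * cnj (G r J) * ?P I J)"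
    unfolding G_def cnj_sum sum_product by (simp add: sum_distrib_right)
  finally have eq: "(\<Sum>I\<in>multi_indices (Suc q). \<Sum>J\<in>multi_indices (Suc q). g I * cnj (g J) * (\<Prod>k<Suc q. A k (I ! k) (J ! k))) =
    (\<Sum>r<n. \<Sum>I\<in>multi_indices q. \<Sum>J\<in>multi_indices q. G r I * cnj (G r J) * ?P I J)" .
  show ?case
    unfolding eq by (subst Re_sum) (intro sum_nonneg Suc.IH Suc.prems, simp)
qed


section \<open>Complex measures with a density\<close>

lemma measure_of_eq_measure:
  assumes "sets N = sets borel" "\<And>E. E \<in> sets borel \<Longrightarrow> m E = emeasure N E"
  shows "measure_of UNIV (sets borel) m = N"
proof -
  have "measure_of UNIV (sets borel) m = measure_of UNIV (sets borel) (emeasure N)"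
    by (rule measure_of_eq) (use assms sets.sigma_sets_eq[of borel] in auto)
  also have "\<dots> = N"
    using measure_of_of_measure[of N] assms(1) sets_eq_imp_space_eq[OF assms(1)] by simp
  finally show ?thesis .
qed

context finite_borel_measure
begin

text \<open>Set functions with a density with respect to the fixed finite measure M; in this form
  the complex integrals of the spectral measure become Bochner integrals.\<close>

definition has_density :: "('w set \<Rightarrow> complex) \<Rightarrow> ('w \<Rightarrow> complex) \<Rightarrow> bool" where
  "has_density \<nu> k \<longleftrightarrow> integrable M k \<and>
     (\<forall>E\<in>sets borel. \<nu> E = (\<integral>x. indicator E x * k x \<partial>M))"

lemma positive_variation_density:
  assumes k: "integrable M k" and \<nu>: "\<And>E. E \<in> sets borel \<Longrightarrow> \<nu> E = (\<integral>x. indicator E x * k x \<partial>M)"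
  shows "positive_variation \<nu> = density M (\<lambda>x. ennreal (max 0 (k x)))"
  unfolding positive_variation_def
proof (rule measure_of_eq_measure)
  let ?N = "density M (\<lambda>x. ennreal (max 0 (k x)))"
  have [measurable]: "k \<in> borel_measurable M" using k by auto
  show "sets ?N = sets borel" by (simp add: sets_eq_borel)
  have i: "integrable M (\<lambda>x. indicator F x * k x)" "integrable M (\<lambda>x. indicator F x * max 0 (k x))"
    if "F \<in> sets borel" for F
  proof -
    have [measurable]: "F \<in> sets M" using that by (simp add: sets_eq_borel)
    show "integrable M (\<lambda>x. indicator F x * k x)" "integrable M (\<lambda>x. indicator F x * max 0 (k x))"
      by (rule Bochner_Integration.integrable_bound[OF k]; auto simp: indicator_def)+
  qed
  have N: "emeasure ?N F = ennreal (\<integral>x. indicator F x * max 0 (k x) \<partial>M)" if "F \<in> sets borel" for F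
  proof -
    have [measurable]: "F \<in> sets M" using that by (simp add: sets_eq_borel)
    have "emeasure ?N F = (\<integral>\<^sup>+x. ennreal (indicator F x * max 0 (k x)) \<partial>M)"
      by (subst emeasure_density) (auto intro!: nn_integral_cong simp: indicator_def)
    also have "\<dots> = ennreal (\<integral>x. indicator F x * max 0 (k x) \<partial>M)"
      by (rule nn_integral_eq_integral[OF i(2)[OF that]]) auto
    finally show ?thesis .
  qed
  fix E :: "'w set" assume E: "E \<in> sets borel"
  show "(SUP F\<in>{F \<in> sets borel. F \<subseteq> E}. ennreal (\<nu> F)) = emeasure ?N E"
  proof (rule antisym)
    show "(SUP F\<in>{F \<in> sets borel. F \<subseteq> E}. ennreal (\<nu> F)) \<le> emeasure ?N E"
    proof (rule SUP_least)
      fix F assume F: "F \<in> {F \<in> sets borel. F \<subseteq> E}"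
      have "\<nu> F \<le> (\<integral>x. indicator E x * max 0 (k x) \<partial>M)"
        using F E i \<nu> by (auto intro!: integral_mono simp: indicator_def)
      then show "ennreal (\<nu> F) \<le> emeasure ?N E" unfolding N[OF E] by (rule ennreal_leI)
    qed
    \<comment> \<open>The part of E in the positive set of the Hahn decomposition, where the
      supremum is attained.\<close>
    let ?F = "E \<inter> {x. 0 < k x}"
    have "{x \<in> space M. 0 < k x} \<in> sets M" by measurable
    then have F: "?F \<in> sets borel"
      using E sets_eq_imp_space_eq[OF sets_eq_borel] sets_eq_borel by auto
    have "\<nu> ?F = (\<integral>x. indicator E x * max 0 (k x) \<partial>M)"
      unfolding \<nu>[OF F] by (intro Bochner_Integration.integral_cong) (auto simp: indicator_def)
    then have "emeasure ?N E = ennreal (\<nu> ?F)" unfolding N[OF E] by simp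
    also have "\<dots> \<le> (SUP F\<in>{F \<in> sets borel. F \<subseteq> E}. ennreal (\<nu> F))"
      by (rule SUP_upper) (use F in auto)
    finally show "emeasure ?N E \<le> (SUP F\<in>{F \<in> sets borel. F \<subseteq> E}. ennreal (\<nu> F))" .
  qed
qed

lemma integrable_mult_bounded:
  fixes k h :: "'w \<Rightarrow> complex"
  assumes "integrable M k" "h \<in> borel_measurable borel" "\<And>x. cmod (h x) \<le> C"
  shows "integrable M (\<lambda>x. k x * h x)"
proof (rule Bochner_Integration.integrable_bound)
  have [measurable]: "k \<in> borel_measurable M" "h \<in> borel_measurable M"
    using assms by (auto simp: measurable_cong_sets[OF sets_eq_borel refl])
  show "integrable M (\<lambda>x. of_real \<bar>C\<bar> * k x)" using assms(1) by simp
  show "(\<lambda>x. k x * h x) \<in> borel_measurable M" by measurable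
  have "cmod (h x) \<le> \<bar>C\<bar>" for x using assms(3)[of x] by linarith
  then show "AE x in M. norm (k x * h x) \<le> norm (of_real \<bar>C\<bar> * k x)"
    by (auto simp: norm_mult mult.commute intro!: mult_right_mono)
qed

lemma signed_integral_density:
  assumes k: "integrable M k" and \<nu>: "\<And>E. E \<in> sets borel \<Longrightarrow> \<nu> E = (\<integral>x. indicator E x * k x \<partial>M)"
    and h: "h \<in> borel_measurable borel" "\<And>x. cmod (h x) \<le> C"
  shows "signed_integral \<nu> h = (\<integral>x. complex_of_real (k x) * h x \<partial>M)"
proof -
  have [measurable]: "k \<in> borel_measurable M" using k by auto
  have [measurable]: "h \<in> borel_measurable M" using h by (simp add: measurable_cong_sets[OF sets_eq_borel refl])
  have kp: "integrable M (\<lambda>x. max 0 (k x))" "integrable M (\<lambda>x. max 0 (- k x))"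
    using k by auto
  have i: "integrable M (\<lambda>x. complex_of_real (max 0 (k x)) * h x)"
    "integrable M (\<lambda>x. complex_of_real (max 0 (- k x)) * h x)"
    by (intro integrable_mult_bounded[OF _ h] integrable_of_real kp)+
  have "- \<nu> E = (\<integral>x. indicator E x * (- k x) \<partial>M)" if "E \<in> sets borel" for E
    using \<nu>[OF that] by simp
  then have "positive_variation (\<lambda>E. - \<nu> E) = density M (\<lambda>x. ennreal (max 0 (- k x)))"
    using k by (intro positive_variation_density) auto
  then have "signed_integral \<nu> h = (\<integral>x. max 0 (k x) *\<^sub>R h x \<partial>M) - (\<integral>x. max 0 (- k x) *\<^sub>R h x \<partial>M)"
    unfolding signed_integral_def
    by (simp only: positive_variation_density[OF k \<nu>]) (subst (1 2) integral_density, auto simp del: ennreal_max_0 ennreal_max_0')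
  also have "\<dots> = (\<integral>x. complex_of_real (max 0 (k x)) * h x - complex_of_real (max 0 (- k x)) * h x \<partial>M)"
    unfolding scaleR_conv_of_real by (rule Bochner_Integration.integral_diff[OF i, symmetric])
  also have "\<dots> = (\<integral>x. complex_of_real (k x) * h x \<partial>M)"
    by (intro Bochner_Integration.integral_cong refl) (auto simp: max_def)
  finally show ?thesis .
qed

lemma complex_integral_density:
  assumes "has_density \<nu> k" and h: "h \<in> borel_measurable borel" "\<And>x. cmod (h x) \<le> C"
  shows "complex_integral \<nu> h = (\<integral>x. k x * h x \<partial>M)"
proof -
  have k: "integrable M k" and \<nu>: "\<And>E. E \<in> sets borel \<Longrightarrow> \<nu> E = (\<integral>x. indicator E x * k x \<partial>M)"
    using assms unfolding has_density_def by auto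
  have i: "integrable M (\<lambda>x. indicator E x * k x)" if "E \<in> sets borel" for E
    using integrable_mult_bounded[OF k, of "indicator E" 1] that by (simp add: mult.commute indicator_def)
  have "Re (\<nu> E) = (\<integral>x. indicator E x * Re (k x) \<partial>M)" "Im (\<nu> E) = (\<integral>x. indicator E x * Im (k x) \<partial>M)"
    if E: "E \<in> sets borel" for E
    unfolding \<nu>[OF E] integral_Re[OF i[OF E], symmetric] integral_Im[OF i[OF E], symmetric]
    by (auto intro!: Bochner_Integration.integral_cong simp: indicator_def)
  then have "complex_integral \<nu> h = (\<integral>x. complex_of_real (Re (k x)) * h x \<partial>M) + \<i> * (\<integral>x. complex_of_real (Im (k x)) * h x \<partial>M)"
    unfolding complex_integral_def
    using signed_integral_density[OF integrable_Re[OF k] _ h, of "\<lambda>E. Re (\<nu> E)"]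
      signed_integral_density[OF integrable_Im[OF k] _ h, of "\<lambda>E. Im (\<nu> E)"] by simp
  also have "\<dots> = (\<integral>x. complex_of_real (Re (k x)) * h x + \<i> * (complex_of_real (Im (k x)) * h x) \<partial>M)"
    using integrable_mult_bounded[OF integrable_of_real[OF integrable_Re[OF k]] h]
      integrable_mult_bounded[OF integrable_of_real[OF integrable_Im[OF k]] h]
    by simp
  also have "\<dots> = (\<integral>x. k x * h x \<partial>M)"
  proof (intro Bochner_Integration.integral_cong refl)
    fix x
    have "k x = complex_of_real (Re (k x)) + \<i> * complex_of_real (Im (k x))" by (rule complex_eq)
    then show "complex_of_real (Re (k x)) * h x + \<i> * (complex_of_real (Im (k x)) * h x) = k x * h x"
      by (metis distrib_right mult.assoc)
  qed
  finally show ?thesis .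
qed

end

section \<open>Product densities and exponentials\<close>

lemma (in pair_sigma_finite) integrable_mult_pair:
  fixes f :: "'a \<Rightarrow> 'c::{real_normed_field, banach, second_countable_topology}"
  assumes f: "integrable M1 f" and g: "integrable M2 g"
  shows "integrable (M1 \<Otimes>\<^sub>M M2) (\<lambda>(x, y). f x * g y)"
proof (rule Fubini_integrable)
  have [measurable]: "f \<in> borel_measurable M1" "g \<in> borel_measurable M2" using assms by auto
  show "(\<lambda>(x, y). f x * g y) \<in> borel_measurable (M1 \<Otimes>\<^sub>M M2)" by measurable
  show "integrable M1 (\<lambda>x. \<integral>y. norm (case (x, y) of (x, y) \<Rightarrow> f x * g y) \<partial>M2)"
    using integrable_norm[OF f] by (simp add: norm_mult)
  show "AE x in M1. integrable M2 (\<lambda>y. case (x, y) of (x, y) \<Rightarrow> f x * g y)"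
    using g by simp
qed

lemma integral_sum_sum:
  fixes f :: "'i \<Rightarrow> 'j \<Rightarrow> 'z \<Rightarrow> complex"
  assumes "\<And>i j. i \<in> A \<Longrightarrow> j \<in> B \<Longrightarrow> integrable M (f i j)"
  shows "(\<integral>x. (\<Sum>i\<in>A. \<Sum>j\<in>B. a i j * f i j x) \<partial>M) = (\<Sum>i\<in>A. \<Sum>j\<in>B. a i j * (\<integral>x. f i j x \<partial>M))"
proof -
  have "(\<integral>x. (\<Sum>i\<in>A. \<Sum>j\<in>B. a i j * f i j x) \<partial>M) = (\<Sum>i\<in>A. \<integral>x. (\<Sum>j\<in>B. a i j * f i j x) \<partial>M)"
    by (intro Bochner_Integration.integral_sum Bochner_Integration.integrable_sum integrable_mult_right assms)
  also have "\<dots> = (\<Sum>i\<in>A. \<Sum>j\<in>B. \<integral>x. a i j * f i j x \<partial>M)"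
    by (intro sum.cong refl Bochner_Integration.integral_sum integrable_mult_right assms)
  finally show ?thesis by simp
qed

text \<open>For H the matrix of densities of \<open>\<mu>\<close>, the density at (x 0, ..., x (q -
  1)) of the q-fold tensor power of \<open>\<mu>\<close> evaluated at the pair (g, g), before the
  coordinates are added up.\<close>

definition tensor_density :: "('w::euclidean_space \<Rightarrow> 'w \<Rightarrow> 'v \<Rightarrow> complex) \<Rightarrow> nat \<Rightarrow>
    ('w list \<Rightarrow> complex) \<Rightarrow> (nat \<Rightarrow> 'v) \<Rightarrow> complex" where
  "tensor_density H q g x = (\<Sum>I\<in>multi_indices q. \<Sum>J\<in>multi_indices q.
     g I * cnj (g J) * (\<Prod>k<q. H (I ! k) (J ! k) (x k)))"

definition char_exp :: "'v::euclidean_space \<Rightarrow> 'v \<Rightarrow> complex" where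
  "char_exp \<xi> v = exp (2 * \<i> * of_real pi * of_real (\<xi> \<bullet> v))"

lemma char_exp_norm [simp]: "cmod (char_exp \<xi> v) = 1"
proof -
  have "2 * \<i> * of_real pi * of_real (\<xi> \<bullet> v) = \<i> * of_real (2 * pi * (\<xi> \<bullet> v))" by simp
  then show ?thesis unfolding char_exp_def by (simp only: norm_exp_i_times)
qed

lemma measurable_char_exp [measurable]:
  assumes [measurable]: "f \<in> borel_measurable M" "g \<in> borel_measurable M"
  shows "(\<lambda>x. char_exp (f x) (g x)) \<in> borel_measurable M"
  unfolding char_exp_def by measurable

lemma char_exp_sum: "finite S \<Longrightarrow> char_exp (\<Sum>k\<in>S. x k) v = (\<Prod>k\<in>S. char_exp (x k) v)"
  unfolding char_exp_def
  by (simp add: exp_sum[symmetric] inner_sum_left sum_distrib_left)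

lemma char_exp_diff: "char_exp \<xi> (v - w) = char_exp \<xi> v * cnj (char_exp \<xi> w)"
  unfolding char_exp_def
  by (simp add: exp_cnj exp_add[symmetric] inner_diff_right algebra_simps)

lemma integrable_bounded_mult:
  fixes f h :: "'z \<Rightarrow> complex"
  assumes "integrable N f" "h \<in> borel_measurable N" "\<And>x. cmod (h x) \<le> 1"
  shows "integrable N (\<lambda>x. h x * f x)"
proof (rule Bochner_Integration.integrable_bound[OF assms(1)])
  show "(\<lambda>x. h x * f x) \<in> borel_measurable N" using assms by measurable
  show "AE x in N. norm (h x * f x) \<le> norm (f x)"
    using assms(3) by (auto simp: norm_mult mult_left_le_one_le)
qed

text \<open>The exponent has the sign opposite to that in \<open>fourier\<close>. For a real weight
  the two are complex conjugates and have the same modulus.\<close>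

definition transform :: "('v::euclidean_space \<Rightarrow> real) \<Rightarrow> 'v \<Rightarrow> complex" where
  "transform \<psi> \<xi> = (\<integral>v. complex_of_real (\<psi> v) * char_exp \<xi> v \<partial>lborel)"

lemma transform_square:
  assumes "integrable lborel \<psi>"
  shows "(\<integral>p. complex_of_real (\<psi> (fst p) * \<psi> (snd p)) * char_exp \<xi> (fst p - snd p) \<partial>(lborel \<Otimes>\<^sub>M lborel)) =
    complex_of_real ((cmod (transform \<psi> \<xi>))\<^sup>2)"
proof -
  let ?f = "\<lambda>v. complex_of_real (\<psi> v) * char_exp \<xi> v"
  have f: "integrable lborel ?f"
    using integrable_bounded_mult[OF integrable_of_real[OF assms], of "char_exp \<xi>"] by (simp add: mult.commute)
  have i: "integrable (lborel \<Otimes>\<^sub>M lborel) (\<lambda>(v, w). ?f v * cnj (?f w))"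
    by (intro lborel_pair.integrable_mult_pair f integrable_cnj)
  have "(\<integral>p. complex_of_real (\<psi> (fst p) * \<psi> (snd p)) * char_exp \<xi> (fst p - snd p) \<partial>(lborel \<Otimes>\<^sub>M lborel)) =
     (\<integral>(v, w). ?f v * cnj (?f w) \<partial>(lborel \<Otimes>\<^sub>M lborel))"
    by (intro Bochner_Integration.integral_cong refl) (auto simp: char_exp_diff)
  also have "\<dots> = (\<integral>v. \<integral>w. ?f v * cnj (?f w) \<partial>lborel \<partial>lborel)"
    using lborel_pair.integral_fst'[OF i] by simp
  also have "\<dots> = transform \<psi> \<xi> * cnj (transform \<psi> \<xi>)"
    unfolding transform_def by (simp only: integral_mult_right_zero integral_mult_left_zero Bochner_Integration.integral_cnj)
  finally show ?thesis unfolding complex_norm_square .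
qed

section \<open>Convolution powers as images of product measures\<close>

context finite_borel_measure
begin

sublocale iterated: product_sigma_finite "\<lambda>_::nat. M" ..

lemma space_eq_UNIV: "space M = UNIV"
  using sets_eq_imp_space_eq[OF sets_eq_borel] by simp

lemma measurable_component [measurable]:
  "k \<in> S \<Longrightarrow> (\<lambda>x. x k) \<in> borel_measurable (PiM S (\<lambda>_::nat. M))"
  using measurable_component_singleton[of k S "\<lambda>_. M"] measurable_cong_sets[OF refl sets_eq_borel] by blast

lemma measurable_component_sum [measurable]:
  "S \<subseteq> T \<Longrightarrow> (\<lambda>x. \<Sum>k\<in>S. x k) \<in> borel_measurable (PiM T (\<lambda>_::nat. M))"
  by (intro borel_measurable_sum measurable_component) auto

text \<open>Convolution is the image of a product under addition. The coordinates are indexed by the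
  entries of js, which are distinct, so that one convolution step adds one coordinate to the product
  space.\<close>

lemma measure_conv_list_density:
  assumes "\<And>j. j \<in> set js \<Longrightarrow> has_density (\<nu> j) (\<kappa> j)" "distinct js" "E \<in> sets borel"
  shows "measure_conv_list (map \<nu> js) E =
    (\<integral>x. indicator E (\<Sum>j\<in>set js. x j) * (\<Prod>j\<in>set js. \<kappa> j (x j)) \<partial>PiM (set js) (\<lambda>_::nat. M))"
  using assms
proof (induction js arbitrary: E)
  case Nil
  then show ?case by (simp add: PiM_empty lebesgue_integral_count_space_finite)
next
  case (Cons j js)
  let ?S = "set js"
  let ?P = "PiM ?S (\<lambda>_::nat. M)"
  interpret P: sigma_finite_measure ?P by (rule iterated.sigma_finite) simp
  interpret PM: pair_sigma_finite ?P M ..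
  have \<kappa>: "integrable M (\<kappa> i)" if "i \<in> set (j # js)" for i
    using Cons.prems(1)[OF that] by (simp add: has_density_def)
  have [measurable]: "\<kappa> j \<in> borel_measurable M" using \<kappa>[of j] by auto
  have [measurable]: "E \<in> sets borel" by (rule Cons.prems(3))
  have int: "integrable ?P (\<lambda>x. \<Prod>i\<in>?S. \<kappa> i (x i))"
    by (rule iterated.product_integrable_prod) (auto intro: \<kappa>)
  have [measurable]: "(\<lambda>x. \<Prod>i\<in>?S. \<kappa> i (x i)) \<in> borel_measurable ?P" using int by auto
  let ?F = "\<lambda>x. indicator E (\<Sum>i\<in>insert j ?S. x i) * (\<Prod>i\<in>insert j ?S. \<kappa> i (x i))"
  let ?f = "\<lambda>x y. indicator E (y + (\<Sum>i\<in>?S. x i)) * ((\<Prod>i\<in>?S. \<kappa> i (x i)) * \<kappa> j y)"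
  let ?L = "\<lambda>y. \<integral>x. indicator E (y + (\<Sum>i\<in>?S. x i)) * (\<Prod>i\<in>?S. \<kappa> i (x i)) \<partial>?P"
  have j: "j \<notin> ?S" using Cons.prems(2) by simp
  have intF: "integrable (PiM (insert j ?S) (\<lambda>_::nat. M)) ?F"
    by (intro integrable_bounded_mult iterated.product_integrable_prod)
       (auto intro: \<kappa> simp: indicator_def)
  have meas: "(\<lambda>(x, y). indicator E (y + (\<Sum>i\<in>?S. x i)) :: complex) \<in> borel_measurable (?P \<Otimes>\<^sub>M M)"
    by measurable
  have intf: "integrable (?P \<Otimes>\<^sub>M M) (\<lambda>(x, y). ?f x y)"
    using integrable_bounded_mult[OF PM.integrable_mult_pair[OF int \<kappa>[of j]] meas]
    by (auto simp: case_prod_unfold indicator_def)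
  have L_meas: "?L \<in> borel_measurable borel"
    by (rule P.borel_measurable_lebesgue_integral) measurable
  \<comment> \<open>\<open>complex_integral_density\<close> asks for a bounded integrand; the L1
    norm of the remaining product density is a bound.\<close>
  have L_bound: "cmod (?L y) \<le> (\<integral>x. cmod (\<Prod>i\<in>?S. \<kappa> i (x i)) \<partial>?P)" for y
  proof -
    have "cmod (?L y) \<le> (\<integral>x. cmod (indicator E (y + (\<Sum>i\<in>?S. x i)) * (\<Prod>i\<in>?S. \<kappa> i (x i))) \<partial>?P)"
      by (rule integral_norm_bound)
    also have "\<dots> \<le> (\<integral>x. cmod (\<Prod>i\<in>?S. \<kappa> i (x i)) \<partial>?P)"
      by (intro integral_mono integrable_norm integrable_bounded_mult int)
         (auto simp: norm_mult indicator_def)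
    finally show ?thesis .
  qed
  \<comment> \<open>The induction hypothesis is applied to a translate of E, which is why E is
    arbitrary in the induction.\<close>
  have L: "measure_conv_list (map \<nu> js) {\<zeta>. y + \<zeta> \<in> E} = ?L y" for y
  proof -
    have "{\<zeta>. y + \<zeta> \<in> E} \<in> sets borel" by measurable
    then show ?thesis
      using Cons.IH[of "{\<zeta>. y + \<zeta> \<in> E}"] Cons.prems by (simp add: indicator_def)
  qed
  have "measure_conv_list (map \<nu> (j # js)) E = complex_integral (\<nu> j) ?L"
    by (simp add: measure_conv_def L)
  also have "\<dots> = (\<integral>y. \<kappa> j y * ?L y \<partial>M)"
    by (rule complex_integral_density[OF _ L_meas L_bound]) (use Cons.prems in auto)
  also have "\<dots> = (\<integral>y. \<integral>x. ?f x y \<partial>?P \<partial>M)"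
    by (intro Bochner_Integration.integral_cong refl) (simp flip: integral_mult_right_zero add: mult_ac)
  also have "\<dots> = (\<integral>x. \<integral>y. ?f x y \<partial>M \<partial>?P)"
    by (rule PM.Fubini_integral[OF intf])
  also have "\<dots> = (\<integral>x. \<integral>y. ?F (x(j := y)) \<partial>M \<partial>?P)"
  proof (intro Bochner_Integration.integral_cong refl)
    fix x y
    have "(\<Sum>i\<in>?S. (x(j := y)) i) = (\<Sum>i\<in>?S. x i)" "(\<Prod>i\<in>?S. \<kappa> i ((x(j := y)) i)) = (\<Prod>i\<in>?S. \<kappa> i (x i))"
      using j by (auto intro!: sum.cong prod.cong)
    then show "?f x y = ?F (x(j := y))" using j by (simp add: mult_ac)
  qed
  also have "\<dots> = (\<integral>x. ?F x \<partial>PiM (insert j ?S) (\<lambda>_::nat. M))"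
    by (rule iterated.product_integral_insert[OF _ j intF, symmetric]) simp
  finally show ?case by simp
qed

lemma integrable_tensor_density:
  assumes "\<And>b b'. b \<in> Basis \<Longrightarrow> b' \<in> Basis \<Longrightarrow> integrable M (H b b')"
  shows "integrable (PiM {..<q} (\<lambda>_::nat. M)) (tensor_density H q g)"
  unfolding tensor_density_def
  by (intro Bochner_Integration.integrable_sum integrable_mult_right iterated.product_integrable_prod assms)
     (auto simp: multi_indices_def)

lemma conv_power_density:
  fixes \<mu> :: "'w set \<Rightarrow> ('u::euclidean_space \<Rightarrow> complex) \<Rightarrow> ('u \<Rightarrow> complex) \<Rightarrow> complex"
  assumes H: "\<And>b b'. b \<in> Basis \<Longrightarrow> b' \<in> Basis \<Longrightarrow>
      has_density (\<lambda>E. \<mu> E (\<lambda>w. of_real (dual_basis b w)) (\<lambda>w. of_real (dual_basis b' w))) (H b b')"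
    and E: "E \<in> sets borel"
  shows "conv_power \<mu> q E g g =
    (\<integral>x. indicator E (\<Sum>k<q. x k) * tensor_density H q g x \<partial>PiM {..<q} (\<lambda>_::nat. M))"
proof -
  let ?P = "PiM {..<q} (\<lambda>_::nat. M)"
  have basis: "I ! k \<in> Basis" if "I \<in> multi_indices q" "k < q" for I :: "'u list" and k
    using that nth_mem[of k I] by (auto simp: multi_indices_def)
  have [measurable]: "E \<in> sets borel" by (rule E)
  have int: "integrable ?P (\<lambda>x. indicator E (\<Sum>k<q. x k) * (\<Prod>k<q. H (I ! k) (J ! k) (x k)))"
    if "I \<in> multi_indices q" "J \<in> multi_indices q" for I J
    using that basis H
    by (intro integrable_bounded_mult iterated.product_integrable_prod) (auto simp: has_density_def indicator_def)
  have conv: "measure_conv_list (map (\<lambda>k F. \<mu> F (\<lambda>w. of_real (dual_basis (I ! k) w)) (\<lambda>w. of_real (dual_basis (J ! k) w))) [0..<q]) E =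
      (\<integral>x. indicator E (\<Sum>k<q. x k) * (\<Prod>k<q. H (I ! k) (J ! k) (x k)) \<partial>?P)"
    if "I \<in> multi_indices q" "J \<in> multi_indices q" for I J
    using measure_conv_list_density[of "[0..<q]" "\<lambda>k F. \<mu> F (\<lambda>w. of_real (dual_basis (I ! k) w)) (\<lambda>w. of_real (dual_basis (J ! k) w))"
        "\<lambda>k. H (I ! k) (J ! k)" E] H basis that E
    by (simp add: atLeast0LessThan)
  have "(\<integral>x. indicator E (\<Sum>k<q. x k) * tensor_density H q g x \<partial>?P) =
     (\<integral>x. (\<Sum>I\<in>multi_indices q. \<Sum>J\<in>multi_indices q.
       (g I * cnj (g J)) * (indicator E (\<Sum>k<q. x k) * (\<Prod>k<q. H (I ! k) (J ! k) (x k)))) \<partial>?P)"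
    unfolding tensor_density_def sum_distrib_left by (simp add: mult_ac)
  also have "\<dots> = (\<Sum>I\<in>multi_indices q. \<Sum>J\<in>multi_indices q. (g I * cnj (g J)) *
       (\<integral>x. indicator E (\<Sum>k<q. x k) * (\<Prod>k<q. H (I ! k) (J ! k) (x k)) \<partial>?P))"
    by (rule integral_sum_sum) (rule int)
  also have "\<dots> = conv_power \<mu> q E g g"
    unfolding conv_power_def using conv by (intro sum.cong refl) simp
  finally show ?thesis by simp
qed

text \<open>By \<open>tensor_contraction_psd\<close> the density is non-negative, so
  \<open>ennreal\<close> truncates nothing and the set function agrees with a genuine measure on all
  Borel sets.\<close>

lemma diagonal_measure_density:
  fixes \<mu> :: "'w set \<Rightarrow> ('u::euclidean_space \<Rightarrow> complex) \<Rightarrow> ('u \<Rightarrow> complex) \<Rightarrow> complex"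
  assumes H: "\<And>b b'. b \<in> Basis \<Longrightarrow> b' \<in> Basis \<Longrightarrow>
      has_density (\<lambda>E. \<mu> E (\<lambda>w. of_real (dual_basis b w)) (\<lambda>w. of_real (dual_basis b' w))) (H b b')"
    and psd: "\<And>\<xi>. psd_matrix Basis (\<lambda>b b'. H b b' \<xi>)"
  shows "diagonal_measure (conv_power \<mu> q) g =
    distr (density (PiM {..<q} (\<lambda>_::nat. M)) (\<lambda>x. ennreal (Re (tensor_density H q g x)))) borel (\<lambda>x. \<Sum>k<q. x k)"
  unfolding diagonal_measure_def
proof (rule measure_of_eq_measure)
  let ?P = "PiM {..<q} (\<lambda>_::nat. M)" and ?G = "tensor_density H q g"
  have G: "integrable ?P ?G" using H by (intro integrable_tensor_density) (auto simp: has_density_def)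
  have [measurable]: "?G \<in> borel_measurable ?P" using G by auto
  have pos: "0 \<le> Re (?G x)" for x
    unfolding tensor_density_def by (rule tensor_contraction_psd) (rule psd)
  fix E :: "'w set" assume E: "E \<in> sets borel"
  then have [measurable]: "E \<in> sets borel" .
  have i: "integrable ?P (\<lambda>x. indicator E (\<Sum>k<q. x k) * ?G x)"
    by (intro integrable_bounded_mult G) (auto simp: indicator_def)
  have conv: "conv_power \<mu> q E g g = (\<integral>x. indicator E (\<Sum>k<q. x k) * ?G x \<partial>?P)"
    by (rule conv_power_density) (fact H E)+
  have "emeasure (distr (density ?P (\<lambda>x. ennreal (Re (?G x)))) borel (\<lambda>x. \<Sum>k<q. x k)) E =
     emeasure (density ?P (\<lambda>x. ennreal (Re (?G x)))) ((\<lambda>x. \<Sum>k<q. x k) -` E \<inter> space ?P)"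
    by (subst emeasure_distr) auto
  also have "\<dots> = (\<integral>\<^sup>+x. ennreal (Re (?G x)) * indicator ((\<lambda>x. \<Sum>k<q. x k) -` E \<inter> space ?P) x \<partial>?P)"
    by (rule emeasure_density) measurable
  also have "\<dots> = (\<integral>\<^sup>+x. ennreal (Re (indicator E (\<Sum>k<q. x k) * ?G x)) \<partial>?P)"
    by (intro nn_integral_cong) (auto simp: indicator_def)
  also have "\<dots> = ennreal (\<integral>x. Re (indicator E (\<Sum>k<q. x k) * ?G x) \<partial>?P)"
    by (intro nn_integral_eq_integral integrable_Re i) (auto simp: indicator_def pos)
  also have "\<dots> = ennreal (Re (conv_power \<mu> q E g g))"
    unfolding conv integral_Re[OF i] ..
  finally show "ennreal (Re (conv_power \<mu> q E g g)) =
     emeasure (distr (density ?P (\<lambda>x. ennreal (Re (?G x)))) borel (\<lambda>x. \<Sum>k<q. x k)) E" by simp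
qed simp

lemma integral_diagonal_measure:
  fixes \<mu> :: "'w set \<Rightarrow> ('u::euclidean_space \<Rightarrow> complex) \<Rightarrow> ('u \<Rightarrow> complex) \<Rightarrow> complex"
    and p :: "'w \<Rightarrow> real"
  assumes H: "\<And>b b'. b \<in> Basis \<Longrightarrow> b' \<in> Basis \<Longrightarrow>
      has_density (\<lambda>E. \<mu> E (\<lambda>w. of_real (dual_basis b w)) (\<lambda>w. of_real (dual_basis b' w))) (H b b')"
    and psd: "\<And>\<xi>. psd_matrix Basis (\<lambda>b b'. H b b' \<xi>)"
    and p [measurable]: "p \<in> borel_measurable borel"
  shows "(\<integral>\<xi>. p \<xi> \<partial>diagonal_measure (conv_power \<mu> q) g) =
    (\<integral>x. Re (tensor_density H q g x) * p (\<Sum>k<q. x k) \<partial>PiM {..<q} (\<lambda>_::nat. M))"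
proof -
  let ?P = "PiM {..<q} (\<lambda>_::nat. M)" and ?G = "tensor_density H q g"
  have G: "integrable ?P ?G" using H by (intro integrable_tensor_density) (auto simp: has_density_def)
  have [measurable]: "?G \<in> borel_measurable ?P" using G by auto
  have pos: "0 \<le> Re (?G x)" for x
    unfolding tensor_density_def by (rule tensor_contraction_psd) (rule psd)
  have d: "diagonal_measure (conv_power \<mu> q) g =
      distr (density ?P (\<lambda>x. ennreal (Re (?G x)))) borel (\<lambda>x. \<Sum>k<q. x k)"
    by (rule diagonal_measure_density) (fact H psd)+
  show ?thesis unfolding d
    by (subst integral_distr) (auto simp: integral_real_density pos)
qed

text \<open>The exponential at a sum is a product over the coordinates, so the integral factorizes
  into q integrals over M, each of them an entry of the covariance.\<close>

lemma tensor_contraction_char: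
  fixes c :: "'w \<Rightarrow> 'u::euclidean_space \<Rightarrow> 'u \<Rightarrow> real"
  assumes H: "\<And>b b'. b \<in> Basis \<Longrightarrow> b' \<in> Basis \<Longrightarrow> integrable M (H b b')"
    and c: "\<And>b b'. b \<in> Basis \<Longrightarrow> b' \<in> Basis \<Longrightarrow>
      complex_of_real (c v b b') = (\<integral>\<xi>. H b b' \<xi> * char_exp \<xi> v \<partial>M)"
  shows "complex_of_real (tensor_contraction (c v) q g g) =
    (\<integral>x. char_exp (\<Sum>k<q. x k) v * tensor_density H q (\<lambda>I. of_real (g I)) x \<partial>PiM {..<q} (\<lambda>_::nat. M))"
proof -
  let ?P = "PiM {..<q} (\<lambda>_::nat. M)"
  have basis: "I ! k \<in> Basis" if "I \<in> multi_indices q" "k < q" for I :: "'u list" and k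
    using that nth_mem[of k I] by (auto simp: multi_indices_def)
  have i1: "integrable M (\<lambda>\<xi>. H b b' \<xi> * char_exp \<xi> v)" if "b \<in> Basis" "b' \<in> Basis" for b b'
    using H[OF that] by (rule integrable_mult_bounded[where C=1]) auto
  have int: "integrable ?P (\<lambda>x. \<Prod>k<q. H (I ! k) (J ! k) (x k) * char_exp (x k) v)"
    if "I \<in> multi_indices q" "J \<in> multi_indices q" for I J
    using that basis by (intro iterated.product_integrable_prod i1) auto
  have prod: "(\<integral>x. (\<Prod>k<q. H (I ! k) (J ! k) (x k) * char_exp (x k) v) \<partial>?P) =
      complex_of_real (\<Prod>k<q. c v (I ! k) (J ! k))"
    if "I \<in> multi_indices q" "J \<in> multi_indices q" for I J
  proof -
    have "(\<integral>x. (\<Prod>k<q. H (I ! k) (J ! k) (x k) * char_exp (x k) v) \<partial>?P) =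
       (\<Prod>k<q. \<integral>\<xi>. H (I ! k) (J ! k) \<xi> * char_exp \<xi> v \<partial>M)"
      using that basis
      by (intro iterated.product_integral_prod[where f="\<lambda>k \<xi>. H (I ! k) (J ! k) \<xi> * char_exp \<xi> v"] i1) auto
    then show ?thesis using that basis by (simp add: c)
  qed
  have "(\<integral>x. char_exp (\<Sum>k<q. x k) v * tensor_density H q (\<lambda>I. of_real (g I)) x \<partial>?P) =
    (\<integral>x. (\<Sum>I\<in>multi_indices q. \<Sum>J\<in>multi_indices q. complex_of_real (g I * g J) *
      (\<Prod>k<q. H (I ! k) (J ! k) (x k) * char_exp (x k) v)) \<partial>?P)"
    unfolding tensor_density_def sum_distrib_left char_exp_sum[OF finite_lessThan]
    by (simp add: prod.distrib mult_ac)
  also have "\<dots> = (\<Sum>I\<in>multi_indices q. \<Sum>J\<in>multi_indices q. complex_of_real (g I * g J) *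
      (\<integral>x. (\<Prod>k<q. H (I ! k) (J ! k) (x k) * char_exp (x k) v) \<partial>?P))"
    by (rule integral_sum_sum) (rule int)
  also have "\<dots> = complex_of_real (tensor_contraction (c v) q g g)"
    unfolding tensor_contraction_def using prod by simp
  finally show ?thesis by simp
qed

text \<open>After Fubini the points v and w are integrated first. For fixed x this gives the squared
  modulus of the transform at the sum of the coordinates, and the remaining integral is one over the
  image measure.\<close>

theorem integral_tensor_contraction:
  fixes \<mu> :: "'w set \<Rightarrow> ('u::euclidean_space \<Rightarrow> complex) \<Rightarrow> ('u \<Rightarrow> complex) \<Rightarrow> complex"
    and c :: "'w \<Rightarrow> 'u \<Rightarrow> 'u \<Rightarrow> real"
  assumes H: "\<And>b b'. b \<in> Basis \<Longrightarrow> b' \<in> Basis \<Longrightarrow>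
      has_density (\<lambda>E. \<mu> E (\<lambda>w. of_real (dual_basis b w)) (\<lambda>w. of_real (dual_basis b' w))) (H b b')"
    and psd: "\<And>\<xi>. psd_matrix Basis (\<lambda>b b'. H b b' \<xi>)"
    and c: "\<And>v b b'. b \<in> Basis \<Longrightarrow> b' \<in> Basis \<Longrightarrow>
      complex_of_real (c v b b') = (\<integral>\<xi>. H b b' \<xi> * char_exp \<xi> v \<partial>M)"
    and \<psi>: "integrable lborel \<psi>"
  shows "(\<integral>p. \<psi> (fst p) * \<psi> (snd p) * tensor_contraction (c (fst p - snd p)) q g g \<partial>(lborel \<Otimes>\<^sub>M lborel)) =
    (\<integral>\<xi>. (cmod (transform \<psi> \<xi>))\<^sup>2 \<partial>diagonal_measure (conv_power \<mu> q) (\<lambda>I. of_real (g I)))"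
proof -
  let ?P = "PiM {..<q} (\<lambda>_::nat. M)" and ?G = "tensor_density H q (\<lambda>I. complex_of_real (g I))"
  let ?N = "lborel \<Otimes>\<^sub>M lborel :: ('w \<times> 'w) measure"
  interpret P: sigma_finite_measure ?P by (rule iterated.sigma_finite) simp
  interpret NP: pair_sigma_finite ?N ?P ..
  have Hi: "integrable M (H b b')" if "b \<in> Basis" "b' \<in> Basis" for b b'
    using H[OF that] by (simp add: has_density_def)
  have G: "integrable ?P ?G" using Hi by (rule integrable_tensor_density)
  have [measurable]: "?G \<in> borel_measurable ?P" using G by auto
  have [measurable]: "\<psi> \<in> borel_measurable borel" using \<psi> by auto
  have \<psi>2: "integrable ?N (\<lambda>p. complex_of_real (\<psi> (fst p) * \<psi> (snd p)))"
    using integrable_of_real[OF lborel_pair.integrable_mult_pair[OF \<psi> \<psi>]] by (simp add: case_prod_beta)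
  \<comment> \<open>The exponential is kept as a separate factor of modulus 1, so that integrability
    follows from that of the weights and the density alone.\<close>
  let ?F = "\<lambda>p x. char_exp (\<Sum>k<q. x k) (fst p - snd p) * (complex_of_real (\<psi> (fst p) * \<psi> (snd p)) * ?G x)"
  have int: "integrable (?N \<Otimes>\<^sub>M ?P) (\<lambda>(p, x). ?F p x)"
    using integrable_bounded_mult[OF NP.integrable_mult_pair[OF \<psi>2 G],
        of "\<lambda>(p, x). char_exp (\<Sum>k<q. x k) (fst p - snd p)"]
    by (simp add: case_prod_unfold)
  have tm [measurable]: "transform \<psi> \<in> borel_measurable borel"
    unfolding transform_def[abs_def] by measurable
  have tc: "complex_of_real (tensor_contraction (c v) q g g) =
      (\<integral>x. char_exp (\<Sum>k<q. x k) v * ?G x \<partial>?P)" for v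
    by (rule tensor_contraction_char) (fact Hi c)+
  have "complex_of_real (\<integral>p. \<psi> (fst p) * \<psi> (snd p) * tensor_contraction (c (fst p - snd p)) q g g \<partial>?N) =
     (\<integral>p. complex_of_real (\<psi> (fst p) * \<psi> (snd p)) * complex_of_real (tensor_contraction (c (fst p - snd p)) q g g) \<partial>?N)"
    by (simp only: of_real_mult[symmetric] integral_complex_of_real)
  also have "\<dots> = (\<integral>p. \<integral>x. ?F p x \<partial>?P \<partial>?N)"
    unfolding tc
    by (intro Bochner_Integration.integral_cong refl) (simp flip: integral_mult_right_zero add: mult_ac)
  also have "\<dots> = (\<integral>x. \<integral>p. ?F p x \<partial>?N \<partial>?P)"
    by (rule NP.Fubini_integral[OF int, symmetric])
  also have "\<dots> = (\<integral>x. ?G x * complex_of_real ((cmod (transform \<psi> (\<Sum>k<q. x k)))\<^sup>2) \<partial>?P)"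
    unfolding transform_square[OF \<psi>, symmetric]
    by (intro Bochner_Integration.integral_cong refl) (simp flip: integral_mult_right_zero add: mult_ac)
  finally have eq: "complex_of_real (\<integral>p. \<psi> (fst p) * \<psi> (snd p) * tensor_contraction (c (fst p - snd p)) q g g \<partial>?N) =
     (\<integral>x. ?G x * complex_of_real ((cmod (transform \<psi> (\<Sum>k<q. x k)))\<^sup>2) \<partial>?P)" .
  have "integrable ?P (\<lambda>x. \<integral>p. ?F p x \<partial>?N)"
    by (rule NP.integrable_snd[OF int])
  then have i: "integrable ?P (\<lambda>x. ?G x * complex_of_real ((cmod (transform \<psi> (\<Sum>k<q. x k)))\<^sup>2))"
    unfolding transform_square[OF \<psi>, symmetric]
    by (rule Bochner_Integration.integrable_cong[THEN iffD1, rotated 2])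
       (simp_all flip: integral_mult_right_zero add: mult_ac)
  have "(\<integral>p. \<psi> (fst p) * \<psi> (snd p) * tensor_contraction (c (fst p - snd p)) q g g \<partial>?N) =
     (\<integral>x. Re (?G x * complex_of_real ((cmod (transform \<psi> (\<Sum>k<q. x k)))\<^sup>2)) \<partial>?P)"
    using arg_cong[OF eq, of Re] integral_Re[OF i] by simp
  then show ?thesis
    using integral_diagonal_measure[where H=H and \<mu>=\<mu> and p="\<lambda>\<xi>. (cmod (transform \<psi> \<xi>))\<^sup>2" and q=q
        and g="\<lambda>I. of_real (g I)", OF H psd]
    by simp
qed

end

section \<open>Density of the spectral measure\<close>

lemma finite_borel_measure_of_real:
  fixes m :: "'v::euclidean_space set \<Rightarrow> real"
  assumes nonneg: "\<And>E. E \<in> sets borel \<Longrightarrow> 0 \<le> m E"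
    and sums: "\<And>A::nat \<Rightarrow> 'v set. range A \<subseteq> sets borel \<Longrightarrow> disjoint_family A \<Longrightarrow>
      (\<lambda>i. m (A i)) sums m (\<Union>i. A i)"
  shows "\<exists>N. finite_borel_measure N \<and> (\<forall>E\<in>sets borel. emeasure N E = ennreal (m E))"
proof -
  define N where "N = measure_of UNIV (sets borel) (\<lambda>E. ennreal (m E))"
  \<comment> \<open>Additivity along the empty sets is a convergent series with constant terms,
    which forces the value 0.\<close>
  have "(\<lambda>i::nat. m {}) sums m (\<Union>i::nat. {})"
    by (rule sums) (auto simp: disjoint_family_on_def)
  then have m0: "m {} = 0" using sums_summable summable_const_iff by blast
  have e: "emeasure N E = ennreal (m E)" if E: "E \<in> sets borel" for E
    unfolding N_def
  proof (rule emeasure_measure_of_sigma)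
    show "sigma_algebra UNIV (sets (borel :: 'v measure))"
      using sets.sigma_algebra_axioms[of "borel :: 'v measure"] by simp
    show "positive (sets borel) (\<lambda>E. ennreal (m E))" by (simp add: positive_def m0)
    show "countably_additive (sets borel) (\<lambda>E. ennreal (m E))"
    proof (rule countably_additiveI)
      fix A :: "nat \<Rightarrow> 'v set" assume A: "range A \<subseteq> sets borel" "disjoint_family A"
      show "(\<Sum>i. ennreal (m (A i))) = ennreal (m (\<Union>i. A i))"
        by (rule suminf_ennreal_eq[OF nonneg sums[OF A]]) (use A in auto)
    qed
  qed fact
  have s: "sets N = sets borel" unfolding N_def using sets.sigma_sets_eq[of "borel :: 'v measure"] by simp
  interpret finite_measure N
    by (rule finite_measureI) (use e[of UNIV] sets_eq_imp_space_eq[OF s] in simp)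
  have "finite_borel_measure N" by unfold_locales (rule s)
  with e show ?thesis by blast
qed

section \<open>Calculus of densities and the Radon-Nikodym theorem\<close>

context finite_borel_measure
begin

lemma integrable_indicator_mult:
  assumes "integrable M k" "E \<in> sets borel"
  shows "integrable M (\<lambda>x. indicator E x * k x :: complex)"
  by (rule integrable_bounded_mult[OF assms(1)])
     (use assms(2) in \<open>auto simp: indicator_def measurable_cong_sets[OF sets_eq_borel refl]\<close>)

lemma has_density_add:
  assumes "has_density \<nu> k" "has_density \<nu>' k'"
  shows "has_density (\<lambda>E. \<nu> E + \<nu>' E) (\<lambda>x. k x + k' x)"
  using assms unfolding has_density_def by (simp add: distrib_left integrable_indicator_mult)

lemma has_density_cmult:
  assumes "has_density \<nu> k"
  shows "has_density (\<lambda>E. c * \<nu> E) (\<lambda>x. c * k x)"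
  using assms unfolding has_density_def by (simp add: mult.left_commute)

lemma has_density_cnj:
  assumes "has_density \<nu> k"
  shows "has_density (\<lambda>E. cnj (\<nu> E)) (\<lambda>x. cnj (k x))"
proof -
  have "(\<integral>x. indicator E x * cnj (k x) \<partial>M) = cnj (\<integral>x. indicator E x * k x \<partial>M)" for E
    unfolding Bochner_Integration.integral_cnj[symmetric]
    by (intro Bochner_Integration.integral_cong refl) (simp add: indicator_def)
  with assms show ?thesis unfolding has_density_def by (simp add: integrable_cnj)
qed

lemma has_density_sum:
  assumes "finite I" "\<And>i. i \<in> I \<Longrightarrow> has_density (\<nu> i) (k i)"
  shows "has_density (\<lambda>E. \<Sum>i\<in>I. \<nu> i E) (\<lambda>x. \<Sum>i\<in>I. k i x)"
  using assms
proof (induction I rule: finite_induct)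
  case empty
  then show ?case by (simp add: has_density_def)
next
  case (insert i I)
  then show ?case by (simp add: has_density_add)
qed

lemma has_density_cong:
  assumes "has_density \<nu> k" "\<And>E. E \<in> sets borel \<Longrightarrow> \<nu>' E = \<nu> E"
  shows "has_density \<nu>' k"
  using assms unfolding has_density_def by simp

lemma has_density_AE:
  assumes d: "has_density \<nu> k" and ae: "AE x in M. k' x = k x" and [measurable]: "k' \<in> borel_measurable M"
  shows "has_density \<nu> k'"
proof -
  have k: "integrable M k" using d by (simp add: has_density_def)
  then have [measurable]: "k \<in> borel_measurable M" by auto
  have "integrable M k'" by (rule integrable_cong_AE_imp[OF k]) (use ae in auto)
  moreover have "(\<integral>x. indicator E x * k' x \<partial>M) = (\<integral>x. indicator E x * k x \<partial>M)" if "E \<in> sets borel" for E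
  proof -
    have [measurable]: "E \<in> sets M" using that by (simp add: sets_eq_borel)
    show ?thesis by (rule integral_cong_AE) (use ae in auto)
  qed
  ultimately show ?thesis using d by (simp add: has_density_def)
qed

lemma has_density_nonneg:
  assumes d: "has_density \<nu> k" and nn: "\<And>E. E \<in> sets borel \<Longrightarrow> 0 \<le> Re (\<nu> E)"
  shows "AE x in M. 0 \<le> Re (k x)"
proof -
  have k: "integrable M k" using d by (simp add: has_density_def)
  then have [measurable]: "k \<in> borel_measurable M" by auto
  \<comment> \<open>Over this set the integral of Re k is at most 0 and, by assumption, at least 0,
    so the set is null.\<close>
  let ?E = "{x. Re (k x) < 0}"
  have "{x \<in> space M. Re (k x) < 0} \<in> sets M" by measurable
  then have E: "?E \<in> sets borel" by (simp add: space_eq_UNIV sets_eq_borel)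
  note i = integrable_indicator_mult[OF k E]
  have "0 \<le> Re (\<nu> ?E)" by (rule nn[OF E])
  also have "\<dots> = (\<integral>x. Re (indicator ?E x * k x) \<partial>M)"
    using d E integral_Re[OF i] by (simp add: has_density_def)
  finally have "(\<integral>x. - Re (indicator ?E x * k x) \<partial>M) \<le> 0"
    unfolding Bochner_Integration.integral_minus by linarith
  moreover have nn2: "0 \<le> - Re (indicator ?E x * k x)" for x by (simp add: indicator_def)
  ultimately have "(\<integral>x. - Re (indicator ?E x * k x) \<partial>M) = 0"
    by (intro antisym Bochner_Integration.integral_nonneg) auto
  then have "AE x in M. - Re (indicator ?E x * k x) = 0"
    using integral_nonneg_eq_0_iff_AE[OF Bochner_Integration.integrable_minus[OF integrable_Re[OF i]] AE_I2[OF nn2]]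
    by blast
  then show ?thesis
  proof eventually_elim
    case (elim x)
    then show ?case by (cases "Re (k x) < 0") (simp_all add: indicator_def)
  qed
qed

lemma has_density_Radon_Nikodym:
  assumes N: "finite_borel_measure N" "\<And>E. E \<in> sets borel \<Longrightarrow> emeasure N E = ennreal (m E)"
    and nonneg: "\<And>E. E \<in> sets borel \<Longrightarrow> 0 \<le> m E"
    and le: "\<And>E. E \<in> sets borel \<Longrightarrow> emeasure N E \<le> emeasure M E"
  shows "\<exists>D. has_density (\<lambda>E. complex_of_real (m E)) D"
proof -
  interpret N: finite_borel_measure N by fact
  have s: "sets N = sets M" by (simp add: sets_eq_borel N.sets_eq_borel)
  have ac: "absolutely_continuous M N"
    unfolding absolutely_continuous_def null_sets_def using le
    by (auto simp: s sets_eq_borel) (metis le_zero_eq)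
  obtain D where D: "D \<in> borel_measurable M" "AE x in M. RN_deriv M N x = ennreal (D x)" "\<And>x. 0 \<le> D x"
    using real_RN_deriv[OF N.finite_measure_axioms ac s] by metis
  note [measurable] = D(1)
  have e: "(\<integral>\<^sup>+x. ennreal (indicator E x * D x) \<partial>M) = ennreal (m E)" if E: "E \<in> sets borel" for E
  proof -
    have [measurable]: "E \<in> sets M" using E by (simp add: sets_eq_borel)
    have "ennreal (m E) = emeasure (density M (RN_deriv M N)) E"
      using N(2)[OF E] density_RN_deriv[OF ac s] by simp
    also have "\<dots> = (\<integral>\<^sup>+x. RN_deriv M N x * indicator E x \<partial>M)"
      by (rule emeasure_density) auto
    also have "\<dots> = (\<integral>\<^sup>+x. ennreal (indicator E x * D x) \<partial>M)"
      by (rule nn_integral_cong_AE) (use D(2) in \<open>auto simp: indicator_def\<close>)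
    finally show ?thesis by simp
  qed
  have "integrable M D"
  proof (rule integrableI_nonneg)
    show "(\<integral>\<^sup>+x. ennreal (D x) \<partial>M) < \<infinity>" using e[of UNIV] by simp
  qed (use D in auto)
  moreover have "m E = (\<integral>x. indicator E x * D x \<partial>M)" if E: "E \<in> sets borel" for E
  proof -
    have [measurable]: "E \<in> sets M" using E by (simp add: sets_eq_borel)
    have "(\<integral>x. indicator E x * D x \<partial>M) = enn2real (\<integral>\<^sup>+x. ennreal (indicator E x * D x) \<partial>M)"
      by (rule integral_eq_nn_integral) (use D(3) in auto)
    then show ?thesis using e[OF E] nonneg[OF E] by simp
  qed
  moreover have "indicator E x * complex_of_real (D x) = complex_of_real (indicator E x * D x)" for E x
    by (simp add: indicator_def)
  ultimately have "has_density (\<lambda>E. complex_of_real (m E)) (\<lambda>x. complex_of_real (D x))"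
    unfolding has_density_def by (simp del: of_real_mult)
  then show ?thesis by blast
qed

end

section \<open>Positive semi-definite Hermitian forms and polarization\<close>

lemma psd_hermitian_onD:
  assumes "psd_hermitian_on S H" "x \<in> S" "y \<in> S"
  shows "z \<in> S \<Longrightarrow> H (\<lambda>t. a * x t + b * y t) z = a * H x z + b * H y z"
    and "H y x = cnj (H x y)" and "0 \<le> Re (H x x)"
  using assms unfolding psd_hermitian_on_def by blast+

lemma linear_complex_combination:
  fixes x y :: "'w::real_vector \<Rightarrow> complex"
  assumes "linear x" "linear y"
  shows "linear (\<lambda>t. a * x t + b * y t)"
  using assms by (intro linearI) (simp_all add: linear_add linear_scale algebra_simps scaleR_conv_of_real)

text \<open>The choices a = 1 and a = \<i> recover the real and the imaginary part of
  \<open>H x y\<close> from diagonal values. The factor 1 keeps the combination in the shape used by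
  \<open>psd_hermitian_on\<close>.\<close>

lemma psd_hermitian_polarization:
  fixes H :: "('w::real_vector \<Rightarrow> complex) \<Rightarrow> ('w \<Rightarrow> complex) \<Rightarrow> complex"
  assumes H: "psd_hermitian_on {l. linear l} H" and x: "linear x" and y: "linear y"
  shows "Re (H (\<lambda>t. 1 * x t + a * y t) (\<lambda>t. 1 * x t + a * y t)) =
    Re (H x x) + (cmod a)\<^sup>2 * Re (H y y) + 2 * Re (a * cnj (H x y))"
proof -
  let ?s = "\<lambda>t. 1 * x t + a * y t"
  have s: "linear ?s" by (rule linear_complex_combination[OF x y])
  have 1: "H ?s z = 1 * H x z + a * H y z" if "linear z" for z
    using psd_hermitian_onD(1)[OF H, of x y z 1 a] x y that by simp
  have 2: "H z ?s = cnj (H ?s z)" if "linear z" for z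
    using psd_hermitian_onD(2)[OF H, of ?s z] s that by simp
  have yx: "H y x = cnj (H x y)" using psd_hermitian_onD(2)[OF H, of x y] x y by simp
  have "H ?s ?s = H x ?s + a * H y ?s" using 1[OF s] by simp
  also have "H x ?s = cnj (H x x + a * H y x)" using 2[OF x] 1[OF x] by simp
  also have "H y ?s = cnj (H x y + a * H y y)" using 2[OF y] 1[OF y] by simp
  finally have e: "H ?s ?s = cnj (H x x + a * cnj (H x y)) + a * cnj (H x y + a * H y y)" unfolding yx .
  show ?thesis unfolding e cmod_power2 by (simp add: power2_eq_square algebra_simps)
qed

lemma psd_hermitian_sum:
  fixes H :: "('w::real_vector \<Rightarrow> complex) \<Rightarrow> ('w \<Rightarrow> complex) \<Rightarrow> complex"
  assumes H: "psd_hermitian_on {l. linear l} H" and "finite I" "\<And>i. i \<in> I \<Longrightarrow> linear (x i)" "linear z"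
  shows "linear (\<lambda>t. \<Sum>i\<in>I. c i * x i t) \<and> H (\<lambda>t. \<Sum>i\<in>I. c i * x i t) z = (\<Sum>i\<in>I. c i * H (x i) z)"
  using assms(2,3)
proof (induction I rule: finite_induct)
  case empty
  have "H (\<lambda>t. 0 * z t + 0 * z t) z = 0 * H z z + 0 * H z z"
    using assms(4) by (intro psd_hermitian_onD(1)[OF H]) auto
  moreover have "linear (\<lambda>t::'w. 0::complex)" by (rule linearI) auto
  ultimately show ?case by simp
next
  case (insert i I)
  then have IH: "linear (\<lambda>t. \<Sum>i\<in>I. c i * x i t)" "H (\<lambda>t. \<Sum>i\<in>I. c i * x i t) z = (\<Sum>i\<in>I. c i * H (x i) z)"
    and i: "linear (x i)" by auto
  have "linear (\<lambda>t. c i * x i t + 1 * (\<Sum>i\<in>I. c i * x i t))"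
    by (rule linear_complex_combination[OF i IH(1)])
  moreover have "H (\<lambda>t. c i * x i t + 1 * (\<Sum>i\<in>I. c i * x i t)) z =
      c i * H (x i) z + 1 * H (\<lambda>t. \<Sum>i\<in>I. c i * x i t) z"
    using i IH(1) assms(4) by (intro psd_hermitian_onD(1)[OF H]) auto
  ultimately show ?case using insert.hyps IH(2) by simp
qed

text \<open>The double sum is the diagonal value of H at the combination of the forms x i with
  coefficients c i.\<close>

lemma psd_hermitian_sum_sum:
  fixes H :: "('w::real_vector \<Rightarrow> complex) \<Rightarrow> ('w \<Rightarrow> complex) \<Rightarrow> complex"
  assumes H: "psd_hermitian_on {l. linear l} H" and I: "finite I" "\<And>i. i \<in> I \<Longrightarrow> linear (x i)"
  shows "0 \<le> Re (\<Sum>i\<in>I. \<Sum>j\<in>I. c i * cnj (c j) * H (x i) (x j))"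
proof -
  let ?s = "\<lambda>t. \<Sum>i\<in>I. c i * x i t"
  have s: "linear ?s"
    using psd_hermitian_sum[where x=x and c=c and z="\<lambda>_. 0", OF H I] by (simp add: linear_zero)
  have e: "H ?s z = (\<Sum>i\<in>I. c i * H (x i) z)" if "linear z" for z
    using psd_hermitian_sum[where x=x and c=c, OF H I that] by blast
  have "H (x i) ?s = (\<Sum>j\<in>I. cnj (c j) * H (x i) (x j))" if "i \<in> I" for i
  proof -
    have "H (x i) ?s = cnj (H ?s (x i))"
      using psd_hermitian_onD(2)[OF H, of ?s "x i"] s I(2)[OF that] by simp
    also have "\<dots> = (\<Sum>j\<in>I. cnj (c j) * cnj (H (x j) (x i)))"
      unfolding e[OF I(2)[OF that]] by simp
    also have "\<dots> = (\<Sum>j\<in>I. cnj (c j) * H (x i) (x j))"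
      using I(2) that psd_hermitian_onD(2)[OF H, of "x i"]
      by (intro sum.cong refl arg_cong2[where f="(*)"]) (metis complex_cnj_cnj mem_Collect_eq)
    finally show ?thesis .
  qed
  then have "H ?s ?s = (\<Sum>i\<in>I. \<Sum>j\<in>I. c i * cnj (c j) * H (x i) (x j))"
    unfolding e[OF s] by (simp add: sum_distrib_left mult.assoc)
  then show ?thesis using psd_hermitian_onD(3)[OF H, of ?s ?s] s by simp
qed

text \<open>
  By polarization, each entry of \<open>\<mu>\<close> is a combination of the positive measures
  \<open>E \<mapsto> \<mu> E l l\<close>, where \<open>l = e\<^sub>b\<close> or \<open>l = e\<^sub>b + a e\<^sub>c\<close> with \<open>a = 1, \<i>\<close>, and all of these are
  dominated by their sum. The resulting matrix of densities is made Hermitian by symmetrization;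
  it is positive semi-definite almost everywhere, and it is replaced by zero elsewhere.
\<close>

theorem hermitian_measure_density:
  fixes \<mu> :: "'v::euclidean_space set \<Rightarrow> ('w::euclidean_space \<Rightarrow> complex) \<Rightarrow> ('w \<Rightarrow> complex) \<Rightarrow> complex"
  assumes \<mu>: "hermitian_measure_on {l. linear l} \<mu>"
  obtains M :: "'v measure" and H where "finite_borel_measure M"
    "\<And>b b'. b \<in> Basis \<Longrightarrow> b' \<in> Basis \<Longrightarrow> finite_borel_measure.has_density M
       (\<lambda>E. \<mu> E (\<lambda>w. of_real (dual_basis b w)) (\<lambda>w. of_real (dual_basis b' w))) (H b b')"
    "\<And>\<xi>. psd_matrix Basis (\<lambda>b b'. H b b' \<xi>)"
proof -
  define e :: "'w \<Rightarrow> 'w \<Rightarrow> complex" where "e b = (\<lambda>w. of_real (dual_basis b w))" for b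
  define c :: "complex \<Rightarrow> 'w \<Rightarrow> 'w \<Rightarrow> 'w \<Rightarrow> complex" where "c a b b' = (\<lambda>t. 1 * e b t + a * e b' t)" for a b b'
  have psd: "psd_hermitian_on {l. linear l} (\<mu> E)" if "E \<in> sets borel" for E
    using \<mu> that unfolding hermitian_measure_on_def by blast
  have sums: "(\<lambda>i. \<mu> (A i) x y) sums \<mu> (\<Union>i. A i) x y"
    if "linear x" "linear y" "range A \<subseteq> sets borel" "disjoint_family A" for x y and A :: "nat \<Rightarrow> 'v set"
    using \<mu> that unfolding hermitian_measure_on_def by blast
  have le: "linear (e b)" for b
    unfolding e_def dual_basis_def by (rule linearI) (simp_all add: inner_add_left scaleR_conv_of_real)
  have lc: "linear (c a b b')" for a b b'
    unfolding c_def by (intro linear_complex_combination le)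
  define L where "L = e ` Basis \<union> (\<lambda>(a, b, b'). c a b b') ` ({1, \<i>} \<times> Basis \<times> Basis)"
  have finL: "finite L" unfolding L_def by auto
  have linL: "linear l" if "l \<in> L" for l using that le lc unfolding L_def by auto
  define m where "m l E = Re (\<mu> E l l)" for l E
  have m_nonneg: "0 \<le> m l E" if "l \<in> L" "E \<in> sets borel" for l E
    unfolding m_def using psd_hermitian_onD(3)[OF psd[OF that(2)], of l l] linL[OF that(1)] by simp
  have m_sums: "(\<lambda>i. m l (A i)) sums m l (\<Union>i. A i)"
    if "l \<in> L" "range A \<subseteq> sets borel" "disjoint_family A" for l and A :: "nat \<Rightarrow> 'v set"
    unfolding m_def by (intro sums_Re sums that linL)
  have "\<exists>N. finite_borel_measure N \<and> (\<forall>E\<in>sets borel. emeasure N E = ennreal (\<Sum>l\<in>L. m l E))"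
    by (rule finite_borel_measure_of_real) (auto intro!: sum_nonneg m_nonneg sums_sum m_sums)
  then obtain M where M: "finite_borel_measure M"
    "\<And>E. E \<in> sets borel \<Longrightarrow> emeasure M E = ennreal (\<Sum>l\<in>L. m l E)" by blast
  interpret finite_borel_measure M by fact
  have "\<exists>D. has_density (\<lambda>E. complex_of_real (m l E)) D" if l: "l \<in> L" for l
  proof -
    have "\<exists>N. finite_borel_measure N \<and> (\<forall>E\<in>sets borel. emeasure N E = ennreal (m l E))"
      by (rule finite_borel_measure_of_real) (auto intro: m_nonneg m_sums l)
    then obtain N where N: "finite_borel_measure N"
      "\<And>E. E \<in> sets borel \<Longrightarrow> emeasure N E = ennreal (m l E)" by blast
    show ?thesis
    proof (rule has_density_Radon_Nikodym[OF N m_nonneg[OF l]])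
      fix E :: "'v set" assume E: "E \<in> sets borel"
      have "m l E \<le> (\<Sum>l\<in>L. m l E)"
        by (rule member_le_sum[OF l _ finL]) (auto intro: m_nonneg E)
      then show "emeasure N E \<le> emeasure M E" unfolding N(2)[OF E] M(2)[OF E] by (rule ennreal_leI)
    qed
  qed
  then obtain D where D: "\<And>l. l \<in> L \<Longrightarrow> has_density (\<lambda>E. complex_of_real (m l E)) (D l)" by metis
  \<comment> \<open>The polarization identity solved for the off-diagonal entry: a = 1 gives the
    real part, a = \<i> the imaginary part.\<close>
  define h where "h b b' x = 1 / 2 * (D (c 1 b b') x + (- 1) * (D (e b) x + D (e b') x))
    + \<i> / 2 * (D (c \<i> b b') x + (- 1) * (D (e b) x + D (e b') x))" for b b' x
  have h: "has_density (\<lambda>E. \<mu> E (e b) (e b')) (h b b')" if b: "b \<in> Basis" "b' \<in> Basis" for b b'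
  proof -
    have "c a b b' \<in> L" if "a \<in> {1, \<i>}" for a
      unfolding L_def using b that by (intro UnI2 image_eqI[of _ _ "(a, b, b')"]) auto
    then have in_L: "e b \<in> L" "e b' \<in> L" "c 1 b b' \<in> L" "c \<i> b b' \<in> L"
      using b unfolding L_def by auto
    have "has_density (\<lambda>E. 1 / 2 * (complex_of_real (m (c 1 b b') E) + (- 1) * (complex_of_real (m (e b) E) + complex_of_real (m (e b') E)))
      + \<i> / 2 * (complex_of_real (m (c \<i> b b') E) + (- 1) * (complex_of_real (m (e b) E) + complex_of_real (m (e b') E)))) (h b b')"
      unfolding h_def by (intro has_density_add has_density_cmult D in_L)
    then show ?thesis
    proof (rule has_density_cong)
      fix E :: "'v set" assume E: "E \<in> sets borel"
      have "m (c a b b') E = m (e b) E + (cmod a)\<^sup>2 * m (e b') E + 2 * Re (a * cnj (\<mu> E (e b) (e b')))" for a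
        unfolding m_def c_def by (rule psd_hermitian_polarization[OF psd[OF E] le le])
      then show "\<mu> E (e b) (e b') = 1 / 2 * (complex_of_real (m (c 1 b b') E) + (- 1) * (complex_of_real (m (e b) E) + complex_of_real (m (e b') E)))
      + \<i> / 2 * (complex_of_real (m (c \<i> b b') E) + (- 1) * (complex_of_real (m (e b) E) + complex_of_real (m (e b') E)))"
        by (simp add: complex_eq_iff)
    qed
  qed
  define k where "k b b' x = 1 / 2 * (h b b' x + cnj (h b' b x))" for b b' x
  have k: "has_density (\<lambda>E. \<mu> E (e b) (e b')) (k b b')" if b: "b \<in> Basis" "b' \<in> Basis" for b b'
  proof -
    have "has_density (\<lambda>E. 1 / 2 * (\<mu> E (e b) (e b') + cnj (\<mu> E (e b') (e b)))) (k b b')"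
      unfolding k_def by (intro has_density_cmult has_density_add has_density_cnj h b)
    then show ?thesis
    proof (rule has_density_cong)
      fix E :: "'v set" assume E: "E \<in> sets borel"
      have "\<mu> E (e b') (e b) = cnj (\<mu> E (e b) (e b'))"
        using psd_hermitian_onD(2)[OF psd[OF E], of "e b" "e b'"] le by simp
      then show "\<mu> E (e b) (e b') = 1 / 2 * (\<mu> E (e b) (e b') + cnj (\<mu> E (e b') (e b)))" by simp
    qed
  qed
  have k_meas [measurable]: "k b b' \<in> borel_measurable M" if "b \<in> Basis" "b' \<in> Basis" for b b'
    using k[OF that] unfolding has_density_def by auto
  \<comment> \<open>Complex coefficient vectors are encoded by pairs of real vectors, so that the
    topology of a Euclidean space is available for them.\<close>
  define z :: "'w \<times> 'w \<Rightarrow> 'w \<Rightarrow> complex" where "z p b = Complex (fst p \<bullet> b) (snd p \<bullet> b)" for p b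
  define Q where "Q p x = (\<Sum>b\<in>Basis. \<Sum>b'\<in>Basis. z p b * cnj (z p b') * k b b' x)" for p x
  have Q_meas [measurable]: "Q p \<in> borel_measurable M" for p
    unfolding Q_def by (intro borel_measurable_sum borel_measurable_times k_meas) auto
  have Q_AE: "AE x in M. 0 \<le> Re (Q p x)" for p
  proof (rule has_density_nonneg)
    show "has_density (\<lambda>E. \<Sum>b\<in>Basis. \<Sum>b'\<in>Basis. z p b * cnj (z p b') * \<mu> E (e b) (e b')) (Q p)"
      unfolding Q_def by (intro has_density_sum has_density_cmult k) auto
    show "0 \<le> Re (\<Sum>b\<in>Basis. \<Sum>b'\<in>Basis. z p b * cnj (z p b') * \<mu> E (e b) (e b'))" if "E \<in> sets borel" for E
      by (rule psd_hermitian_sum_sum[OF psd[OF that]]) (auto intro: le)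
  qed
  \<comment> \<open>The exceptional null set depends on the vector p. Testing countably many p
    leaves one null set; density of C and continuity in p then give non-negativity for all p outside
    of it.\<close>
  obtain C :: "('w \<times> 'w) set" where C: "countable C" "\<And>U. open U \<Longrightarrow> U \<noteq> {} \<Longrightarrow> \<exists>p\<in>C. p \<in> U"
    using countable_dense_exists[where 'a="'w \<times> 'w"] by blast
  define G where "G = {x. \<forall>p\<in>C. 0 \<le> Re (Q p x)}"
  have "{x \<in> space M. \<forall>p\<in>C. 0 \<le> Re (Q p x)} \<in> sets M"
    using C(1) by measurable
  then have [measurable]: "G \<in> sets M" unfolding G_def by (simp add: space_eq_UNIV)
  have G_AE: "AE x in M. x \<in> G"
    unfolding G_def using Q_AE C(1) by (simp add: AE_ball_countable)
  have G: "0 \<le> Re (Q p x)" if "x \<in> G" for p x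
  proof (rule ccontr)
    assume "\<not> 0 \<le> Re (Q p x)"
    moreover have "continuous_on UNIV (\<lambda>p. Re (Q p x))"
      unfolding Q_def z_def Complex_eq by (intro continuous_intros)
    then have "open {p. Re (Q p x) < 0}" by (intro open_Collect_less continuous_on_const)
    moreover from calculation have "p \<in> {p. Re (Q p x) < 0}" by simp
    ultimately have "\<exists>d\<in>C. d \<in> {p. Re (Q p x) < 0}" using C(2) by blast
    then obtain d where "d \<in> C" "Re (Q d x) < 0" by blast
    then show False using that unfolding G_def by force
  qed
  define H where "H b b' x = indicator G x * k b b' x" for b b' x
  have H: "has_density (\<lambda>E. \<mu> E (e b) (e b')) (H b b')" if b: "b \<in> Basis" "b' \<in> Basis" for b b'
  proof (rule has_density_AE[OF k[OF b]])
    show "AE x in M. H b b' x = k b b' x" using G_AE by eventually_elim (simp add: H_def)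
    have [measurable]: "k b b' \<in> borel_measurable M" by (rule k_meas[OF b])
    show "H b b' \<in> borel_measurable M" unfolding H_def by measurable
  qed
  have "psd_matrix Basis (\<lambda>b b'. H b b' x)" for x
    unfolding psd_matrix_def
  proof (intro conjI ballI allI)
    show "H b' b x = cnj (H b b' x)" for b b'
      unfolding H_def k_def by (simp add: indicator_def add.commute)
    fix y :: "'w \<Rightarrow> complex"
    define p where "p = ((\<Sum>b\<in>Basis. Re (y b) *\<^sub>R b), (\<Sum>b\<in>Basis. Im (y b) *\<^sub>R b))"
    have "z p b = y b" if "b \<in> Basis" for b
      unfolding z_def p_def using that by (simp add: complex_eq_iff)
    then have "(\<Sum>b\<in>Basis. \<Sum>b'\<in>Basis. y b * cnj (y b') * H b b' x) = indicator G x * Q p x"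
      unfolding Q_def H_def sum_distrib_left by (intro sum.cong refl) (simp add: mult_ac)
    then show "0 \<le> Re (\<Sum>b\<in>Basis. \<Sum>b'\<in>Basis. y b * cnj (y b') * H b b' x)"
      using G[of x p] by (simp add: indicator_def)
  qed
  with H show thesis
    using that[OF M(1), of H] unfolding e_def by blast
qed

section \<open>Stationary Gaussian fields\<close>

locale stationary_gaussian_field = prob_space M for M :: "'a measure" +
  fixes X :: "'v::euclidean_space \<Rightarrow> 'a \<Rightarrow> 'w::euclidean_space"
  assumes gaussian_field: "gaussian_field M X"
    and centered_field: "centered_field M X"
    and stationary_field: "stationary_field M X"
    and nondegenerate: "nondegenerate_cov (field_cov M X)"
begin

lemma measurable_joint: "(\<lambda>(v, \<omega>). X v \<omega>) \<in> borel_measurable (borel \<Otimes>\<^sub>M M)"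
  using gaussian_field by (simp add: gaussian_field_def)

lemma measurable_field [measurable]: "X v \<in> borel_measurable M"
  using measurable_compose[OF measurable_Pair[OF measurable_const measurable_ident_sets[OF refl]] measurable_joint, of v]
  by simp

lemma gaussian_linear:
  "finite S \<Longrightarrow> (\<And>v. v \<in> S \<Longrightarrow> linear (l v)) \<Longrightarrow> gaussian_rv M (\<lambda>\<omega>. \<Sum>v\<in>S. l v (X v \<omega>))"
  using gaussian_field unfolding gaussian_field_def by blast

lemma linear_inner_left: "linear (\<lambda>x :: 'w. a \<bullet> x)"
  by (intro bounded_linear.linear bounded_linear_inner_right)

lemma
  shows integrable_field: "integrable M (\<lambda>\<omega>. a \<bullet> X v \<omega>)"
    and expectation_field: "expectation (\<lambda>\<omega>. a \<bullet> X v \<omega>) = 0"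
proof -
  have "has_bochner_integral M (\<lambda>\<omega>. a \<bullet> X v \<omega>) (a \<bullet> 0)"
    using centered_field has_bochner_integral_bounded_linear[OF bounded_linear_inner_right]
    unfolding centered_field_def by blast
  then show "integrable M (\<lambda>\<omega>. a \<bullet> X v \<omega>)" "expectation (\<lambda>\<omega>. a \<bullet> X v \<omega>) = 0"
    by (auto simp: has_bochner_integral_iff)
qed

lemma gaussian_vector_field: "gaussian_vector M (X v)"
proof unfold_locales
  show "gaussian_rv M (\<lambda>\<omega>. u \<bullet> X v \<omega>)" for u
    using gaussian_linear[of "{v}" "\<lambda>_ x. u \<bullet> x"] linear_inner_left by simp
qed (simp_all add: expectation_field)

lemma gaussian_vector_field_pair: "gaussian_vector M (\<lambda>\<omega>. (X v \<omega>, X w \<omega>))"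
proof unfold_locales
  fix u :: "'w \<times> 'w"
  show "gaussian_rv M (\<lambda>\<omega>. u \<bullet> (X v \<omega>, X w \<omega>))"
  \<comment> \<open>For v = w the set \<open>{v, w}\<close> has one element, so the two linear forms
    have to be added before \<open>gaussian_linear\<close> is applied.\<close>
  proof (cases "v = w")
    case True
    then show ?thesis
      using gaussian_linear[of "{v}" "\<lambda>_ x. (fst u + snd u) \<bullet> x"] linear_inner_left[of "fst u + snd u"]
      by (simp add: inner_prod_def inner_add_left)
  next
    case False
    have "gaussian_rv M (\<lambda>\<omega>. \<Sum>x\<in>{v, w}. (if x = v then fst u else snd u) \<bullet> X x \<omega>)"
      by (rule gaussian_linear) (auto intro: linear_inner_left)
    with False show ?thesis by (auto simp: inner_prod_def)
  qed
  show "expectation (\<lambda>\<omega>. u \<bullet> (X v \<omega>, X w \<omega>)) = 0"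
    by (simp add: inner_prod_def integrable_field expectation_field)
qed measurable

lemma stationary:
  "finite S \<Longrightarrow> distr M (PiM S (\<lambda>_. borel)) (\<lambda>\<omega>. \<lambda>v\<in>S. X (v + u) \<omega>) =
    distr M (PiM S (\<lambda>_. borel)) (\<lambda>\<omega>. \<lambda>v\<in>S. X v \<omega>)"
  using stationary_field unfolding stationary_field_def by blast

lemma law_field: "distr M borel (X v) = distr M borel (X 0)"
proof -
  have "distr M (PiM {0} (\<lambda>_. borel)) (\<lambda>\<omega>. \<lambda>x\<in>{0}. X (x + v) \<omega>) =
      distr M (PiM {0} (\<lambda>_. borel)) (\<lambda>\<omega>. \<lambda>x\<in>{0}. X x \<omega>)"
    by (rule stationary) simp
  then have "distr (distr M (PiM {0} (\<lambda>_. borel)) (\<lambda>\<omega>. \<lambda>x\<in>{0}. X (x + v) \<omega>)) borel (\<lambda>y. y 0) =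
      distr (distr M (PiM {0} (\<lambda>_. borel)) (\<lambda>\<omega>. \<lambda>x\<in>{0}. X x \<omega>)) borel (\<lambda>y. y 0)" by simp
  moreover have "distr (distr M (PiM {0} (\<lambda>_. borel)) (\<lambda>\<omega>. \<lambda>x\<in>{0}. X (x + t) \<omega>)) borel (\<lambda>y. y 0) =
     distr M borel (X t)" for t
    by (subst distr_distr) (auto simp: comp_def intro!: measurable_restrict)
  from this[of v] this[of 0] show ?thesis using calculation by simp
qed

text \<open>Stationarity for the points v - w and 0, translated by w.\<close>

lemma expectation_field_product:
  "expectation (\<lambda>\<omega>. (a \<bullet> X v \<omega>) * (b \<bullet> X w \<omega>)) = field_cov M X (v - w) (dual_basis a) (dual_basis b)"
proof -
  let ?S = "{v - w, 0}"
  let ?P = "PiM ?S (\<lambda>_. borel) :: ('v \<Rightarrow> 'w) measure"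
  let ?F = "\<lambda>y :: 'v \<Rightarrow> 'w. (a \<bullet> y (v - w)) * (b \<bullet> y 0)"
  have F: "?F \<in> borel_measurable ?P"
    by (intro borel_measurable_times borel_measurable_inner borel_measurable_const measurable_component_singleton) auto
  have "distr M ?P (\<lambda>\<omega>. \<lambda>x\<in>?S. X (x + w) \<omega>) = distr M ?P (\<lambda>\<omega>. \<lambda>x\<in>?S. X x \<omega>)"
    by (rule stationary) simp
  then have "(\<integral>y. ?F y \<partial>distr M ?P (\<lambda>\<omega>. \<lambda>x\<in>?S. X (x + w) \<omega>)) = (\<integral>y. ?F y \<partial>distr M ?P (\<lambda>\<omega>. \<lambda>x\<in>?S. X x \<omega>))"
    by simp
  moreover have "(\<integral>y. ?F y \<partial>distr M ?P (\<lambda>\<omega>. \<lambda>x\<in>?S. X (x + t) \<omega>)) =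
      expectation (\<lambda>\<omega>. (a \<bullet> X (v - w + t) \<omega>) * (b \<bullet> X t \<omega>))" for t
    by (subst integral_distr[OF _ F]) (auto intro!: measurable_restrict)
  from this[of w] this[of 0]
  have "(\<integral>y. ?F y \<partial>distr M ?P (\<lambda>\<omega>. \<lambda>x\<in>?S. X (x + w) \<omega>)) = expectation (\<lambda>\<omega>. (a \<bullet> X v \<omega>) * (b \<bullet> X w \<omega>))"
    "(\<integral>y. ?F y \<partial>distr M ?P (\<lambda>\<omega>. \<lambda>x\<in>?S. X x \<omega>)) = expectation (\<lambda>\<omega>. (a \<bullet> X (v - w) \<omega>) * (b \<bullet> X 0 \<omega>))"
    by simp_all
  ultimately show ?thesis
    by (simp add: field_cov_def dual_basis_def inner_commute)
qed

lemma linear_integrable: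
  fixes l m :: "'w \<Rightarrow> real"
  assumes "linear l" "linear m"
  shows "integrable M (\<lambda>\<omega>. l (X v \<omega>) * m (X v \<omega>))"
proof -
  interpret gaussian_vector M "X v" by (rule gaussian_vector_field)
  define u k where "u = (\<Sum>b\<in>Basis. l b *\<^sub>R b)" and "k = (\<Sum>b\<in>Basis. m b *\<^sub>R b)"
  have "l = (\<lambda>x. u \<bullet> x)" "m = (\<lambda>x. k \<bullet> x)"
    unfolding u_def k_def using assms by (auto intro!: ext bounded_linear_eq_inner)
  then show ?thesis using integrable_inner2[of u k] by simp
qed

lemma dual_inner_field_cov: "dual_inner (field_cov M X 0)"
proof
  fix l l' m :: "'w \<Rightarrow> real"
  assume l: "linear l" and m: "linear m"
  show "linear l' \<Longrightarrow> field_cov M X 0 (\<lambda>x. l x + l' x) m = field_cov M X 0 l m + field_cov M X 0 l' m"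
    unfolding field_cov_def distrib_right
    by (intro Bochner_Integration.integral_add linear_integrable l m)
  show "field_cov M X 0 (\<lambda>x. c * l x) m = c * field_cov M X 0 l m" for c
    unfolding field_cov_def by (simp add: mult.assoc)
  show "field_cov M X 0 l m = field_cov M X 0 m l"
    unfolding field_cov_def by (simp add: mult.commute)
next
  fix l :: "'w \<Rightarrow> real" assume "linear l" "l \<noteq> (\<lambda>_. 0)"
  then show "field_cov M X 0 l l > 0" using nondegenerate unfolding nondegenerate_cov_def by blast
qed

sublocale dual_inner "field_cov M X 0" by (rule dual_inner_field_cov)

lemma gaussian_law_field: "gaussian_law (field_cov M X 0) M (X 0)"
proof -
  interpret gaussian_vector M "X 0" by (rule gaussian_vector_field)
  show ?thesis
    by unfold_locales (simp add: cov_def expectation_field_product form_def)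
qed

lemma gaussian_pair_field:
  "gaussian_pair (field_cov M X 0) M (X v) (X w)
    (\<lambda>a b. field_cov M X (v - w) (dual_basis a) (dual_basis b))"
proof -
  interpret gaussian_vector M "\<lambda>\<omega>. (X v \<omega>, X w \<omega>)" by (rule gaussian_vector_field_pair)
  show ?thesis
    by unfold_locales (simp_all add: cov_def inner_prod_def expectation_field_product form_def)
qed

lemma gaussian_integrated_field:
  assumes "integrable lborel \<psi>"
  shows "gaussian_integrated_field (field_cov M X 0) M X \<psi>
    (\<lambda>v w a b. field_cov M X (v - w) (dual_basis a) (dual_basis b))"
  unfolding gaussian_integrated_field_def gaussian_integrated_field_axioms_def integrated_field_def
    integrated_field_axioms_def
  using prob_space_axioms measurable_joint law_field assms gaussian_law_field gaussian_pair_field by blast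

text \<open>On dual basis elements the imaginary parts vanish, so the sesquilinear extension reduces
  to the real covariance and the spectral representation can be read off entry by entry.\<close>

lemma spectral_density_char:
  assumes "finite_borel_measure N" and spec: "is_spectral_measure (field_cov M X) \<mu>"
    and H: "finite_borel_measure.has_density N
       (\<lambda>E. \<mu> E (\<lambda>w. of_real (dual_basis b w)) (\<lambda>w. of_real (dual_basis b' w))) h"
  shows "complex_of_real (field_cov M X v (dual_basis b) (dual_basis b')) = (\<integral>\<xi>. h \<xi> * char_exp \<xi> v \<partial>N)"
proof -
  interpret N: finite_borel_measure N by fact
  have lin: "linear (\<lambda>w::'w. complex_of_real (dual_basis b w))" for b
    unfolding dual_basis_def by (rule linearI) (simp_all add: inner_add_left scaleR_conv_of_real)
  have "complex_of_real (field_cov M X v (dual_basis b) (dual_basis b')) =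
     sesquilinear_ext (field_cov M X v) (\<lambda>w. of_real (dual_basis b w)) (\<lambda>w. of_real (dual_basis b' w))"
    unfolding sesquilinear_ext_def by (simp add: field_cov_def)
  also have "\<dots> = complex_integral (\<lambda>E. \<mu> E (\<lambda>w. of_real (dual_basis b w)) (\<lambda>w. of_real (dual_basis b' w)))
      (\<lambda>\<xi>. char_exp \<xi> v)"
    using spec lin unfolding is_spectral_measure_def char_exp_def by blast
  also have "\<dots> = (\<integral>\<xi>. h \<xi> * char_exp \<xi> v \<partial>N)"
    by (rule N.complex_integral_density[OF H, where C=1]) auto
  finally show ?thesis .
qed

end


section \<open>Scaling\<close>

lemma lborel_scale:
  assumes "s > 0"
  shows "(lborel :: 'v::euclidean_space measure) = density (distr lborel borel (\<lambda>x. s *\<^sub>R x)) (\<lambda>_. ennreal (s ^ DIM('v)))"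
  using lborel_affine[of s "0 :: 'v"] assms by simp

lemma integrable_lborel_scale:
  fixes \<phi> :: "'v::euclidean_space \<Rightarrow> real"
  assumes \<phi>: "integrable lborel \<phi>" and s: "s > 0"
  shows "integrable lborel (\<lambda>v. \<phi> (v /\<^sub>R s))"
proof -
  have [measurable]: "\<phi> \<in> borel_measurable borel" using \<phi> by auto
  have "integrable (density (distr lborel borel (\<lambda>x. s *\<^sub>R x)) (\<lambda>_. ennreal (s ^ DIM('v)))) (\<lambda>v. \<phi> (v /\<^sub>R s))"
    using \<phi> s by (subst integrable_density) (auto simp: integrable_distr_eq)
  then show ?thesis using lborel_scale[OF s, where 'v='v] by simp
qed

lemma integral_lborel_scale:
  fixes f :: "'v::euclidean_space \<Rightarrow> complex"
  assumes [measurable]: "f \<in> borel_measurable borel" and s: "s > 0"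
  shows "(\<integral>v. f v \<partial>lborel) = of_real (s ^ DIM('v)) * (\<integral>v. f (s *\<^sub>R v) \<partial>lborel)"
proof -
  have "(\<integral>v. f v \<partial>lborel) = (\<integral>v. f v \<partial>density (distr lborel borel (\<lambda>x. s *\<^sub>R x)) (\<lambda>_. ennreal (s ^ DIM('v))))"
    using lborel_scale[OF s, where 'v='v] by simp
  also have "\<dots> = (\<integral>v. s ^ DIM('v) *\<^sub>R f v \<partial>distr lborel borel (\<lambda>x. s *\<^sub>R x))"
    using s by (intro integral_density) auto
  also have "\<dots> = (\<integral>v. s ^ DIM('v) *\<^sub>R f (s *\<^sub>R v) \<partial>lborel)"
    by (rule integral_distr) auto
  finally show ?thesis by (simp add: scaleR_conv_of_real)
qed

text \<open>The normalization contributes s^(-d/2) and the change of variables s^d. Their product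
  squared is the factor s^d of the scaled window.\<close>

lemma transform_scaled_window:
  fixes \<phi> :: "'v::euclidean_space \<Rightarrow> real"
  assumes \<phi>: "integrable lborel \<phi>" and s: "s > 0"
  shows "(cmod (transform (\<lambda>v. s powr (- real DIM('v) / 2) * \<phi> (v /\<^sub>R s)) \<xi>))\<^sup>2 =
    scaled_window \<phi> s \<xi>"
proof -
  let ?d = "real DIM('v)" and ?c = "s powr (- real DIM('v) / 2)"
  have [measurable]: "\<phi> \<in> borel_measurable borel" using \<phi> by auto
  have fourier: "fourier \<phi> (s *\<^sub>R \<xi>) = cnj (\<integral>v. complex_of_real (\<phi> v) * char_exp (s *\<^sub>R \<xi>) v \<partial>lborel)"
    unfolding fourier_def Bochner_Integration.integral_cnj[symmetric]
    by (intro Bochner_Integration.integral_cong refl) (simp add: char_exp_def exp_cnj)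
  have "transform (\<lambda>v. ?c * \<phi> (v /\<^sub>R s)) \<xi> =
     (\<integral>v. of_real ?c * (complex_of_real (\<phi> (v /\<^sub>R s)) * char_exp \<xi> v) \<partial>lborel)"
    unfolding transform_def by (simp add: mult.assoc)
  also have "\<dots> = of_real ?c * (\<integral>v. complex_of_real (\<phi> (v /\<^sub>R s)) * char_exp \<xi> v \<partial>lborel)"
    by (rule integral_mult_right_zero)
  also have "(\<integral>v. complex_of_real (\<phi> (v /\<^sub>R s)) * char_exp \<xi> v \<partial>lborel) =
     of_real (s ^ DIM('v)) * (\<integral>v. complex_of_real (\<phi> ((s *\<^sub>R v) /\<^sub>R s)) * char_exp \<xi> (s *\<^sub>R v) \<partial>lborel)"
    by (rule integral_lborel_scale[OF _ s]) measurable
  also have "(\<integral>v. complex_of_real (\<phi> ((s *\<^sub>R v) /\<^sub>R s)) * char_exp \<xi> (s *\<^sub>R v) \<partial>lborel) = cnj (fourier \<phi> (s *\<^sub>R \<xi>))"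
    unfolding fourier complex_cnj_cnj using s
    by (intro Bochner_Integration.integral_cong refl) (simp add: char_exp_def)
  finally have "cmod (transform (\<lambda>v. ?c * \<phi> (v /\<^sub>R s)) \<xi>) = ?c * s ^ DIM('v) * cmod (fourier \<phi> (s *\<^sub>R \<xi>))"
    using s by (simp add: norm_mult norm_power)
  moreover have "(?c * s ^ DIM('v))\<^sup>2 = s ^ DIM('v)"
  proof -
    have "?c * s ^ DIM('v) = s powr (?d / 2)"
      using s by (simp add: powr_realpow[symmetric] powr_add[symmetric])
    then have "(?c * s ^ DIM('v))\<^sup>2 = s powr (?d / 2) * s powr (?d / 2)" by (simp add: power2_eq_square)
    also have "\<dots> = s ^ DIM('v)" using s by (simp add: powr_realpow[symmetric] powr_add[symmetric])
    finally show ?thesis .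
  qed
  ultimately show ?thesis
    by (simp add: scaled_window_def spectral_window_def power_mult_distrib)
qed

theorem theorem1p1:
  fixes M :: "'a measure"
    and X :: "'v::euclidean_space \<Rightarrow> 'a \<Rightarrow> 'w::euclidean_space"
    and \<mu> :: "'v set \<Rightarrow> ('w \<Rightarrow> complex) \<Rightarrow> ('w \<Rightarrow> complex) \<Rightarrow> complex"
    and \<Omega> :: "'v \<Rightarrow> ('w \<Rightarrow> real) \<Rightarrow> ('w \<Rightarrow> real) \<Rightarrow> real"
    and \<eta> :: "'w measure"
    and f :: "'w \<Rightarrow> real"
    and \<phi> :: "'v \<Rightarrow> real"
    and s :: real
  assumes "prob_space M"
    and "gaussian_field M X"
    and "centered_field M X"
    and "stationary_field M X"
    and "\<Omega> = field_cov M X"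
    and "continuous_cov \<Omega>"
    and "nondegenerate_cov \<Omega>"
    and "is_spectral_measure \<Omega> \<mu>"
    and "\<eta> = distr M borel (X 0)"
    and "square_integrable \<eta> f"
    and "integrable lborel \<phi>"
    and "square_integrable lborel \<phi>"
    and "(\<integral>v. (\<phi> v)\<^sup>2 \<partial>lborel) = 1"
    and "s > 0"
  shows "square_integrable M (field_functional X f s \<phi>) \<and>
    (\<forall>q\<ge>1. square_integrable M (field_functional X (chaos_proj (\<Omega> 0) \<eta> q f) s \<phi>)) \<and>
    (\<lambda>n. prob_space.variance M (field_functional X (chaos_proj (\<Omega> 0) \<eta> (Suc n) f) s \<phi>))
      sums prob_space.variance M (field_functional X f s \<phi>) \<and>
    (\<forall>q\<ge>1. prob_space.variance M (field_functional X (chaos_proj (\<Omega> 0) \<eta> q f) s \<phi>) =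
       1 / fact q * (\<integral>\<xi>. scaled_window \<phi> s \<xi>
         \<partial>diagonal_measure (conv_power \<mu> q)
           (\<lambda>ws. complex_of_real (chaos_coeff (\<Omega> 0) \<eta> f ws))))"
proof -
  note \<Omega> = \<open>\<Omega> = field_cov M X\<close> and \<eta> = \<open>\<eta> = distr M borel (X 0)\<close>
  interpret field: stationary_gaussian_field M X
    using assms(1-4,7) unfolding \<Omega> stationary_gaussian_field_def stationary_gaussian_field_axioms_def by blast
  \<comment> \<open>With the normalizing power inside the weight, all functionals become instances
    of \<open>weighted_integral\<close>.\<close>
  define \<psi> where "\<psi> v = s powr (- real DIM('v) / 2) * \<phi> (v /\<^sub>R s)" for v
  have \<psi>: "integrable lborel \<psi>"
    unfolding \<psi>_def[abs_def] using integrable_lborel_scale[OF assms(11,14)] by simp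
  \<comment> \<open>A function of one point: by stationarity the cross covariance of X v and X w is
    \<open>c (v - w)\<close>, the form to which the spectral representation applies.\<close>
  define c where "c v a b = field_cov M X v (dual_basis a) (dual_basis b)" for v a b
  interpret Z: gaussian_integrated_field "field_cov M X 0" M X \<psi> "\<lambda>v w. c (v - w)"
    using field.gaussian_integrated_field[OF \<psi>] unfolding c_def[abs_def] .
  have functional: "field_functional X g s \<phi> = Z.weighted_integral g" for g
    unfolding field_functional_def[abs_def] Z.weighted_integral_def[abs_def] \<psi>_def
    by (simp add: mult.assoc flip: integral_mult_right_zero)
  have f: "square_integrable (distr M borel (X 0)) f" using assms(10) unfolding \<eta> .
  obtain N :: "'v measure" and H where N: "finite_borel_measure N"
    and H: "\<And>b b'. b \<in> Basis \<Longrightarrow> b' \<in> Basis \<Longrightarrow> finite_borel_measure.has_density N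
       (\<lambda>E. \<mu> E (\<lambda>w. of_real (dual_basis b w)) (\<lambda>w. of_real (dual_basis b' w))) (H b b')"
    and psd: "\<And>\<xi>. psd_matrix Basis (\<lambda>b b'. H b b' \<xi>)"
    by (rule hermitian_measure_density) (use assms(8) in \<open>auto simp: is_spectral_measure_def\<close>)
  interpret N: finite_borel_measure N by fact
  have char: "complex_of_real (c v b b') = (\<integral>\<xi>. H b b' \<xi> * char_exp \<xi> v \<partial>N)"
    if "b \<in> Basis" "b' \<in> Basis" for v b b'
    unfolding c_def
    by (rule field.spectral_density_char[where \<mu>=\<mu>])
       (fact N, use assms(8) in \<open>simp add: \<Omega>\<close>, rule H[OF that])
  have "prob_space.variance M (Z.weighted_integral (chaos_proj (field_cov M X 0) (distr M borel (X 0)) q f)) =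
       1 / fact q * (\<integral>\<xi>. scaled_window \<phi> s \<xi> \<partial>diagonal_measure (conv_power \<mu> q)
           (\<lambda>ws. complex_of_real (chaos_coeff (field_cov M X 0) (distr M borel (X 0)) f ws)))" if "q \<ge> 1" for q
  proof -
    let ?g = "chaos_coeff (field_cov M X 0) (distr M borel (X 0)) f"
    have "(\<integral>p. \<psi> (fst p) * \<psi> (snd p) * tensor_contraction (c (fst p - snd p)) q ?g ?g \<partial>(lborel \<Otimes>\<^sub>M lborel)) =
      (\<integral>\<xi>. (cmod (transform \<psi> \<xi>))\<^sup>2 \<partial>diagonal_measure (conv_power \<mu> q) (\<lambda>I. of_real (?g I)))"
      by (rule N.integral_tensor_contraction) (fact H psd char \<psi>)+
    also have "(\<lambda>\<xi>. (cmod (transform \<psi> \<xi>))\<^sup>2) = scaled_window \<phi> s"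
      unfolding \<psi>_def[abs_def] using transform_scaled_window[OF assms(11,14)] by blast
    finally show ?thesis
      unfolding Z.variance_chaos_functional[OF that] times_divide_eq_right integral_divide_zero by simp
  qed
  \<comment> \<open>The series over \<open>Suc n\<close> starts at order 1, and each summand is
    covered by the formula just proved.\<close>
  then show ?thesis
    unfolding functional \<Omega> \<eta>
    using Z.variance_sums[OF f] Z.square_integrable_weighted_integral[OF f]
      Z.square_integrable_weighted_integral[OF Z.square_integrable_chaos_proj] by blast
qed

end
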